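(* Let $\mathbb X_n$ be random variables with values in $\mathcal X_n$, let $\mathbb V_n$ be random variables with values in $\mathcal V_n$, independent of $\mathbb X_n$, and let $\mathbb V_n^{(1)},\mathbb V_n^{(2)}$ be independent copies of $\mathbb V_n$. Let $\mathbb G_n=\mathbb G_n(\mathbb X_n)$ and $\mathbb G_n^{(j)}=\mathbb G_n(\mathbb X_n,\mathbb V_n^{(j)})$, $j=1,2$, be maps with values in $\ell^\infty(T)$, constructed from $\mathbb X_n$ and from $(\mathbb X_n,\mathbb V_n^{(j)})$ respectively, such that each $\mathbb G_n(t)$, $\mathbb G_n^{(j)}(t)$, $t\in T$, is measurable. Assume that $\mathbb G_n$ is relatively compact. Then the following are equivalent: (i) as $n\to\infty$, $$\sup_{h\in\mathrm{BL}_1(\ell^\infty(T))}\bigl|\mathbb E[h(\mathbb G_n^{(1)})\mid\mathbb X_n]-\mathbb E[h(\mathbb G_n)]\bigr|\to0\quad\text{in outer probability},$$ and $\mathbb G_n^{(1)}$ is asymptotically measurable; (ii) $\bigl(\mathbb G_n,\mathbb G_n^{(1)},\mathbb G_n^{(2)}\bigr)\leftrightarrow_d\mathbb G_n^{\otimes3}$.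
   Context: $\ell^\infty(T)$ is the space of bounded functions $T\to\mathbb R$ with the uniform metric. $\mathrm{BL}_1(\ell^\infty(T))$ is the set of functions $h:\ell^\infty(T)\to\mathbb R$ that are bounded by $1$ and $1$-Lipschitz. $\mathbb G_n^{\otimes3}$ denotes the triple consisting of three independent copies of $\mathbb G_n$. Expectations of possibly non-measurable quantities are outer expectations; $\mathbb E[h(\mathbb G_n^{(1)})\mid\mathbb X_n]$ is the (outer) expectation with respect to $\mathbb V_n^{(1)}$ with $\mathbb X_n$ held fixed. $\mathbb V_n^{(1)},\mathbb V_n^{(2)}$ are independent of each other and of $\mathbb X_n$. For (not necessarily measurable) maps $X_n,Y_n$ from probability spaces to a metric space $\mathbb D$, with $\mathbb E^*,\mathbb E_*$ outer and inner expectation: $X_n\to_dX$ for a Borel measurable $X$ if $\mathbb E^*[f(X_n)]\to\mathbb E[f(X)]$ for all bounded continuous $f:\mathbb D\to\mathbb R$; $X_n$ is asymptotically measurable if $\mathbb E^*[f(X_n)]-\mathbb E_*[f(X_n)]\to0$ for all such $f$; $X_n$ is relatively compact if every subsequence contains a further subsequence converging weakly to a tight Borel law; $X_n\leftrightarrow_dY_n$ if $|\mathbb E^*[f(X_n)]-\mathbb E^*[f(Y_n)]|\to0$ for all such $f$. *)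

theory Defs
  imports "HOL-Probability.Probability"
begin

text \<open>
  The space of bounded real functions on the index set \<open>T = UNIV :: 't set\<close> with the uniform metric:
  every function on a discrete space is continuous, and the library metric on
  bounded continuous functions is the supremum metric.
\<close>
type_synonym 't linf = "'t discrete \<Rightarrow>\<^sub>C real"

definition coord :: "'t linf \<Rightarrow> 't \<Rightarrow> real" where
  "coord z t = apply_bcontfun z (discrete t)"

text \<open>
  Only used for bounded \<open>f\<close> on probability spaces. There the measurable majorants of finite
  expectation may be taken real-valued, and the set below is nonempty and bounded below.
\<close>
definition outer_expectation :: "'w measure \<Rightarrow> ('w \<Rightarrow> real) \<Rightarrow> real" where
  "outer_expectation P f =
     Inf {integral\<^sup>L P U | U. integrable P U \<and> (\<forall>\<omega>\<in>space P. f \<omega> \<le> U \<omega>)}"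

definition inner_expectation :: "'w measure \<Rightarrow> ('w \<Rightarrow> real) \<Rightarrow> real" where
  "inner_expectation P f =
     Sup {integral\<^sup>L P L | L. integrable P L \<and> (\<forall>\<omega>\<in>space P. L \<omega> \<le> f \<omega>)}"

definition tendsto_zero_outer_prob :: "(nat \<Rightarrow> 'w measure) \<Rightarrow> (nat \<Rightarrow> 'w \<Rightarrow> real) \<Rightarrow> bool" where
  "tendsto_zero_outer_prob P Z \<longleftrightarrow>
     (\<forall>\<epsilon>>0. (\<lambda>n. outer_measure_of (P n) {\<omega> \<in> space (P n). \<bar>Z n \<omega>\<bar> > \<epsilon>}) \<longlonglongrightarrow> 0)"

definition bounded_continuous :: "('d::metric_space \<Rightarrow> real) set" where
  "bounded_continuous = {f. continuous_on UNIV f \<and> bounded (range f)}"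

definition BL1 :: "('d::metric_space \<Rightarrow> real) set" where
  "BL1 = {h. (\<forall>x. \<bar>h x\<bar> \<le> 1) \<and> 1-lipschitz_on UNIV h}"

definition borel_law :: "'d::metric_space measure \<Rightarrow> bool" where
  "borel_law \<mu> \<longleftrightarrow> prob_space \<mu> \<and> sets \<mu> = sets borel"

definition tight_law :: "'d::metric_space measure \<Rightarrow> bool" where
  "tight_law \<mu> \<longleftrightarrow> (\<forall>\<epsilon>>0. \<exists>K. compact K \<and> measure \<mu> K \<ge> 1 - \<epsilon>)"

text \<open>
  Below, \<open>Y n\<close> is an arbitrary map on the probability space \<open>P n\<close>, and the Borel measurable limit
  is represented by its law \<open>\<mu>\<close>.
\<close>
definition converges_weakly ::
  "(nat \<Rightarrow> 'w measure) \<Rightarrow> (nat \<Rightarrow> 'w \<Rightarrow> 'd::metric_space) \<Rightarrow> 'd measure \<Rightarrow> bool" where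
  "converges_weakly P Y \<mu> \<longleftrightarrow> borel_law \<mu> \<and>
     (\<forall>f\<in>bounded_continuous. (\<lambda>n. outer_expectation (P n) (\<lambda>\<omega>. f (Y n \<omega>))) \<longlonglongrightarrow> integral\<^sup>L \<mu> f)"

definition asymptotically_measurable ::
  "(nat \<Rightarrow> 'w measure) \<Rightarrow> (nat \<Rightarrow> 'w \<Rightarrow> 'd::metric_space) \<Rightarrow> bool" where
  "asymptotically_measurable P Y \<longleftrightarrow>
     (\<forall>f\<in>bounded_continuous.
        (\<lambda>n. outer_expectation (P n) (\<lambda>\<omega>. f (Y n \<omega>)) - inner_expectation (P n) (\<lambda>\<omega>. f (Y n \<omega>)))
          \<longlonglongrightarrow> 0)"

definition relatively_compact ::
  "(nat \<Rightarrow> 'w measure) \<Rightarrow> (nat \<Rightarrow> 'w \<Rightarrow> 'd::metric_space) \<Rightarrow> bool" where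
  "relatively_compact P Y \<longleftrightarrow>
     (\<forall>r::nat \<Rightarrow> nat. strict_mono r \<longrightarrow>
        (\<exists>(s::nat \<Rightarrow> nat) \<mu>. strict_mono s \<and> tight_law \<mu> \<and>
           converges_weakly (\<lambda>n. P (r (s n))) (\<lambda>n. Y (r (s n))) \<mu>))"

definition weakly_equivalent ::
  "(nat \<Rightarrow> 'w measure) \<Rightarrow> (nat \<Rightarrow> 'w \<Rightarrow> 'd::metric_space) \<Rightarrow>
   (nat \<Rightarrow> 'u measure) \<Rightarrow> (nat \<Rightarrow> 'u \<Rightarrow> 'd) \<Rightarrow> bool" where
  "weakly_equivalent P Y Q Z \<longleftrightarrow>
     (\<forall>f\<in>bounded_continuous.
        (\<lambda>n. \<bar>outer_expectation (P n) (\<lambda>\<omega>. f (Y n \<omega>)) - outer_expectation (Q n) (\<lambda>\<omega>. f (Z n \<omega>))\<bar>)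
          \<longlonglongrightarrow> 0)"

text \<open>Independent copies of a possibly non-measurable map are formed on the product space.\<close>
definition three_space :: "'w measure \<Rightarrow> ('w \<times> 'w \<times> 'w) measure" where
  "three_space P = P \<Otimes>\<^sub>M P \<Otimes>\<^sub>M P"

definition three_copies :: "('w \<Rightarrow> 'd) \<Rightarrow> 'w \<times> 'w \<times> 'w \<Rightarrow> 'd \<times> 'd \<times> 'd" where
  "three_copies Y = (\<lambda>(\<omega>1, \<omega>2, \<omega>3). (Y \<omega>1, Y \<omega>2, Y \<omega>3))"

text \<open>
  Independence of the data and of the two copies of the weights is understood in the product
  sense usual with outer expectations: the data live on \<open>P\<close>, the weights on \<open>Q\<close>, and each variable
  depends on its own coordinate of the space below only.
\<close>
definition bootstrap_space :: "'a measure \<Rightarrow> 'b measure \<Rightarrow> ('a \<times> 'b \<times> 'b) measure" where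
  "bootstrap_space P Q = P \<Otimes>\<^sub>M Q \<Otimes>\<^sub>M Q"

end

theory Submission
  imports Defs
begin

text \<open>
  Along a subsequence on which \<open>G\<close> converges to a tight law \<open>\<mu>\<close>, finitely many Lipschitz functions forming a
  partition of unity on a large compact set approximate, up to small \<open>L\<^sup>1\<close> error, every member of \<open>BL1\<close>
  uniformly and every bounded continuous function of three arguments by sums of products. Hence both (i)
  and (ii) reduce to the following property of each Lipschitz \<open>\<phi>\<close> with values in \<open>[0, 1]\<close>: \<open>\<phi> (G1)\<close> lies between
  functions of the data and one weight, measurable on the product space, whose conditional means given the
  data tend to \<open>\<integral> \<phi> d\<mu>\<close> in \<open>L\<^sup>1\<close>.
  From (ii) this follows by a second moment computation: the mean square of the conditional mean of a minorant
  \<open>L\<close> is the integral of \<open>L (a, b) * L (a, c)\<close>, which is at most the outer expectation of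
  \<open>\<phi> (G1) * \<phi> (G2)\<close>, and this tends to \<open>(\<integral> \<phi> d\<mu>)\<^sup>2\<close>.
\<close>

text \<open>The obstacle is that outer expectations are only subadditive and obey no Fubini theorem.
  They are therefore not manipulated directly: nonmeasurable functions are enclosed between
  measurable minorants and majorants, the computations are done with these, and the outer
  expectation is caught between their integrals. Nonnegativity of the test functions is what lets
  such bounds be multiplied. The second moment computation works for minorants alone: the integral
  of a product of minorants lies below an outer expectation, whereas for majorants the inequality
  points the wrong way. The majorant is recovered from the fact that its integral and that of the
  minorant have the same limit. The law \<open>\<mu>\<close> depends on the subsequence. Neither
  side of the equivalence mentions it, so the equivalences along subsequences can be glued together
  to one for the whole sequence.\<close>

lemma tendsto_by_subsequences:
  fixes x :: "nat \<Rightarrow> 'a::topological_space"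
  assumes "\<And>r :: nat \<Rightarrow> nat. strict_mono r \<Longrightarrow> \<exists>s :: nat \<Rightarrow> nat. strict_mono s \<and> (\<lambda>n. x (r (s n))) \<longlonglongrightarrow> l"
  shows "x \<longlonglongrightarrow> l"
proof (rule topological_tendstoI, rule ccontr)
  fix S assume S: "open S" "l \<in> S" and "\<not> (\<forall>\<^sub>F n in sequentially. x n \<in> S)"
  then have inf: "infinite {n. x n \<notin> S}"
    by (simp add: eventually_cofinite[symmetric] cofinite_eq_sequentially)
  define r where "r = enumerate {n. x n \<notin> S}"
  have r: "strict_mono r" "\<And>n. x (r n) \<notin> S"
    using strict_mono_enumerate[OF inf] enumerate_in_set[OF inf] by (auto simp: r_def)
  from assms[OF r(1)] obtain s :: "nat \<Rightarrow> nat" where "(\<lambda>n. x (r (s n))) \<longlonglongrightarrow> l" by blast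
  from topological_tendstoD[OF this S] show False
    using r(2) by simp
qed

section \<open>Outer expectations\<close>

text \<open>A real \<open>Inf\<close> is known to be a lower bound only of sets that are bounded
  below; the integrable minorant \<open>L\<close> provides this.\<close>

lemma outer_expectation_le:
  assumes "integrable M U" "\<And>\<omega>. \<omega> \<in> space M \<Longrightarrow> f \<omega> \<le> U \<omega>"
    and "integrable M L" "\<And>\<omega>. \<omega> \<in> space M \<Longrightarrow> L \<omega> \<le> f \<omega>"
  shows "outer_expectation M f \<le> integral\<^sup>L M U"
  unfolding outer_expectation_def
proof (rule cInf_lower)
  show "bdd_below {integral\<^sup>L M U |U. integrable M U \<and> (\<forall>\<omega>\<in>space M. f \<omega> \<le> U \<omega>)}"
    using assms(3,4)
    by (auto intro!: bdd_belowI[of _ "integral\<^sup>L M L"] integral_mono intro: order_trans)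
qed (use assms in auto)

text \<open>Every admissible majorant dominates \<open>L\<close>. The role of \<open>U\<close> is to
  make the set of majorants nonempty, as a real infimum requires.\<close>

lemma le_outer_expectation:
  assumes "integrable M U" "\<And>\<omega>. \<omega> \<in> space M \<Longrightarrow> f \<omega> \<le> U \<omega>"
    and "integrable M L" "\<And>\<omega>. \<omega> \<in> space M \<Longrightarrow> L \<omega> \<le> f \<omega>"
  shows "integral\<^sup>L M L \<le> outer_expectation M f"
  unfolding outer_expectation_def
  using assms by (intro cInf_greatest) (auto intro!: integral_mono intro: order_trans)

text \<open>Negation exchanges integrable minorants and majorants. Facts about inner expectations
  are obtained from those about outer ones by passing to \<open>- f\<close>.\<close>

lemma inner_expectation_eq: "inner_expectation M f = - outer_expectation M (\<lambda>\<omega>. - f \<omega>)"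
proof -
  have "{integral\<^sup>L M L |L. integrable M L \<and> (\<forall>\<omega>\<in>space M. L \<omega> \<le> f \<omega>)} =
    uminus ` {integral\<^sup>L M U |U. integrable M U \<and> (\<forall>\<omega>\<in>space M. - f \<omega> \<le> U \<omega>)}" (is "?A = uminus ` ?B")
  proof (intro equalityI subsetI)
    fix x assume "x \<in> ?A"
    then obtain L where "x = integral\<^sup>L M L" "integrable M L" "\<forall>\<omega>\<in>space M. L \<omega> \<le> f \<omega>" by auto
    then show "x \<in> uminus ` ?B"
      by (intro image_eqI[of _ _ "- x"]) (auto intro!: exI[of _ "\<lambda>\<omega>. - L \<omega>"])
  next
    fix x assume "x \<in> uminus ` ?B"
    then obtain U where "x = - integral\<^sup>L M U" "integrable M U" "\<forall>\<omega>\<in>space M. - f \<omega> \<le> U \<omega>" by auto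
    then show "x \<in> ?A"
      by (auto intro!: exI[of _ "\<lambda>\<omega>. - U \<omega>"] simp: minus_le_iff)
  qed
  then show ?thesis
    by (simp add: inner_expectation_def outer_expectation_def Inf_real_def image_image)
qed

text \<open>\<open>U - D\<close> and \<open>U + D\<close> are an integrable minorant and majorant.
  This stands in for linearity: the error is absorbed into an integrable \<open>D\<close> before the
  outer expectation is taken.\<close>

lemma outer_expectation_approx:
  assumes "integrable M U" "integrable M D" "\<And>\<omega>. \<omega> \<in> space M \<Longrightarrow> \<bar>f \<omega> - U \<omega>\<bar> \<le> D \<omega>"
  shows "\<bar>outer_expectation M f - integral\<^sup>L M U\<bar> \<le> integral\<^sup>L M D"
proof -
  have *: "f \<omega> \<le> U \<omega> + D \<omega>" "U \<omega> - D \<omega> \<le> f \<omega>" if "\<omega> \<in> space M" for \<omega>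
    using assms(3)[OF that] by linarith+
  have "outer_expectation M f \<le> (\<integral>\<omega>. U \<omega> + D \<omega> \<partial>M)"
    using assms * by (intro outer_expectation_le[where L="\<lambda>\<omega>. U \<omega> - D \<omega>"]) auto
  moreover have "(\<integral>\<omega>. U \<omega> - D \<omega> \<partial>M) \<le> outer_expectation M f"
    using assms * by (intro le_outer_expectation[where U="\<lambda>\<omega>. U \<omega> + D \<omega>"]) auto
  ultimately show ?thesis using assms by simp
qed

lemma (in prob_space) bounded_integrable:
  fixes f :: "'a \<Rightarrow> real"
  assumes "f \<in> borel_measurable M" "\<And>\<omega>. \<omega> \<in> space M \<Longrightarrow> lo \<le> f \<omega>" "\<And>\<omega>. \<omega> \<in> space M \<Longrightarrow> f \<omega> \<le> hi"
  shows "integrable M f"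
  using assms by (intro integrable_const_bound[of _ "max \<bar>lo\<bar> \<bar>hi\<bar>"] AE_I2) (force simp: max_def abs_if)+

text \<open>The infimum over majorants is attained: the pointwise infimum of countably many
  majorants whose integrals approach it is again a measurable majorant.\<close>

lemma (in prob_space) measurable_cover:
  assumes "\<And>\<omega>. \<omega> \<in> space M \<Longrightarrow> lo \<le> f \<omega>" "\<And>\<omega>. \<omega> \<in> space M \<Longrightarrow> f \<omega> \<le> hi"
  shows "\<exists>U\<in>borel_measurable M. (\<forall>\<omega>\<in>space M. lo \<le> U \<omega> \<and> f \<omega> \<le> U \<omega> \<and> U \<omega> \<le> hi) \<and>
           integral\<^sup>L M U = outer_expectation M f"
proof -
  let ?S = "{integral\<^sup>L M U |U. integrable M U \<and> (\<forall>\<omega>\<in>space M. f \<omega> \<le> U \<omega>)}"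
  have ne: "?S \<noteq> {}" using assms(2) by (auto intro!: exI[of _ "\<lambda>_. hi"])
  have "\<exists>U. integrable M U \<and> (\<forall>\<omega>\<in>space M. f \<omega> \<le> U \<omega>) \<and>
      integral\<^sup>L M U < outer_expectation M f + inverse (Suc k)" for k :: nat
    using cInf_lessD[OF ne, of "outer_expectation M f + inverse (Suc k)"]
    by (auto simp: outer_expectation_def)
  then obtain U where U: "\<And>k. integrable M (U k)" "\<And>k \<omega>. \<omega> \<in> space M \<Longrightarrow> f \<omega> \<le> U k \<omega>"
    "\<And>k :: nat. integral\<^sup>L M (U k) < outer_expectation M f + inverse (Suc k)" by metis
  \<comment> \<open>Truncation at \<open>hi\<close> leaves a majorant of \<open>f\<close> and does
    not increase the integral. It yields the upper bound on \<open>V\<close>; the lower bound is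
    inherited from \<open>f\<close>.\<close>
  define W where "W k \<omega> = min hi (U k \<omega>)" for k \<omega>
  define V where "V \<omega> = (INF k. W k \<omega>)" for \<omega>
  have Wm [measurable]: "W k \<in> borel_measurable M" for k
    using U(1)[of k] unfolding W_def by measurable
  have W: "f \<omega> \<le> W k \<omega>" "W k \<omega> \<le> hi" "lo \<le> W k \<omega>" if "\<omega> \<in> space M" for \<omega> k
    using U(2)[OF that, of k] assms[OF that] by (auto simp: W_def)
  have bdd: "bdd_below (range (\<lambda>k. W k \<omega>))" if "\<omega> \<in> space M" for \<omega>
    using W(3)[OF that] by (auto intro!: bdd_belowI2)
  have Vm: "V \<in> borel_measurable M"
    unfolding V_def using bdd by (intro borel_measurable_cINF) auto
  have V: "f \<omega> \<le> V \<omega>" "V \<omega> \<le> W k \<omega>" if "\<omega> \<in> space M" for \<omega> k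
    unfolding V_def using W[OF that] bdd[OF that] by (auto intro: cINF_greatest cINF_lower)
  have Vi: "lo \<le> V \<omega>" "V \<omega> \<le> hi" if "\<omega> \<in> space M" for \<omega>
    using V[OF that] W(2)[OF that] assms(1)[OF that] by (auto intro: order_trans)
  have intV: "integrable M V" using Vi Vm by (intro bounded_integrable) auto
  have le: "integral\<^sup>L M V \<le> outer_expectation M f + inverse (Suc k)" for k :: nat
  proof -
    have "integral\<^sup>L M V \<le> integral\<^sup>L M (U k)"
      using V(2)[of _ k] by (intro integral_mono intV U) (auto simp: W_def)
    with U(3)[of k] show ?thesis by linarith
  qed
  have "integral\<^sup>L M V \<le> outer_expectation M f"
  proof (rule field_le_epsilon)
    fix e :: real assume "0 < e"
    then obtain k where "inverse (Suc k) < e" using reals_Archimedean by blast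
    with le[of k] show "integral\<^sup>L M V \<le> outer_expectation M f + e" by linarith
  qed
  moreover have "outer_expectation M f \<le> integral\<^sup>L M V"
    using V(1) assms(1) by (intro outer_expectation_le[where L="\<lambda>_. lo"] intV) auto
  ultimately show ?thesis using Vm V Vi by (intro bexI[of _ V]) auto
qed

lemma (in prob_space) measurable_sandwich:
  assumes "\<And>\<omega>. \<omega> \<in> space M \<Longrightarrow> lo \<le> f \<omega>" "\<And>\<omega>. \<omega> \<in> space M \<Longrightarrow> f \<omega> \<le> hi"
  obtains L U where "L \<in> borel_measurable M" "U \<in> borel_measurable M"
    "\<And>\<omega>. \<omega> \<in> space M \<Longrightarrow> lo \<le> L \<omega>" "\<And>\<omega>. \<omega> \<in> space M \<Longrightarrow> L \<omega> \<le> f \<omega>"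
    "\<And>\<omega>. \<omega> \<in> space M \<Longrightarrow> f \<omega> \<le> U \<omega>" "\<And>\<omega>. \<omega> \<in> space M \<Longrightarrow> U \<omega> \<le> hi"
    "integral\<^sup>L M L = inner_expectation M f" "integral\<^sup>L M U = outer_expectation M f"
proof -
  obtain U where U: "U \<in> borel_measurable M" "\<forall>\<omega>\<in>space M. f \<omega> \<le> U \<omega> \<and> U \<omega> \<le> hi"
    "integral\<^sup>L M U = outer_expectation M f"
    using measurable_cover[of lo f hi] assms by blast
  have "\<exists>V\<in>borel_measurable M. (\<forall>\<omega>\<in>space M. - hi \<le> V \<omega> \<and> - f \<omega> \<le> V \<omega> \<and> V \<omega> \<le> - lo) \<and>
           integral\<^sup>L M V = outer_expectation M (\<lambda>\<omega>. - f \<omega>)"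
    using assms by (intro measurable_cover) auto
  then obtain V where V: "V \<in> borel_measurable M" "\<forall>\<omega>\<in>space M. - f \<omega> \<le> V \<omega> \<and> V \<omega> \<le> - lo"
    "integral\<^sup>L M V = outer_expectation M (\<lambda>\<omega>. - f \<omega>)" by blast
  show ?thesis
    using U V by (intro that[of "\<lambda>\<omega>. - V \<omega>" U]) (auto simp: inner_expectation_eq minus_le_iff le_minus_iff)
qed

section \<open>Nonmeasurable sequences with an asymptotic mean\<close>

text \<open>For bounded functions on probability spaces this says that inner and outer expectations
  both tend to \<open>l\<close>. Stated through minorants and majorants it is visibly stable under
  linear combinations, which convergence of outer expectations alone is not.\<close>

definition asymp_mean :: "(nat \<Rightarrow> 'w measure) \<Rightarrow> (nat \<Rightarrow> 'w \<Rightarrow> real) \<Rightarrow> real \<Rightarrow> bool" where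
  "asymp_mean M f l \<longleftrightarrow> (\<exists>L U.
     (\<forall>n. integrable (M n) (L n) \<and> integrable (M n) (U n) \<and>
        (\<forall>\<omega>\<in>space (M n). L n \<omega> \<le> f n \<omega> \<and> f n \<omega> \<le> U n \<omega>)) \<and>
     (\<lambda>n. integral\<^sup>L (M n) (L n)) \<longlonglongrightarrow> l \<and> (\<lambda>n. integral\<^sup>L (M n) (U n)) \<longlonglongrightarrow> l)"

lemma asymp_meanI:
  assumes "\<And>n. integrable (M n) (L n)" "\<And>n. integrable (M n) (U n)"
    and "\<And>n \<omega>. \<omega> \<in> space (M n) \<Longrightarrow> L n \<omega> \<le> f n \<omega>" "\<And>n \<omega>. \<omega> \<in> space (M n) \<Longrightarrow> f n \<omega> \<le> U n \<omega>"
    and "(\<lambda>n. integral\<^sup>L (M n) (L n)) \<longlonglongrightarrow> l" "(\<lambda>n. integral\<^sup>L (M n) (U n)) \<longlonglongrightarrow> l"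
  shows "asymp_mean M f l"
  unfolding asymp_mean_def using assms by blast

lemma asymp_meanE:
  assumes "asymp_mean M f l"
  obtains L U where "\<And>n. integrable (M n) (L n)" "\<And>n. integrable (M n) (U n)"
    and "\<And>n \<omega>. \<omega> \<in> space (M n) \<Longrightarrow> L n \<omega> \<le> f n \<omega>" "\<And>n \<omega>. \<omega> \<in> space (M n) \<Longrightarrow> f n \<omega> \<le> U n \<omega>"
    and "(\<lambda>n. integral\<^sup>L (M n) (L n)) \<longlonglongrightarrow> l" "(\<lambda>n. integral\<^sup>L (M n) (U n)) \<longlonglongrightarrow> l"
  using assms unfolding asymp_mean_def by blast

lemma asymp_mean_add:
  assumes "asymp_mean M f l" "asymp_mean M g k"
  shows "asymp_mean M (\<lambda>n \<omega>. f n \<omega> + g n \<omega>) (l + k)"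
proof -
  obtain L U where 1: "\<And>n. integrable (M n) (L n)" "\<And>n. integrable (M n) (U n)"
    "\<And>n \<omega>. \<omega> \<in> space (M n) \<Longrightarrow> L n \<omega> \<le> f n \<omega>" "\<And>n \<omega>. \<omega> \<in> space (M n) \<Longrightarrow> f n \<omega> \<le> U n \<omega>"
    "(\<lambda>n. integral\<^sup>L (M n) (L n)) \<longlonglongrightarrow> l" "(\<lambda>n. integral\<^sup>L (M n) (U n)) \<longlonglongrightarrow> l"
    using asymp_meanE[OF assms(1)] by blast
  obtain L' U' where 2: "\<And>n. integrable (M n) (L' n)" "\<And>n. integrable (M n) (U' n)"
    "\<And>n \<omega>. \<omega> \<in> space (M n) \<Longrightarrow> L' n \<omega> \<le> g n \<omega>" "\<And>n \<omega>. \<omega> \<in> space (M n) \<Longrightarrow> g n \<omega> \<le> U' n \<omega>"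
    "(\<lambda>n. integral\<^sup>L (M n) (L' n)) \<longlonglongrightarrow> k" "(\<lambda>n. integral\<^sup>L (M n) (U' n)) \<longlonglongrightarrow> k"
    using asymp_meanE[OF assms(2)] by blast
  show ?thesis
    by (rule asymp_meanI[where L="\<lambda>n \<omega>. L n \<omega> + L' n \<omega>" and U="\<lambda>n \<omega>. U n \<omega> + U' n \<omega>"])
       (use 1 2 in \<open>auto intro!: add_mono tendsto_add\<close>)
qed

lemma asymp_mean_cmult:
  assumes "asymp_mean M f l"
  shows "asymp_mean M (\<lambda>n \<omega>. c * f n \<omega>) (c * l)"
proof -
  obtain L U where 1: "\<And>n. integrable (M n) (L n)" "\<And>n. integrable (M n) (U n)"
    "\<And>n \<omega>. \<omega> \<in> space (M n) \<Longrightarrow> L n \<omega> \<le> f n \<omega>" "\<And>n \<omega>. \<omega> \<in> space (M n) \<Longrightarrow> f n \<omega> \<le> U n \<omega>"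
    "(\<lambda>n. integral\<^sup>L (M n) (L n)) \<longlonglongrightarrow> l" "(\<lambda>n. integral\<^sup>L (M n) (U n)) \<longlonglongrightarrow> l"
    using asymp_meanE[OF assms(1)] by blast
  show ?thesis
  proof (cases "c \<ge> 0")
    case True
    then show ?thesis
      by (intro asymp_meanI[where L="\<lambda>n \<omega>. c * L n \<omega>" and U="\<lambda>n \<omega>. c * U n \<omega>"])
         (use 1 in \<open>auto intro!: mult_left_mono tendsto_mult\<close>)
  next
    case False
    then show ?thesis
      by (intro asymp_meanI[where L="\<lambda>n \<omega>. c * U n \<omega>" and U="\<lambda>n \<omega>. c * L n \<omega>"])
         (use 1 in \<open>auto intro!: mult_left_mono_neg tendsto_mult\<close>)
  qed
qed

lemma asymp_mean_outer:
  assumes "asymp_mean M f l"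
  shows "(\<lambda>n. outer_expectation (M n) (f n)) \<longlonglongrightarrow> l"
proof -
  obtain L U where 1: "\<And>n. integrable (M n) (L n)" "\<And>n. integrable (M n) (U n)"
    "\<And>n \<omega>. \<omega> \<in> space (M n) \<Longrightarrow> L n \<omega> \<le> f n \<omega>" "\<And>n \<omega>. \<omega> \<in> space (M n) \<Longrightarrow> f n \<omega> \<le> U n \<omega>"
    "(\<lambda>n. integral\<^sup>L (M n) (L n)) \<longlonglongrightarrow> l" "(\<lambda>n. integral\<^sup>L (M n) (U n)) \<longlonglongrightarrow> l"
    using asymp_meanE[OF assms(1)] by blast
  show ?thesis
  proof (rule tendsto_sandwich[OF _ _ 1(5,6)])
    show "\<forall>\<^sub>F n in sequentially. integral\<^sup>L (M n) (L n) \<le> outer_expectation (M n) (f n)"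
      by (intro always_eventually allI le_outer_expectation[OF 1(2,4,1,3)])
    show "\<forall>\<^sub>F n in sequentially. outer_expectation (M n) (f n) \<le> integral\<^sup>L (M n) (U n)"
      by (intro always_eventually allI outer_expectation_le[OF 1(2,4,1,3)])
  qed
qed

lemma sandwich_sequence:
  assumes "\<And>n. prob_space (M n)"
    and "\<And>n \<omega>. \<omega> \<in> space (M n) \<Longrightarrow> lo \<le> f n \<omega>" "\<And>n \<omega>. \<omega> \<in> space (M n) \<Longrightarrow> f n \<omega> \<le> hi"
  obtains L U where "\<And>n. L n \<in> borel_measurable (M n)" "\<And>n. U n \<in> borel_measurable (M n)"
    "\<And>n \<omega>. \<omega> \<in> space (M n) \<Longrightarrow> lo \<le> L n \<omega>" "\<And>n \<omega>. \<omega> \<in> space (M n) \<Longrightarrow> L n \<omega> \<le> f n \<omega>"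
    "\<And>n \<omega>. \<omega> \<in> space (M n) \<Longrightarrow> f n \<omega> \<le> U n \<omega>" "\<And>n \<omega>. \<omega> \<in> space (M n) \<Longrightarrow> U n \<omega> \<le> hi"
    "\<And>n. integral\<^sup>L (M n) (L n) = inner_expectation (M n) (f n)"
    "\<And>n. integral\<^sup>L (M n) (U n) = outer_expectation (M n) (f n)"
proof -
  have "\<exists>L U. L \<in> borel_measurable (M n) \<and> U \<in> borel_measurable (M n) \<and>
    (\<forall>\<omega>\<in>space (M n). lo \<le> L \<omega> \<and> L \<omega> \<le> f n \<omega> \<and> f n \<omega> \<le> U \<omega> \<and> U \<omega> \<le> hi) \<and>
    integral\<^sup>L (M n) L = inner_expectation (M n) (f n) \<and> integral\<^sup>L (M n) U = outer_expectation (M n) (f n)" for n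
    by (rule prob_space.measurable_sandwich[OF assms(1), of n lo "f n" hi]) (use assms(2,3) in blast)+
  then obtain L U where "\<And>n. L n \<in> borel_measurable (M n) \<and> U n \<in> borel_measurable (M n) \<and>
    (\<forall>\<omega>\<in>space (M n). lo \<le> L n \<omega> \<and> L n \<omega> \<le> f n \<omega> \<and> f n \<omega> \<le> U n \<omega> \<and> U n \<omega> \<le> hi) \<and>
    integral\<^sup>L (M n) (L n) = inner_expectation (M n) (f n) \<and> integral\<^sup>L (M n) (U n) = outer_expectation (M n) (f n)"
    by metis
  then show ?thesis by (intro that[of L U]) auto
qed

section \<open>Approximation by bounded Lipschitz functions\<close>

text \<open>These functions take values in \<open>[0, 1]\<close>. A product of them is monotone in
  each factor, so products of nonnegative minorants and products of majorants are again minorants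
  and majorants.\<close>

abbreviation nonneg_BL1 :: "('d::metric_space \<Rightarrow> real) set" where
  "nonneg_BL1 \<equiv> {h\<in>BL1. \<forall>x. 0 \<le> h x}"

lemma nonneg_BL1_const: "0 \<le> c \<Longrightarrow> c \<le> 1 \<Longrightarrow> (\<lambda>_. c) \<in> nonneg_BL1"
  by (auto simp: BL1_def intro: lipschitz_onI)

lemma BL1_bounded_continuous: "h \<in> BL1 \<Longrightarrow> h \<in> bounded_continuous"
  by (auto simp: BL1_def bounded_continuous_def bounded_iff intro: lipschitz_on_continuous_on)

lemma nonneg_BL1D:
  assumes "h \<in> nonneg_BL1"
  shows "0 \<le> h x" "h x \<le> 1" "h \<in> BL1" "h \<in> bounded_continuous"
  using assms BL1_bounded_continuous[of h] by (auto simp: BL1_def abs_le_iff)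

lemma bounded_continuousD:
  assumes "f \<in> bounded_continuous"
  obtains C where "C \<ge> 0" "\<And>x. \<bar>f x\<bar> \<le> C" "continuous_on UNIV f"
  using assms by (auto simp: bounded_continuous_def bounded_iff intro: order_trans[OF abs_ge_zero])

lemma borel_law_measurable:
  assumes "borel_law \<mu>" "continuous_on UNIV f"
  shows "f \<in> borel_measurable \<mu>"
  using borel_measurable_continuous_onI[OF assms(2)] assms(1)
  by (simp add: borel_law_def cong: measurable_cong_sets)

lemma borel_law_integrable:
  fixes f :: "'d::metric_space \<Rightarrow> real"
  assumes "borel_law \<mu>" "f \<in> bounded_continuous"
  shows "integrable \<mu> f"
proof -
  obtain C where C: "\<And>x. \<bar>f x\<bar> \<le> C" "continuous_on UNIV f"
    using bounded_continuousD[OF assms(2)] by blast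
  interpret prob_space \<mu> using assms(1) by (simp add: borel_law_def)
  show ?thesis
    by (rule bounded_integrable[where lo="-C" and hi=C])
       (use C borel_law_measurable[OF assms(1)] in \<open>auto simp: abs_le_iff minus_le_iff\<close>)
qed

text \<open>The difference splits as \<open>(t - t') / m + t' / m' * ((m' - m) / m)\<close>. The
  factor \<open>t' / m'\<close> is at most \<open>1\<close>, so the variations of numerator and
  denominator add up over the lower bound \<open>b\<close>.\<close>

lemma Lipschitz_quotient:
  fixes t t' m m' :: real
  assumes "0 \<le> t'" "t' \<le> m'" "0 < b" "b \<le> m" "\<bar>t - t'\<bar> \<le> d" "\<bar>m - m'\<bar> \<le> e" "0 < m'"
  shows "\<bar>t / m - t' / m'\<bar> \<le> (d + e) / b"
proof -
  have m: "0 < m" using assms by linarith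
  have "\<bar>t / m - t' / m'\<bar> = \<bar>(t - t') / m + t' / m' * ((m' - m) / m)\<bar>"
    using m assms by (simp add: field_simps)
  also have "\<dots> \<le> \<bar>(t - t') / m\<bar> + \<bar>t' / m' * ((m' - m) / m)\<bar>" by (rule abs_triangle_ineq)
  also have "\<bar>t' / m' * ((m' - m) / m)\<bar> = (t' / m') * (\<bar>m - m'\<bar> / m)"
    using m assms by (simp add: abs_mult abs_minus_commute)
  also have "\<dots> \<le> 1 * (e / m)"
    using m assms by (intro mult_mono divide_right_mono) auto
  also have "\<bar>(t - t') / m\<bar> \<le> d / m" using m assms by (simp add: divide_right_mono)
  finally have "\<bar>t / m - t' / m'\<bar> \<le> (d + e) / m" by (simp add: add_divide_distrib)
  also have "\<dots> \<le> (d + e) / b" using m assms by (intro divide_left_mono) auto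
  finally show ?thesis .
qed

text \<open>The factor \<open>\<kappa>\<close> normalises the members of the partition of unity to Lipschitz constant \<open>1\<close>.\<close>
lemma Lipschitz_partition_of_unity:
  fixes K :: "'d::metric_space set"
  assumes "compact K" "0 < \<eta>"
  obtains I \<psi> \<kappa> where "finite I" "I \<subseteq> K" "0 < \<kappa>" "\<And>i. i \<in> I \<Longrightarrow> \<psi> i \<in> nonneg_BL1"
    "\<And>i y. \<psi> i y \<noteq> 0 \<Longrightarrow> dist i y < \<eta>"
    "\<And>y. (\<Sum>i\<in>I. \<kappa> * \<psi> i y) \<le> 1" "\<And>y. y \<in> K \<Longrightarrow> (\<Sum>i\<in>I. \<kappa> * \<psi> i y) = 1"
proof -
  \<comment> \<open>The balls have radius \<open>\<eta>/2\<close>, while the tents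
    \<open>t i\<close> below are supported in radius \<open>\<eta>\<close>: at every point of
    \<open>K\<close> some tent then has height at least \<open>\<eta>/2\<close>.\<close>
  obtain I where I: "I \<subseteq> K" "finite I" "K \<subseteq> (\<Union>x\<in>I. ball x (\<eta>/2))"
  proof (rule compactE_image[OF assms(1), of K "\<lambda>x. ball x (\<eta>/2)"])
    show "K \<subseteq> (\<Union>x\<in>K. ball x (\<eta>/2))" using assms(2) by force
  qed (use that in auto)
  define t where "t i y = max 0 (\<eta> - dist i y)" for i y :: 'd
  define T where "T y = (\<Sum>i\<in>I. t i y)" for y
  \<comment> \<open>The denominator is cut off at \<open>\<eta>/2\<close> to make the quotients
    Lipschitz on the whole space. On \<open>K\<close> the cut-off is inactive, which gives the sum
    \<open>1\<close> there.\<close>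
  define m where "m y = max (T y) (\<eta>/2)" for y
  \<comment> \<open>\<open>(1 + N) / (\<eta>/2)\<close>, used in \<open>\<kappa>\<close>, is a
    Lipschitz constant of \<open>t i / m\<close>: the numerator contributes \<open>1\<close>, the
    denominator \<open>N\<close>. The maximum with \<open>1\<close> keeps the rescaled functions at
    most \<open>1\<close>.\<close>
  define N where "N = real (card I)"
  define \<kappa> where "\<kappa> = max 1 ((1 + N) / (\<eta>/2))"
  define \<psi> where "\<psi> i y = t i y / m y / \<kappa>" for i y
  have \<kappa>: "\<kappa> \<ge> 1" "(1 + N) / (\<eta>/2) \<le> \<kappa>" by (auto simp: \<kappa>_def)
  have t0: "0 \<le> t i y" for i y by (simp add: t_def)
  have tlip: "\<bar>t i y - t i z\<bar> \<le> dist y z" for i y z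
    unfolding t_def using abs_dist_diff_le[of y i z] by (auto simp: max_def dist_commute)
  have Tlip: "\<bar>T y - T z\<bar> \<le> N * dist y z" for y z
  proof -
    have "\<bar>T y - T z\<bar> \<le> (\<Sum>i\<in>I. \<bar>t i y - t i z\<bar>)"
      unfolding T_def sum_subtractf[symmetric] by (rule sum_abs)
    also have "\<dots> \<le> (\<Sum>i\<in>I. dist y z)" by (intro sum_mono tlip)
    finally show ?thesis by (simp add: N_def)
  qed
  have mlip: "\<bar>m y - m z\<bar> \<le> N * dist y z" for y z
    using Tlip[of y z] unfolding m_def by (auto simp: max_def)
  have m0: "0 < m y" "\<eta>/2 \<le> m y" "T y \<le> m y" for y using assms(2) by (auto simp: m_def less_max_iff_disj)
  have tT: "t i y \<le> T y" if "i \<in> I" for i y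
    unfolding T_def using that I(2) t0 by (intro member_le_sum) auto
  have S: "(\<Sum>i\<in>I. \<kappa> * \<psi> i y) = T y / m y" for y
    using \<kappa> by (simp add: \<psi>_def T_def sum_divide_distrib)
  show ?thesis
  proof (rule that[of I \<kappa> \<psi>])
    fix i assume i: "i \<in> I"
    have "\<bar>\<psi> i y\<bar> \<le> 1" "0 \<le> \<psi> i y" for y
    proof -
      have r: "0 \<le> t i y / m y" "t i y / m y \<le> 1"
        using t0[of i y] m0(1,3)[of y] tT[OF i, of y] by (auto simp: divide_le_eq_1)
      then have "t i y / m y / \<kappa> \<le> 1 / 1" using \<kappa> by (intro frac_le) auto
      then show "0 \<le> \<psi> i y" "\<bar>\<psi> i y\<bar> \<le> 1"
        using divide_nonneg_nonneg[OF r(1), of \<kappa>] \<kappa> by (simp_all add: \<psi>_def[of i y])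
    qed
    moreover have "dist (\<psi> i y) (\<psi> i z) \<le> 1 * dist y z" for y z
    proof -
      have "\<bar>t i y / m y - t i z / m z\<bar> \<le> (dist y z + N * dist y z) / (\<eta>/2)"
        using assms(2) m0 tT[OF i, of z] by (intro Lipschitz_quotient tlip mlip t0) (auto intro: order_trans)
      also have "\<dots> = (1 + N) / (\<eta>/2) * dist y z" by (simp add: field_simps)
      also have "\<dots> \<le> \<kappa> * dist y z" using \<kappa> by (intro mult_right_mono) auto
      finally have "\<bar>t i y / m y - t i z / m z\<bar> / \<kappa> \<le> dist y z" using \<kappa> by (simp add: field_simps)
      moreover have "\<bar>\<psi> i y - \<psi> i z\<bar> = \<bar>t i y / m y - t i z / m z\<bar> / \<kappa>"
        using \<kappa> unfolding \<psi>_def diff_divide_distrib[symmetric] by (simp add: abs_divide)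
      ultimately show ?thesis by (simp add: dist_real_def)
    qed
    ultimately show "\<psi> i \<in> nonneg_BL1" by (auto simp: BL1_def intro: lipschitz_onI)
  next
    fix i y assume "\<psi> i y \<noteq> 0"
    then show "dist i y < \<eta>" by (auto simp: \<psi>_def t_def max_def split: if_splits)
  next
    fix y show "(\<Sum>i\<in>I. \<kappa> * \<psi> i y) \<le> 1" using m0[of y] by (simp add: S)
  next
    fix y assume "y \<in> K"
    then obtain i where i: "i \<in> I" "dist i y < \<eta>/2" using I(3) by auto
    then have "\<eta>/2 \<le> t i y" by (simp add: t_def max_def)
    with tT[OF i(1), of y] have "m y = T y" by (simp add: m_def)
    then show "(\<Sum>i\<in>I. \<kappa> * \<psi> i y) = 1" using m0(1)[of y] by (simp add: S)
  qed (use I \<kappa> in auto)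
qed

text \<open>The sum of the partition dominates the indicator of \<open>K\<close>. Integrating turns
  a pointwise statement on \<open>K\<close> into one about finitely many means, and this form passes
  to the sequence, whose values need not lie in \<open>K\<close>.\<close>

lemma tight_partition_of_unity:
  fixes \<mu> :: "'d::metric_space measure"
  assumes "borel_law \<mu>" "compact K" "1 - \<epsilon> \<le> measure \<mu> K" "0 < \<eta>"
  obtains I \<psi> \<kappa> where "finite I" "I \<subseteq> K" "0 < \<kappa>" "\<And>i. i \<in> I \<Longrightarrow> \<psi> i \<in> nonneg_BL1"
    "\<And>i y. \<psi> i y \<noteq> 0 \<Longrightarrow> dist i y < \<eta>"
    "\<And>y. (\<Sum>i\<in>I. \<kappa> * \<psi> i y) \<le> 1" "1 - \<epsilon> \<le> (\<Sum>i\<in>I. \<kappa> * integral\<^sup>L \<mu> (\<psi> i))"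
proof (rule Lipschitz_partition_of_unity[OF assms(2,4)])
  fix I :: "'d set" and \<kappa> :: real and \<psi> :: "'d \<Rightarrow> 'd \<Rightarrow> real"
  assume *: "finite I" "I \<subseteq> K" "0 < \<kappa>" "\<And>i. i \<in> I \<Longrightarrow> \<psi> i \<in> nonneg_BL1"
    "\<And>i y. \<psi> i y \<noteq> 0 \<Longrightarrow> dist i y < \<eta>" "\<And>y. (\<Sum>i\<in>I. \<kappa> * \<psi> i y) \<le> 1"
    "\<And>y. y \<in> K \<Longrightarrow> (\<Sum>i\<in>I. \<kappa> * \<psi> i y) = 1"
  interpret prob_space \<mu> using assms(1) by (simp add: borel_law_def)
  have K: "K \<in> sets \<mu>" using assms(1,2) by (simp add: borel_law_def borel_closed compact_imp_closed)
  have int: "integrable \<mu> (\<psi> i)" if "i \<in> I" for i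
    using borel_law_integrable[OF assms(1)] nonneg_BL1D(4)[OF *(4)[OF that]] .
  have "measure \<mu> K = (\<integral>y. indicator K y \<partial>\<mu>)" using K by simp
  also have "\<dots> \<le> (\<integral>y. (\<Sum>i\<in>I. \<kappa> * \<psi> i y) \<partial>\<mu>)"
  proof (rule integral_mono)
    show "integrable \<mu> (indicator K :: 'd \<Rightarrow> real)"
      using K by (intro integrable_real_indicator) (auto simp: emeasure_finite less_top[symmetric])
    show "integrable \<mu> (\<lambda>y. \<Sum>i\<in>I. \<kappa> * \<psi> i y)" using int by simp
    fix y show "indicator K y \<le> (\<Sum>i\<in>I. \<kappa> * \<psi> i y)"
      using *(7)[of y] nonneg_BL1D(1)[OF *(4)] *(3) by (auto simp: indicator_def intro!: sum_nonneg mult_nonneg_nonneg)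
  qed
  also have "\<dots> = (\<Sum>i\<in>I. \<kappa> * integral\<^sup>L \<mu> (\<psi> i))" using int by simp
  finally have "1 - \<epsilon> \<le> (\<Sum>i\<in>I. \<kappa> * integral\<^sup>L \<mu> (\<psi> i))" using assms(3) by linarith
  with * show ?thesis by (intro that[of I \<kappa> \<psi>])
qed

section \<open>Approximation on triples by sums of products\<close>

text \<open>The last argument records what the integral against the threefold product of
  \<open>\<mu>\<close> would be, carried along with the construction. No measure on triples is
  formed; in a nonseparable space the product sigma-algebra may miss Borel sets.\<close>

inductive product_span :: "'d::metric_space measure \<Rightarrow> ('d \<times> 'd \<times> 'd \<Rightarrow> real) \<Rightarrow> real \<Rightarrow> bool" for \<mu> where
  prod: "\<phi> \<in> nonneg_BL1 \<Longrightarrow> \<psi> \<in> nonneg_BL1 \<Longrightarrow> \<xi> \<in> nonneg_BL1 \<Longrightarrow>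
    product_span \<mu> (\<lambda>(x, y, z). \<phi> x * \<psi> y * \<xi> z) (integral\<^sup>L \<mu> \<phi> * integral\<^sup>L \<mu> \<psi> * integral\<^sup>L \<mu> \<xi>)"
| add: "product_span \<mu> F l \<Longrightarrow> product_span \<mu> G k \<Longrightarrow> product_span \<mu> (\<lambda>p. F p + G p) (l + k)"
| cmult: "product_span \<mu> F l \<Longrightarrow> product_span \<mu> (\<lambda>p. c * F p) (c * l)"

lemma product_span_asymp_mean:
  assumes "product_span \<mu> F l"
    and "\<And>\<phi> \<psi> \<xi>. \<phi> \<in> nonneg_BL1 \<Longrightarrow> \<psi> \<in> nonneg_BL1 \<Longrightarrow> \<xi> \<in> nonneg_BL1 \<Longrightarrow>
      asymp_mean M (\<lambda>n \<omega>. case Y n \<omega> of (x, y, z) \<Rightarrow> \<phi> x * \<psi> y * \<xi> z)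
        (integral\<^sup>L \<mu> \<phi> * integral\<^sup>L \<mu> \<psi> * integral\<^sup>L \<mu> \<xi>)"
  shows "asymp_mean M (\<lambda>n \<omega>. F (Y n \<omega>)) l"
  using assms(1)
proof induction
  case (prod \<phi> \<psi> \<xi>)
  then show ?case using assms(2) by simp
qed (simp_all add: asymp_mean_add asymp_mean_cmult)

lemma product_span_const:
  assumes "prob_space \<mu>"
  shows "product_span \<mu> (\<lambda>_. c) c"
proof -
  have "product_span \<mu> (\<lambda>p. c * (case p of (x, y, z) \<Rightarrow> 1 * 1 * 1))
     (c * (integral\<^sup>L \<mu> (\<lambda>_. 1) * integral\<^sup>L \<mu> (\<lambda>_. 1) * integral\<^sup>L \<mu> (\<lambda>_. 1)))"
    by (intro product_span.intros nonneg_BL1_const) auto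
  then show ?thesis using prob_space.prob_space[OF assms] by (simp add: case_prod_unfold)
qed

lemma product_span_sum:
  assumes "prob_space \<mu>" "finite I" "\<And>i. i \<in> I \<Longrightarrow> product_span \<mu> (F i) (l i)"
  shows "product_span \<mu> (\<lambda>p. \<Sum>i\<in>I. F i p) (\<Sum>i\<in>I. l i)"
  using assms(2,3) by (induction rule: finite_induct) (simp_all add: product_span_const[OF assms(1)] add)

lemma dist_triple_le:
  "dist (x, y, z) (x', y', z') \<le> dist x x' + dist y y' + dist z z'"
proof -
  have "dist (x, y, z) (x', y', z') \<le> dist x x' + dist (y, z) (y', z')"
    unfolding dist_Pair_Pair[of x] by (rule sqrt_sum_squares_le_sum) auto
  also have "dist (y, z) (y', z') \<le> dist y y' + dist z z'"
    unfolding dist_Pair_Pair by (rule sqrt_sum_squares_le_sum) auto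
  finally show ?thesis by simp
qed

text \<open>The radius is a Lebesgue number of the cover of \<open>K\<close> by preimages of balls
  of radius \<open>\<delta>/2\<close>. The point \<open>q\<close> ranges over the whole space, which
  is more than uniform continuity on \<open>K\<close> gives: the points later compared with grid
  points need not lie in the compact set.\<close>

lemma uniform_radius:
  fixes f :: "'d::metric_space \<Rightarrow> real"
  assumes "compact K" "continuous_on UNIV f" "0 < \<delta>"
  obtains e where "0 < e" "\<And>p q. p \<in> K \<Longrightarrow> dist p q < e \<Longrightarrow> \<bar>f p - f q\<bar> < \<delta>"
proof -
  have "open (f -` ball c (\<delta>/2))" for c
    using assms(2) by (simp add: continuous_on_open_vimage)
  moreover have "K \<subseteq> \<Union>(range (\<lambda>c. f -` ball c (\<delta>/2)))"
  proof
    fix p have "p \<in> f -` ball (f p) (\<delta>/2)" using assms(3) by simp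
    then show "p \<in> \<Union>(range (\<lambda>c. f -` ball c (\<delta>/2)))" by blast
  qed
  ultimately obtain e where e: "0 < e" "\<And>p. p \<in> K \<Longrightarrow> \<exists>G\<in>range (\<lambda>c. f -` ball c (\<delta>/2)). ball p e \<subseteq> G"
    by (rule_tac Heine_Borel_lemma[OF assms(1), of "range (\<lambda>c. f -` ball c (\<delta>/2))"]) auto
  show ?thesis
  proof (rule that[OF e(1)])
    fix p q assume "p \<in> K" "dist p q < e"
    with e obtain c where "ball p e \<subseteq> f -` ball c (\<delta>/2)" by blast
    with e(1) \<open>dist p q < e\<close> have "dist c (f p) < \<delta>/2" "dist c (f q) < \<delta>/2" by (auto simp: subset_iff)
    then show "\<bar>f p - f q\<bar> < \<delta>" unfolding dist_real_def by linarith
  qed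
qed

text \<open>Values of \<open>f\<close> at grid triples are interpolated with products of partition
  functions. Away from the compact set the approximation may be poor, so the error is bounded not by
  a constant but by a function \<open>R\<close> of the same span: the number attached to
  \<open>R\<close> is known, and small.\<close>

lemma product_span_approximation:
  fixes \<mu> :: "'d::metric_space measure"
  assumes "borel_law \<mu>" "tight_law \<mu>" "f \<in> bounded_continuous" "0 < \<epsilon>"
  obtains F l R r where "product_span \<mu> F l" "product_span \<mu> R r" "r \<le> \<epsilon>" "\<And>p. \<bar>f p - F p\<bar> \<le> R p"
proof -
  obtain C where C: "C \<ge> 0" "\<And>p. \<bar>f p\<bar> \<le> C" "continuous_on UNIV f"
    using bounded_continuousD[OF assms(3)] by blast
  \<comment> \<open>Chosen so that \<open>3 * C * \<epsilon>'\<close>, the missing mass in three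
    coordinates weighted by \<open>C\<close>, is at most \<open>\<epsilon> / 2\<close>; the summand
    \<open>1\<close> covers \<open>C = 0\<close>.\<close>
  define \<epsilon>' where "\<epsilon>' = \<epsilon> / (6 * (C + 1))"
  have \<epsilon>': "0 < \<epsilon>'" "3 * C * \<epsilon>' \<le> \<epsilon> / 2" using C(1) assms(4) by (auto simp: \<epsilon>'_def field_simps)
  obtain K where K: "compact K" "1 - \<epsilon>' \<le> measure \<mu> K"
    using assms(2) \<epsilon>'(1) by (auto simp: tight_law_def)
  have "compact (K \<times> K \<times> K)" by (intro compact_Times K)
  then obtain e where e: "0 < e" "\<And>p q. p \<in> K \<times> K \<times> K \<Longrightarrow> dist p q < e \<Longrightarrow> \<bar>f p - f q\<bar> < \<epsilon>/2"
    using uniform_radius[OF _ C(3), of "K \<times> K \<times> K" "\<epsilon>/2"] assms(4) by auto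
  \<comment> \<open>One third per coordinate, as the distance of triples is at most the sum of the
    three distances.\<close>
  have e3: "0 < e/3" using e(1) by simp
  obtain I \<psi> \<kappa> where I: "finite I" "I \<subseteq> K" "0 < \<kappa>" "\<And>i. i \<in> I \<Longrightarrow> \<psi> i \<in> nonneg_BL1"
    "\<And>i y. \<psi> i y \<noteq> 0 \<Longrightarrow> dist i y < e/3"
    "\<And>y. (\<Sum>i\<in>I. \<kappa> * \<psi> i y) \<le> 1" "1 - \<epsilon>' \<le> (\<Sum>i\<in>I. \<kappa> * integral\<^sup>L \<mu> (\<psi> i))"
    by (rule tight_partition_of_unity[OF assms(1) K e3]) (rule that)
  define S where "S y = (\<Sum>i\<in>I. \<kappa> * \<psi> i y)" for y
  have \<psi>0: "0 \<le> \<psi> i y" if "i \<in> I" for i y using nonneg_BL1D(1)[OF I(4)[OF that]] .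
  have S: "0 \<le> S y" "S y \<le> 1" for y
    using I(3,6) \<psi>0 by (auto simp: S_def intro!: sum_nonneg)
  define J where "J = I \<times> I \<times> I"
  have J: "finite J" using I(1) by (simp add: J_def)
  define w where "w q p = (case (q, p) of ((i, j, k), (x, y, z)) \<Rightarrow> \<psi> i x * \<psi> j y * \<psi> k z)" for q p
  define F where "F p = (\<Sum>q\<in>J. f q * \<kappa>^3 * w q p)" for p
  \<comment> \<open>This is
    \<open>\<epsilon>/2 + C * (1 - S x) + C * (1 - S y) + C * (1 - S z)\<close>, expanded so that
    every summand has the shape required by \<open>product_span\<close>, with the constant
    \<open>1\<close> in the two other coordinates.\<close>
  define R where "R p = (\<epsilon>/2 + 3 * C) + ((\<Sum>i\<in>I. - C * \<kappa> * (case p of (x, y, z) \<Rightarrow> \<psi> i x * 1 * 1))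
      + ((\<Sum>i\<in>I. - C * \<kappa> * (case p of (x, y, z) \<Rightarrow> 1 * \<psi> i y * 1))
        + (\<Sum>i\<in>I. - C * \<kappa> * (case p of (x, y, z) \<Rightarrow> 1 * 1 * \<psi> i z))))" for p
  have prob: "prob_space \<mu>" using assms(1) by (simp add: borel_law_def)
  have mu1: "integral\<^sup>L \<mu> (\<lambda>_. 1 :: real) = 1" using prob_space.prob_space[OF prob] by simp
  have one: "(\<lambda>_. 1) \<in> nonneg_BL1" by (rule nonneg_BL1_const) auto
  have R: "R (x, y, z) = \<epsilon>/2 + C * (1 - S x) + C * (1 - S y) + C * (1 - S z)" for x y z
    by (simp add: R_def S_def sum_negf sum_distrib_left algebra_simps)
  let ?m = "\<lambda>i. integral\<^sup>L \<mu> (\<psi> i)"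
  show ?thesis
  proof (rule that)
    show "product_span \<mu> F (\<Sum>q\<in>J. f q * \<kappa>^3 * (case q of (i, j, k) \<Rightarrow> ?m i * ?m j * ?m k))"
      unfolding F_def
    proof (intro product_span_sum[OF prob J] product_span.cmult)
      fix q assume "q \<in> J"
      then obtain i j k where q: "q = (i, j, k)" "i \<in> I" "j \<in> I" "k \<in> I" by (auto simp: J_def)
      then show "product_span \<mu> (w q) (case q of (i, j, k) \<Rightarrow> ?m i * ?m j * ?m k)"
        using product_span.prod[OF I(4)[OF q(2)] I(4)[OF q(3)] I(4)[OF q(4)], of \<mu>]
        by (simp add: w_def[abs_def] case_prod_unfold)
    qed
    let ?l = "integral\<^sup>L \<mu> (\<lambda>_. 1 :: real)"
    show "product_span \<mu> R ((\<epsilon>/2 + 3 * C) + ((\<Sum>i\<in>I. - C * \<kappa> * (?m i * ?l * ?l))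
      + ((\<Sum>i\<in>I. - C * \<kappa> * (?l * ?m i * ?l)) + (\<Sum>i\<in>I. - C * \<kappa> * (?l * ?l * ?m i)))))"
      unfolding R_def
      by (intro product_span.add product_span_sum[OF prob I(1)] product_span.cmult product_span.prod
            product_span_const[OF prob] one I(4))
    have "3 * C * (1 - (\<Sum>i\<in>I. \<kappa> * ?m i)) \<le> 3 * C * \<epsilon>'"
      using C(1) I(7) by (intro mult_left_mono) auto
    also note \<epsilon>'(2)
    finally show "(\<epsilon>/2 + 3 * C) + ((\<Sum>i\<in>I. - C * \<kappa> * (?m i * ?l * ?l))
      + ((\<Sum>i\<in>I. - C * \<kappa> * (?l * ?m i * ?l)) + (\<Sum>i\<in>I. - C * \<kappa> * (?l * ?l * ?m i)))) \<le> \<epsilon>"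
      unfolding mu1 by (simp add: sum_negf mult.assoc sum_distrib_left[symmetric] algebra_simps)
  next
    fix p :: "'d \<times> 'd \<times> 'd"
    obtain x y z where p: "p = (x, y, z)" by (cases p)
    define s where "s = S x * S y * S z"
    have s: "(\<Sum>q\<in>J. \<kappa>^3 * w q p) = s"
    proof -
      have s': "s = S x * (S y * S z)" by (simp add: s_def mult.assoc)
      have "s = (\<Sum>q\<in>J. \<kappa> * \<psi> (fst q) x * (\<kappa> * \<psi> (fst (snd q)) y * (\<kappa> * \<psi> (snd (snd q)) z)))"
        unfolding s'
        by (simp only: S_def J_def sum_product sum.cartesian_product case_prod_unfold)
      then show ?thesis by (simp add: w_def p case_prod_unfold power3_eq_cube mult_ac)
    qed
    have w0: "0 \<le> \<kappa>^3 * w q p" if "q \<in> J" for q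
      using that \<psi>0 I(3) by (auto simp: w_def p J_def)
    \<comment> \<open>A nonzero weight forces each coordinate of \<open>p\<close> to be within
      \<open>e/3\<close> of that of \<open>q\<close>. The uniform radius applies because
      \<open>q\<close> lies in \<open>K \<times> K \<times> K\<close>, wherever \<open>p\<close>
      is.\<close>
    have near: "\<bar>(f p - f q) * (\<kappa>^3 * w q p)\<bar> \<le> \<epsilon>/2 * (\<kappa>^3 * w q p)" if q: "q \<in> J" for q
    proof (cases "w q p = 0")
      case False
      obtain i j k where ijk: "q = (i, j, k)" by (cases q)
      with False have "dist i x < e/3" "dist j y < e/3" "dist k z < e/3"
        using I(5) by (auto simp: w_def p)
      then have "dist q p < e"
        using dist_triple_le[of i j k x y z] by (simp add: p ijk)
      moreover have "q \<in> K \<times> K \<times> K" using q I(2) by (auto simp: J_def)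
      ultimately have "\<bar>f p - f q\<bar> \<le> \<epsilon>/2" using e(2)[of q p] by (simp add: abs_minus_commute)
      with w0[OF q] show ?thesis by (simp only: abs_mult[of "f p - f q"] abs_of_nonneg mult_right_mono)
    qed simp
    have "f p - F p = f p * (1 - s) + (\<Sum>q\<in>J. (f p - f q) * (\<kappa>^3 * w q p))"
      by (simp add: F_def s[symmetric] sum_subtractf left_diff_distrib right_diff_distrib sum_distrib_left mult.assoc)
    also have "\<bar>\<dots>\<bar> \<le> \<bar>f p * (1 - s)\<bar> + (\<Sum>q\<in>J. \<bar>(f p - f q) * (\<kappa>^3 * w q p)\<bar>)"
      by (intro order_trans[OF abs_triangle_ineq] add_left_mono sum_abs)
    also have "(\<Sum>q\<in>J. \<bar>(f p - f q) * (\<kappa>^3 * w q p)\<bar>) \<le> (\<Sum>q\<in>J. \<epsilon>/2 * (\<kappa>^3 * w q p))"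
      by (intro sum_mono near)
    also have "\<dots> = \<epsilon>/2 * s" by (simp add: s[symmetric] sum_distrib_left mult.assoc)
    finally have main: "\<bar>f p - F p\<bar> \<le> \<bar>f p * (1 - s)\<bar> + \<epsilon>/2 * s" by simp
    have xy: "S x * S y \<le> 1" "0 \<le> S x * S y" using S by (auto intro: mult_le_one)
    then have s1: "0 \<le> s" "s \<le> 1" using S[of z] by (auto simp: s_def intro!: mult_le_one)
    \<comment> \<open>Expanding these two nonnegative products yields the union bound
      \<open>1 - S x * S y * S z \<le> (1 - S x) + (1 - S y) + (1 - S z)\<close>.\<close>
    have "0 \<le> (1 - S x) * (1 - S y)" "0 \<le> (1 - S x * S y) * (1 - S z)"
      using S xy by (auto intro: mult_nonneg_nonneg)
    then have "1 - s \<le> (1 - S x) + (1 - S y) + (1 - S z)" by (simp add: s_def algebra_simps)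
    then have "C * (1 - s) \<le> C * ((1 - S x) + (1 - S y) + (1 - S z))" using C(1) by (rule mult_left_mono)
    moreover have "\<bar>f p * (1 - s)\<bar> \<le> C * (1 - s)"
      using C(2)[of p] s1 by (simp add: abs_mult mult_right_mono)
    moreover have "\<epsilon>/2 * s \<le> \<epsilon>/2" using s1 assms(4) by simp
    ultimately have "\<bar>f p - F p\<bar> \<le> \<epsilon>/2 + C * ((1 - S x) + (1 - S y) + (1 - S z))"
      using main by linarith
    then show "\<bar>f p - F p\<bar> \<le> R p" unfolding p R by (simp only: distrib_left add.assoc)
  qed
qed

text \<open>Both sequences are compared with the same number \<open>l\<close> attached to an
  approximant of \<open>f\<close>, so no limit law on triples enters.\<close>

lemma weak_equivalence_by_products:
  fixes Y :: "nat \<Rightarrow> 'w \<Rightarrow> 'd::metric_space \<times> 'd \<times> 'd" and Z :: "nat \<Rightarrow> 'u \<Rightarrow> 'd \<times> 'd \<times> 'd"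
  assumes "borel_law \<mu>" "tight_law \<mu>"
    and Y: "\<And>\<phi> \<psi> \<xi>. \<phi> \<in> nonneg_BL1 \<Longrightarrow> \<psi> \<in> nonneg_BL1 \<Longrightarrow> \<xi> \<in> nonneg_BL1 \<Longrightarrow>
      asymp_mean M (\<lambda>n \<omega>. case Y n \<omega> of (x, y, z) \<Rightarrow> \<phi> x * \<psi> y * \<xi> z)
        (integral\<^sup>L \<mu> \<phi> * integral\<^sup>L \<mu> \<psi> * integral\<^sup>L \<mu> \<xi>)"
    and Z: "\<And>\<phi> \<psi> \<xi>. \<phi> \<in> nonneg_BL1 \<Longrightarrow> \<psi> \<in> nonneg_BL1 \<Longrightarrow> \<xi> \<in> nonneg_BL1 \<Longrightarrow>
      asymp_mean N (\<lambda>n \<omega>. case Z n \<omega> of (x, y, z) \<Rightarrow> \<phi> x * \<psi> y * \<xi> z)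
        (integral\<^sup>L \<mu> \<phi> * integral\<^sup>L \<mu> \<psi> * integral\<^sup>L \<mu> \<xi>)"
  shows "weakly_equivalent M Y N Z"
  unfolding weakly_equivalent_def
proof
  fix f :: "'d \<times> 'd \<times> 'd \<Rightarrow> real" assume f: "f \<in> bounded_continuous"
  \<comment> \<open>\<open>U n\<close> approximates \<open>f (V n)\<close> up to
    \<open>W n + (U n - L n)\<close>, whose integrals tend to \<open>r\<close>; the distance from
    the integral of \<open>U n\<close> to \<open>l\<close> costs another
    \<open>\<epsilon>\<close>.\<close>
  have close: "\<forall>\<^sub>F n in sequentially. \<bar>outer_expectation (M' n) (\<lambda>\<omega>. f (V n \<omega>)) - l\<bar> < r + 3 * \<epsilon>"
    if F: "asymp_mean M' (\<lambda>n \<omega>. F (V n \<omega>)) l" "asymp_mean M' (\<lambda>n \<omega>. R (V n \<omega>)) r"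
      and fF: "\<And>p. \<bar>f p - F p\<bar> \<le> R p" and "0 < \<epsilon>"
    for M' :: "nat \<Rightarrow> 'v measure" and V F l R r and \<epsilon> :: real
  proof -
    obtain L U where 1: "\<And>n. integrable (M' n) (L n)" "\<And>n. integrable (M' n) (U n)"
      "\<And>n \<omega>. \<omega> \<in> space (M' n) \<Longrightarrow> L n \<omega> \<le> F (V n \<omega>)" "\<And>n \<omega>. \<omega> \<in> space (M' n) \<Longrightarrow> F (V n \<omega>) \<le> U n \<omega>"
      "(\<lambda>n. integral\<^sup>L (M' n) (L n)) \<longlonglongrightarrow> l" "(\<lambda>n. integral\<^sup>L (M' n) (U n)) \<longlonglongrightarrow> l"
      using asymp_meanE[OF F(1)] by blast
    obtain L' W where 2: "\<And>n. integrable (M' n) (L' n)" "\<And>n. integrable (M' n) (W n)"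
      "\<And>n \<omega>. \<omega> \<in> space (M' n) \<Longrightarrow> L' n \<omega> \<le> R (V n \<omega>)"
      "\<And>n \<omega>. \<omega> \<in> space (M' n) \<Longrightarrow> R (V n \<omega>) \<le> W n \<omega>"
      "(\<lambda>n. integral\<^sup>L (M' n) (L' n)) \<longlonglongrightarrow> r" "(\<lambda>n. integral\<^sup>L (M' n) (W n)) \<longlonglongrightarrow> r"
      using asymp_meanE[OF F(2)] by blast
    have le: "\<bar>outer_expectation (M' n) (\<lambda>\<omega>. f (V n \<omega>)) - integral\<^sup>L (M' n) (U n)\<bar> \<le>
      integral\<^sup>L (M' n) (W n) + (integral\<^sup>L (M' n) (U n) - integral\<^sup>L (M' n) (L n))" for n
    proof -
      have "\<bar>f (V n \<omega>) - U n \<omega>\<bar> \<le> W n \<omega> + (U n \<omega> - L n \<omega>)" if "\<omega> \<in> space (M' n)" for \<omega>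
        using fF[of "V n \<omega>"] 1(3,4)[OF that] 2(4)[OF that] by linarith
      then have "\<bar>outer_expectation (M' n) (\<lambda>\<omega>. f (V n \<omega>)) - integral\<^sup>L (M' n) (U n)\<bar> \<le>
          (\<integral>\<omega>. W n \<omega> + (U n \<omega> - L n \<omega>) \<partial>M' n)"
        using 1(1,2) 2(2) by (intro outer_expectation_approx) auto
      then show ?thesis using 1(1,2)[of n] 2(2)[of n] by simp
    qed
    have "\<forall>\<^sub>F n in sequentially. \<bar>integral\<^sup>L (M' n) (U n) - l\<bar> < \<epsilon>"
      using tendstoD[OF 1(6) \<open>0 < \<epsilon>\<close>] by (simp add: dist_real_def)
    moreover have "(\<lambda>n. integral\<^sup>L (M' n) (W n) + (integral\<^sup>L (M' n) (U n) - integral\<^sup>L (M' n) (L n))) \<longlonglongrightarrow> r + (l - l)"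
      by (intro tendsto_intros 1 2)
    then have "\<forall>\<^sub>F n in sequentially.
      integral\<^sup>L (M' n) (W n) + (integral\<^sup>L (M' n) (U n) - integral\<^sup>L (M' n) (L n)) < r + \<epsilon>"
      using \<open>0 < \<epsilon>\<close> by (intro order_tendstoD) auto
    ultimately show ?thesis
      by eventually_elim (use le \<open>0 < \<epsilon>\<close> in \<open>smt (verit)\<close>)
  qed
  show "(\<lambda>n. \<bar>outer_expectation (M n) (\<lambda>\<omega>. f (Y n \<omega>)) - outer_expectation (N n) (\<lambda>\<omega>. f (Z n \<omega>))\<bar>)
          \<longlonglongrightarrow> 0"
  proof (rule tendstoI)
    fix e :: real assume e: "0 < e"
    \<comment> \<open>With \<open>r \<le> e/8\<close>, each side comes within
      \<open>e/8 + 3 * (e/8) = e/2\<close> of \<open>l\<close>.\<close>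
    then have e8: "0 < e/8" by simp
    obtain F l R r where F: "product_span \<mu> F l" "product_span \<mu> R r" "r \<le> e/8" "\<And>p. \<bar>f p - F p\<bar> \<le> R p"
      using product_span_approximation[OF assms(1,2) f e8] by blast
    have Y': "\<forall>\<^sub>F n in sequentially. \<bar>outer_expectation (M n) (\<lambda>\<omega>. f (Y n \<omega>)) - l\<bar> < r + 3 * (e/8)"
    proof (rule close[OF _ _ F(4) e8])
      show "asymp_mean M (\<lambda>n \<omega>. F (Y n \<omega>)) l" "asymp_mean M (\<lambda>n \<omega>. R (Y n \<omega>)) r"
        by (rule product_span_asymp_mean[OF F(1)] product_span_asymp_mean[OF F(2)]; rule Y; assumption)+
    qed
    have Z': "\<forall>\<^sub>F n in sequentially. \<bar>outer_expectation (N n) (\<lambda>\<omega>. f (Z n \<omega>)) - l\<bar> < r + 3 * (e/8)"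
    proof (rule close[OF _ _ F(4) e8])
      show "asymp_mean N (\<lambda>n \<omega>. F (Z n \<omega>)) l" "asymp_mean N (\<lambda>n \<omega>. R (Z n \<omega>)) r"
        by (rule product_span_asymp_mean[OF F(1)] product_span_asymp_mean[OF F(2)]; rule Z; assumption)+
    qed
    show "\<forall>\<^sub>F n in sequentially. dist \<bar>outer_expectation (M n) (\<lambda>\<omega>. f (Y n \<omega>)) - outer_expectation (N n) (\<lambda>\<omega>. f (Z n \<omega>))\<bar> 0 < e"
      using Y' Z'
      by eventually_elim (use F(3) in \<open>simp add: dist_real_def abs_less_iff\<close>)
  qed
qed

section \<open>Sections of bounded functions on product spaces\<close>

text \<open>For integrable \<open>v\<close> on a product of probability spaces, where independence
  is built in, this is a version of the conditional mean given the first coordinate.\<close>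

definition partial_mean :: "'b measure \<Rightarrow> ('a \<times> 'b \<Rightarrow> real) \<Rightarrow> 'a \<Rightarrow> real" where
  "partial_mean N v a = (\<integral>b. v (a, b) \<partial>N)"

text \<open>Two-sided bounds make the side conditions of Fubini's theorem automatic, and make the
  sections integrable for every \<open>a\<close> rather than for almost every one.\<close>

lemma partial_mean:
  assumes "prob_space M" "prob_space N" and v: "v \<in> borel_measurable (M \<Otimes>\<^sub>M N)"
    and lo: "\<And>a b. a \<in> space M \<Longrightarrow> b \<in> space N \<Longrightarrow> lo \<le> v (a, b)"
    and hi: "\<And>a b. a \<in> space M \<Longrightarrow> b \<in> space N \<Longrightarrow> v (a, b) \<le> hi"
  shows partial_mean_measurable: "partial_mean N v \<in> borel_measurable M"
    and integral_partial_mean: "(\<integral>a. partial_mean N v a \<partial>M) = integral\<^sup>L (M \<Otimes>\<^sub>M N) v"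
    and integrable_section: "a \<in> space M \<Longrightarrow> integrable N (\<lambda>b. v (a, b))"
    and partial_mean_ge: "a \<in> space M \<Longrightarrow> lo \<le> partial_mean N v a"
    and partial_mean_le: "a \<in> space M \<Longrightarrow> partial_mean N v a \<le> hi"
    and integrable_partial_mean: "integrable M (partial_mean N v)"
    and integrable_pair: "integrable (M \<Otimes>\<^sub>M N) v"
proof -
  interpret M: prob_space M by fact
  interpret N: prob_space N by fact
  interpret pair_prob_space M N ..
  show i: "integrable (M \<Otimes>\<^sub>M N) v"
    using v lo hi by (intro bounded_integrable[where lo=lo and hi=hi]) (auto simp: space_pair_measure)
  show "(\<integral>a. partial_mean N v a \<partial>M) = integral\<^sup>L (M \<Otimes>\<^sub>M N) v"
    unfolding partial_mean_def by (rule integral_fst'[OF i])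
  show "integrable M (partial_mean N v)"
    using integrable_fst'[OF i] by (simp add: partial_mean_def[abs_def])
  then show "partial_mean N v \<in> borel_measurable M" by (rule borel_measurable_integrable)
  assume a: "a \<in> space M"
  show ia: "integrable N (\<lambda>b. v (a, b))"
    using lo[OF a] hi[OF a] measurable_compose[OF measurable_Pair1'[OF a] v]
    by (intro N.bounded_integrable[where lo=lo and hi=hi]) auto
  show "lo \<le> partial_mean N v a" "partial_mean N v a \<le> hi"
    unfolding partial_mean_def using ia lo[OF a] hi[OF a]
    by (auto intro!: N.integral_ge_const N.integral_le_const AE_I2)
qed

lemma integral_product:
  assumes "prob_space M" "prob_space N" "f \<in> borel_measurable M" "g \<in> borel_measurable N"
    and "\<And>x. x \<in> space M \<Longrightarrow> 0 \<le> f x \<and> f x \<le> 1" "\<And>y. y \<in> space N \<Longrightarrow> 0 \<le> g y \<and> g y \<le> 1"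
  shows "integral\<^sup>L (M \<Otimes>\<^sub>M N) (\<lambda>p. f (fst p) * g (snd p)) = integral\<^sup>L M f * (integral\<^sup>L N g :: real)"
proof -
  have [measurable]: "f \<in> borel_measurable M" "g \<in> borel_measurable N" by fact+
  have "integral\<^sup>L (M \<Otimes>\<^sub>M N) (\<lambda>p. f (fst p) * g (snd p)) = (\<integral>x. partial_mean N (\<lambda>p. f (fst p) * g (snd p)) x \<partial>M)"
    using assms(5,6)
    by (intro integral_partial_mean[symmetric, where lo=0 and hi=1] assms) (auto intro: mult_le_one)
  then show ?thesis by (simp add: partial_mean_def)
qed

lemma integral_product3:
  assumes "prob_space M" "prob_space N" "prob_space K"
    and "f \<in> borel_measurable M" "g \<in> borel_measurable N" "h \<in> borel_measurable K"
    and "\<And>x. x \<in> space M \<Longrightarrow> 0 \<le> f x \<and> f x \<le> 1" "\<And>y. y \<in> space N \<Longrightarrow> 0 \<le> g y \<and> g y \<le> 1"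
      "\<And>z. z \<in> space K \<Longrightarrow> 0 \<le> h z \<and> h z \<le> 1"
  shows "integral\<^sup>L (M \<Otimes>\<^sub>M N \<Otimes>\<^sub>M K) (\<lambda>(x, y, z). f x * g y * h z) =
    integral\<^sup>L M f * integral\<^sup>L N g * (integral\<^sup>L K h :: real)"
proof -
  have [measurable]: "g \<in> borel_measurable N" "h \<in> borel_measurable K" by fact+
  have "integral\<^sup>L (M \<Otimes>\<^sub>M N \<Otimes>\<^sub>M K) (\<lambda>p. f (fst p) * (g (fst (snd p)) * h (snd (snd p)))) =
    integral\<^sup>L M f * integral\<^sup>L (N \<Otimes>\<^sub>M K) (\<lambda>p. g (fst p) * h (snd p))"
    using assms(8,9) by (intro integral_product prob_space_pair assms) (auto simp: space_pair_measure mult_le_one)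
  also have "integral\<^sup>L (N \<Otimes>\<^sub>M K) (\<lambda>p. g (fst p) * h (snd p)) = integral\<^sup>L N g * integral\<^sup>L K h"
    by (intro integral_product assms)
  finally show ?thesis by (simp add: case_prod_unfold mult.assoc)
qed

lemma prob_space_bootstrap: "prob_space P \<Longrightarrow> prob_space Q \<Longrightarrow> prob_space (bootstrap_space P Q)"
  unfolding bootstrap_space_def by (intro prob_space_pair)

lemma prob_space_three: "prob_space P \<Longrightarrow> prob_space (three_space P)"
  unfolding three_space_def by (intro prob_space_pair)

text \<open>Given the data \<open>a\<close>, the two weights are independent, so the conditional
  mean of the product factorises. With \<open>v = w\<close> and \<open>u = 1\<close> this identifies
  the mean square of a conditional mean with an integral over
  \<open>bootstrap_space\<close>.\<close>

lemma bootstrap_integral_product: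
  assumes "prob_space P" "prob_space Q"
    and u: "u \<in> borel_measurable P" "\<And>a. a \<in> space P \<Longrightarrow> 0 \<le> u a \<and> u a \<le> 1"
    and v: "v \<in> borel_measurable (P \<Otimes>\<^sub>M Q)"
      "\<And>a b. a \<in> space P \<Longrightarrow> b \<in> space Q \<Longrightarrow> 0 \<le> v (a, b) \<and> v (a, b) \<le> 1"
    and w: "w \<in> borel_measurable (P \<Otimes>\<^sub>M Q)"
      "\<And>a b. a \<in> space P \<Longrightarrow> b \<in> space Q \<Longrightarrow> 0 \<le> w (a, b) \<and> w (a, b) \<le> 1"
  shows "integrable (bootstrap_space P Q) (\<lambda>(a, b, c). u a * v (a, b) * w (a, c))" (is "integrable _ ?f")
    and "integral\<^sup>L (bootstrap_space P Q) (\<lambda>(a, b, c). u a * v (a, b) * w (a, c)) =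
      (\<integral>a. u a * partial_mean Q v a * partial_mean Q w a \<partial>P)"
proof -
  note [measurable] = u(1) v(1) w(1)
  have QQ: "prob_space (Q \<Otimes>\<^sub>M Q)" by (intro prob_space_pair assms)
  have m: "?f \<in> borel_measurable (P \<Otimes>\<^sub>M Q \<Otimes>\<^sub>M Q)" by measurable
  have b: "0 \<le> ?f (a, p)" "?f (a, p) \<le> 1" if "a \<in> space P" "p \<in> space (Q \<Otimes>\<^sub>M Q)" for a p
    using that u(2) v(2) w(2) by (auto simp: space_pair_measure intro!: mult_le_one)
  show "integrable (bootstrap_space P Q) ?f"
    unfolding bootstrap_space_def using b by (intro integrable_pair[OF assms(1) QQ m])
  have "partial_mean (Q \<Otimes>\<^sub>M Q) ?f a = u a * partial_mean Q v a * partial_mean Q w a" if a: "a \<in> space P" for a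
  proof -
    have "integral\<^sup>L (Q \<Otimes>\<^sub>M Q) (\<lambda>p. v (a, fst p) * w (a, snd p)) = partial_mean Q v a * partial_mean Q w a"
      unfolding partial_mean_def
      using v(2)[OF a] w(2)[OF a] a
      by (intro integral_product assms measurable_compose[OF measurable_Pair1'[OF a]] v w)
    then show ?thesis by (simp add: partial_mean_def case_prod_unfold mult.assoc)
  qed
  then show "integral\<^sup>L (bootstrap_space P Q) ?f = (\<integral>a. u a * partial_mean Q v a * partial_mean Q w a \<partial>P)"
    unfolding bootstrap_space_def
    using integral_partial_mean[OF assms(1) QQ m b] by (simp cong: Bochner_Integration.integral_cong)
qed

text \<open>Fubini's theorem for both bracketings of the triple product: \<open>V\<close> is a
  section integral on \<open>(P \<Otimes>\<^sub>M Q) \<Otimes>\<^sub>M Q\<close>, while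
  \<open>U\<close> lives on \<open>P \<Otimes>\<^sub>M Q \<Otimes>\<^sub>M Q\<close>. The iterated
  integrals agree for each fixed \<open>a\<close>.\<close>

lemma bootstrap_integrate_out:
  fixes U :: "'a \<times> 'b \<times> 'b \<Rightarrow> real"
  assumes "prob_space P" "prob_space Q" and U: "U \<in> borel_measurable (bootstrap_space P Q)"
    and b: "\<And>a b c. a \<in> space P \<Longrightarrow> b \<in> space Q \<Longrightarrow> c \<in> space Q \<Longrightarrow> 0 \<le> U (a, b, c) \<and> U (a, b, c) \<le> 1"
  defines "V \<equiv> \<lambda>(a, b). \<integral>c. U (a, b, c) \<partial>Q"
  shows "V \<in> borel_measurable (P \<Otimes>\<^sub>M Q)" "integral\<^sup>L (P \<Otimes>\<^sub>M Q) V = integral\<^sup>L (bootstrap_space P Q) U"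
    and "\<And>a b. a \<in> space P \<Longrightarrow> b \<in> space Q \<Longrightarrow> 0 \<le> V (a, b) \<and> V (a, b) \<le> 1"
    and "\<And>a b. a \<in> space P \<Longrightarrow> b \<in> space Q \<Longrightarrow> integrable Q (\<lambda>c. U (a, b, c))"
proof -
  have U' [measurable]: "U \<in> borel_measurable (P \<Otimes>\<^sub>M Q \<Otimes>\<^sub>M Q)" using U by (simp add: bootstrap_space_def)
  have PQ: "prob_space (P \<Otimes>\<^sub>M Q)" and QQ: "prob_space (Q \<Otimes>\<^sub>M Q)" by (intro prob_space_pair assms)+
  let ?U = "\<lambda>p. U (fst (fst p), snd (fst p), snd p)"
  have m: "?U \<in> borel_measurable ((P \<Otimes>\<^sub>M Q) \<Otimes>\<^sub>M Q)" by measurable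
  have V: "V = partial_mean Q ?U" by (auto simp: V_def partial_mean_def fun_eq_iff)
  have b': "0 \<le> ?U (p, c)" "?U (p, c) \<le> 1" if "p \<in> space (P \<Otimes>\<^sub>M Q)" "c \<in> space Q" for p c
    using that b by (auto simp: space_pair_measure)
  note pm = partial_mean[OF PQ assms(2) m b']
  show Vm: "V \<in> borel_measurable (P \<Otimes>\<^sub>M Q)" unfolding V by (rule pm(1))
  show Vb: "0 \<le> V (a, b) \<and> V (a, b) \<le> 1" if "a \<in> space P" "b \<in> space Q" for a b
    unfolding V using pm(4,5)[of "(a, b)"] that by (auto simp: space_pair_measure)
  show "integrable Q (\<lambda>c. U (a, b, c))" if "a \<in> space P" "b \<in> space Q" for a b
    using pm(3)[of "(a, b)"] that by (auto simp: space_pair_measure)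
  have "integral\<^sup>L (P \<Otimes>\<^sub>M Q) V = (\<integral>a. partial_mean Q V a \<partial>P)"
    using Vb by (intro integral_partial_mean[symmetric, OF assms(1,2) Vm]) auto
  also have "\<dots> = (\<integral>a. partial_mean (Q \<Otimes>\<^sub>M Q) U a \<partial>P)"
  proof (rule Bochner_Integration.integral_cong[OF refl])
    fix a assume a: "a \<in> space P"
    have "(\<integral>p. partial_mean Q (\<lambda>p. U (a, p)) p \<partial>Q) = (\<integral>p. U (a, p) \<partial>(Q \<Otimes>\<^sub>M Q))"
      using b[OF a] by (intro integral_partial_mean assms measurable_compose[OF measurable_Pair1'[OF a] U']) auto
    then show "partial_mean Q V a = partial_mean (Q \<Otimes>\<^sub>M Q) U a"
      by (simp add: V_def partial_mean_def)
  qed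
  also have "\<dots> = integral\<^sup>L (bootstrap_space P Q) U"
    unfolding bootstrap_space_def
    using b by (intro integral_partial_mean[OF assms(1) QQ U', of 0 1]) (auto simp: space_pair_measure)
  finally show "integral\<^sup>L (P \<Otimes>\<^sub>M Q) V = integral\<^sup>L (bootstrap_space P Q) U" .
qed

section \<open>Conditional and unconditional convergence along a convergent sequence\<close>

lemma outer_expectation_bound:
  assumes "prob_space M" "\<And>\<omega>. \<omega> \<in> space M \<Longrightarrow> \<bar>f \<omega>\<bar> \<le> C"
  shows "\<bar>outer_expectation M f\<bar> \<le> C"
proof -
  interpret prob_space M by fact
  show ?thesis using outer_expectation_approx[of M "\<lambda>_. 0" "\<lambda>_. C" f] assms(2) by (simp add: prob_space)
qed

text \<open>The error splits into \<open>h y\<close> times the missing mass of the partition and an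
  interpolation error, which the Lipschitz constant \<open>1\<close> bounds by
  \<open>\<delta>\<close>. Neither bound involves \<open>h\<close>, so the estimate is uniform over
  \<open>BL1\<close>.\<close>

lemma BL1_partition_error:
  assumes h: "h \<in> BL1" and I: "finite I" and \<psi>: "\<And>i. i \<in> I \<Longrightarrow> 0 \<le> \<psi> i y"
    "\<And>i. i \<in> I \<Longrightarrow> \<psi> i y \<noteq> 0 \<Longrightarrow> dist i y < \<delta>" "(\<Sum>i\<in>I. \<kappa> * \<psi> i y) \<le> 1" and pos: "0 < \<kappa>" "0 \<le> \<delta>"
  shows "\<bar>h y - (\<Sum>i\<in>I. h i * (\<kappa> * \<psi> i y))\<bar> \<le> \<delta> + (1 - (\<Sum>i\<in>I. \<kappa> * \<psi> i y))"
proof -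
  let ?S = "\<Sum>i\<in>I. \<kappa> * \<psi> i y"
  have near: "\<bar>(h y - h i) * (\<kappa> * \<psi> i y)\<bar> \<le> \<delta> * (\<kappa> * \<psi> i y)" if i: "i \<in> I" for i
  proof (cases "\<psi> i y = 0")
    case False
    have "\<bar>h y - h i\<bar> \<le> dist i y"
      using h lipschitz_onD[of 1 UNIV h y i] by (simp add: BL1_def dist_real_def dist_commute)
    also have "\<dots> \<le> \<delta>" using \<psi>(2)[OF i False] by simp
    finally show ?thesis
      using \<psi>(1)[OF i] pos by (simp add: abs_mult mult_right_mono)
  qed simp
  have "h y - (\<Sum>i\<in>I. h i * (\<kappa> * \<psi> i y)) = h y * (1 - ?S) + (\<Sum>i\<in>I. (h y - h i) * (\<kappa> * \<psi> i y))"
    by (simp add: left_diff_distrib right_diff_distrib sum_subtractf sum_distrib_left)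
  also have "\<bar>\<dots>\<bar> \<le> \<bar>h y * (1 - ?S)\<bar> + (\<Sum>i\<in>I. \<bar>(h y - h i) * (\<kappa> * \<psi> i y)\<bar>)"
    by (intro order_trans[OF abs_triangle_ineq] add_left_mono sum_abs)
  also have "\<bar>h y * (1 - ?S)\<bar> \<le> 1 * (1 - ?S)"
    using h \<psi>(3) mult_right_mono[of "\<bar>h y\<bar>" 1 "1 - ?S"] by (simp add: BL1_def abs_mult)
  also have "(\<Sum>i\<in>I. \<bar>(h y - h i) * (\<kappa> * \<psi> i y)\<bar>) \<le> (\<Sum>i\<in>I. \<delta> * (\<kappa> * \<psi> i y))"
    by (intro sum_mono near)
  also have "\<dots> = \<delta> * ?S" by (simp add: sum_distrib_left)
  also have "\<delta> * ?S \<le> \<delta> * 1" using \<psi>(3) pos(2) by (rule mult_left_mono)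
  finally show ?thesis by simp
qed

text \<open>The same finitely many minorants and majorants serve every \<open>h\<close>. This is how
  a supremum over \<open>BL1\<close>, which need not be measurable in the data, acquires a
  measurable bound.\<close>

lemma BL1_outer_expectation_error:
  assumes "prob_space M" and h: "h \<in> BL1" and I: "finite I" and \<psi>: "\<And>i. i \<in> I \<Longrightarrow> \<psi> i \<in> nonneg_BL1"
    "\<And>i y. \<psi> i y \<noteq> 0 \<Longrightarrow> dist i y < \<delta>" "\<And>y. (\<Sum>i\<in>I. \<kappa> * \<psi> i y) \<le> 1" and pos: "0 < \<kappa>" "0 \<le> \<delta>"
    and L: "\<And>i. i \<in> I \<Longrightarrow> integrable M (L i)" and U: "\<And>i. i \<in> I \<Longrightarrow> integrable M (U i)"
    and LU: "\<And>i \<omega>. i \<in> I \<Longrightarrow> \<omega> \<in> space M \<Longrightarrow> L i \<omega> \<le> \<psi> i (Y \<omega>) \<and> \<psi> i (Y \<omega>) \<le> U i \<omega>"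
  shows "\<bar>outer_expectation M (\<lambda>\<omega>. h (Y \<omega>)) - (\<Sum>i\<in>I. h i * (\<kappa> * integral\<^sup>L M (L i)))\<bar> \<le>
    \<delta> + (1 - (\<Sum>i\<in>I. \<kappa> * integral\<^sup>L M (L i))) + (\<Sum>i\<in>I. \<kappa> * (integral\<^sup>L M (U i) - integral\<^sup>L M (L i)))"
proof -
  interpret prob_space M by fact
  let ?F = "\<lambda>\<omega>. \<Sum>i\<in>I. h i * (\<kappa> * L i \<omega>)"
  let ?D = "\<lambda>\<omega>. \<delta> + (1 - (\<Sum>i\<in>I. \<kappa> * L i \<omega>)) + (\<Sum>i\<in>I. \<kappa> * (U i \<omega> - L i \<omega>))"
  have "\<bar>h (Y \<omega>) - ?F \<omega>\<bar> \<le> ?D \<omega>" if \<omega>: "\<omega> \<in> space M" for \<omega>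
  proof -
    let ?y = "Y \<omega>"
    have "\<bar>h ?y - (\<Sum>i\<in>I. h i * (\<kappa> * \<psi> i ?y))\<bar> \<le> \<delta> + (1 - (\<Sum>i\<in>I. \<kappa> * \<psi> i ?y))"
      using \<psi> pos nonneg_BL1D(1) by (intro BL1_partition_error h I) auto
    moreover have "(\<Sum>i\<in>I. \<kappa> * L i \<omega>) \<le> (\<Sum>i\<in>I. \<kappa> * \<psi> i ?y)"
      using LU \<omega> pos by (intro sum_mono mult_left_mono) auto
    moreover have "\<bar>(\<Sum>i\<in>I. h i * (\<kappa> * \<psi> i ?y)) - ?F \<omega>\<bar> \<le> (\<Sum>i\<in>I. \<kappa> * (U i \<omega> - L i \<omega>))"
    proof -
      have "\<bar>h i * (\<kappa> * \<psi> i ?y) - h i * (\<kappa> * L i \<omega>)\<bar> \<le> \<kappa> * (U i \<omega> - L i \<omega>)" if i: "i \<in> I" for i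
      proof -
        have "\<bar>h i * (\<kappa> * \<psi> i ?y) - h i * (\<kappa> * L i \<omega>)\<bar> = \<bar>h i\<bar> * (\<kappa> * (\<psi> i ?y - L i \<omega>))"
          using LU[OF i \<omega>] pos by (simp add: right_diff_distrib[symmetric] abs_mult)
        also have "\<dots> \<le> 1 * (\<kappa> * (U i \<omega> - L i \<omega>))"
          using h LU[OF i \<omega>] pos by (intro mult_mono) (auto simp: BL1_def)
        finally show ?thesis by simp
      qed
      then show ?thesis unfolding sum_subtractf[symmetric] by (intro order_trans[OF sum_abs] sum_mono)
    qed
    ultimately show ?thesis by linarith
  qed
  then have "\<bar>outer_expectation M (\<lambda>\<omega>. h (Y \<omega>)) - integral\<^sup>L M ?F\<bar> \<le> integral\<^sup>L M ?D"
    using L U by (intro outer_expectation_approx) auto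
  then show ?thesis using L U by (simp add: prob_space)
qed

lemma tendsto_ennreal_zeroI:
  fixes x :: "nat \<Rightarrow> ennreal"
  assumes "\<forall>\<^sub>F n in sequentially. x n \<le> ennreal (y n)" "y \<longlonglongrightarrow> 0"
  shows "x \<longlonglongrightarrow> 0"
proof (rule tendsto_sandwich[where f="\<lambda>_. 0", OF _ assms(1)])
  show "(\<lambda>n. ennreal (y n)) \<longlonglongrightarrow> 0" using tendsto_ennrealI[OF assms(2)] by simp
qed auto

text \<open>Minorants and majorants are pulled back along a projection, which preserves their
  integrals. The middle coordinate is singled out because it is the place of the first bootstrap
  copy in the triple.\<close>

lemma three_copies_asymp_mean:
  assumes "\<And>n. prob_space (M n)" "f \<in> bounded_continuous"
    and "(\<lambda>n. outer_expectation (M n) (\<lambda>\<omega>. f (Y n \<omega>))) \<longlonglongrightarrow> l"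
    and "(\<lambda>n. inner_expectation (M n) (\<lambda>\<omega>. f (Y n \<omega>))) \<longlonglongrightarrow> l"
  shows "asymp_mean (\<lambda>n. three_space (M n)) (\<lambda>n \<omega>. f (fst (snd (three_copies (Y n) \<omega>)))) l"
proof -
  obtain C where C: "C \<ge> 0" "\<And>x. \<bar>f x\<bar> \<le> C" using bounded_continuousD[OF assms(2)] by blast
  have fC: "- C \<le> f (Y n \<omega>)" "f (Y n \<omega>) \<le> C" for n \<omega>
    using C(2)[of "Y n \<omega>"] by linarith+
  obtain L U where LU: "\<And>n. L n \<in> borel_measurable (M n)" "\<And>n. U n \<in> borel_measurable (M n)"
    "\<And>n \<omega>. \<omega> \<in> space (M n) \<Longrightarrow> - C \<le> L n \<omega>" "\<And>n \<omega>. \<omega> \<in> space (M n) \<Longrightarrow> L n \<omega> \<le> f (Y n \<omega>)"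
    "\<And>n \<omega>. \<omega> \<in> space (M n) \<Longrightarrow> f (Y n \<omega>) \<le> U n \<omega>" "\<And>n \<omega>. \<omega> \<in> space (M n) \<Longrightarrow> U n \<omega> \<le> C"
    "\<And>n. integral\<^sup>L (M n) (L n) = inner_expectation (M n) (\<lambda>\<omega>. f (Y n \<omega>))"
    "\<And>n. integral\<^sup>L (M n) (U n) = outer_expectation (M n) (\<lambda>\<omega>. f (Y n \<omega>))"
    using sandwich_sequence[of M "- C" "\<lambda>n \<omega>. f (Y n \<omega>)" C, OF assms(1) fC] by blast
  have lift: "integrable (three_space (M n)) (\<lambda>\<omega>. V (fst (snd \<omega>)))"
      "integral\<^sup>L (three_space (M n)) (\<lambda>\<omega>. V (fst (snd \<omega>))) = integral\<^sup>L (M n) V"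
    if [measurable]: "V \<in> borel_measurable (M n)" and V: "\<And>\<omega>. \<omega> \<in> space (M n) \<Longrightarrow> - C \<le> V \<omega>" "\<And>\<omega>. \<omega> \<in> space (M n) \<Longrightarrow> V \<omega> \<le> C"
    for V n
  proof -
    interpret prob_space "M n" by fact
    have p2: "prob_space (M n \<Otimes>\<^sub>M M n)" by (intro prob_space_pair assms)
    have m: "(\<lambda>\<omega>. V (fst (snd \<omega>))) \<in> borel_measurable (M n \<Otimes>\<^sub>M M n \<Otimes>\<^sub>M M n)" by measurable
    have m': "(\<lambda>\<omega>. V (fst \<omega>)) \<in> borel_measurable (M n \<Otimes>\<^sub>M M n)" by measurable
    show "integrable (three_space (M n)) (\<lambda>\<omega>. V (fst (snd \<omega>)))"
      unfolding three_space_def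
      using V by (intro integrable_pair[OF assms(1) p2 m, of "-C" C]) (auto simp: space_pair_measure)
    have "integral\<^sup>L (three_space (M n)) (\<lambda>\<omega>. V (fst (snd \<omega>))) =
        (\<integral>a. partial_mean (M n \<Otimes>\<^sub>M M n) (\<lambda>\<omega>. V (fst (snd \<omega>))) a \<partial>M n)"
      unfolding three_space_def
      using V by (intro integral_partial_mean[symmetric, OF assms(1) p2 m, of "-C" C]) (auto simp: space_pair_measure)
    also have "\<dots> = integral\<^sup>L (M n \<Otimes>\<^sub>M M n) (\<lambda>\<omega>. V (fst \<omega>))"
      by (simp add: partial_mean_def prob_space)
    also have "\<dots> = (\<integral>a. partial_mean (M n) (\<lambda>\<omega>. V (fst \<omega>)) a \<partial>M n)"
      using V by (intro integral_partial_mean[symmetric, OF assms(1,1) m', of "-C" C]) auto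
    finally show "integral\<^sup>L (three_space (M n)) (\<lambda>\<omega>. V (fst (snd \<omega>))) = integral\<^sup>L (M n) V"
      by (simp add: partial_mean_def prob_space)
  qed
  have L: "- C \<le> L n \<omega>" "L n \<omega> \<le> C" "- C \<le> U n \<omega>" "U n \<omega> \<le> C" if "\<omega> \<in> space (M n)" for n \<omega>
    using LU(3-6)[OF that] C(2)[of "Y n \<omega>"] by linarith+
  show ?thesis
  proof (rule asymp_meanI)
    show "integrable (three_space (M n)) (\<lambda>\<omega>. L n (fst (snd \<omega>)))" for n by (intro lift LU L)
    show "integrable (three_space (M n)) (\<lambda>\<omega>. U n (fst (snd \<omega>)))" for n by (intro lift LU L)
    show "(\<lambda>n. LINT \<omega>|three_space (M n). L n (fst (snd \<omega>))) \<longlonglongrightarrow> l"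
      using assms(4) LU(7) lift(2)[OF LU(1) L(1,2)] by simp
    show "(\<lambda>n. LINT \<omega>|three_space (M n). U n (fst (snd \<omega>))) \<longlonglongrightarrow> l"
      using assms(3) LU(8) lift(2)[OF LU(2) L(3,4)] by simp
  qed (auto simp: three_space_def three_copies_def space_pair_measure intro: LU)
qed

text \<open>Minorants and majorants are chosen for each coordinate separately; their products remain
  bounds by nonnegativity, and the integrals of these products factorise over the independent
  copies.\<close>

lemma three_copies_products:
  assumes M: "\<And>n. prob_space (M n)"
    and lim: "\<And>\<phi>. \<phi> \<in> nonneg_BL1 \<Longrightarrow> (\<lambda>n. outer_expectation (M n) (\<lambda>\<omega>. \<phi> (Y n \<omega>))) \<longlonglongrightarrow> m \<phi> \<and>
      (\<lambda>n. inner_expectation (M n) (\<lambda>\<omega>. \<phi> (Y n \<omega>))) \<longlonglongrightarrow> m \<phi>"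
    and \<phi>: "\<phi> \<in> nonneg_BL1" "\<psi> \<in> nonneg_BL1" "\<xi> \<in> nonneg_BL1"
  shows "asymp_mean (\<lambda>n. three_space (M n))
    (\<lambda>n \<omega>. case three_copies (Y n) \<omega> of (x, y, z) \<Rightarrow> \<phi> x * \<psi> y * \<xi> z) (m \<phi> * m \<psi> * m \<xi>)"
proof -
  have sw: "\<exists>L U. \<forall>n. L n \<in> borel_measurable (M n) \<and> U n \<in> borel_measurable (M n) \<and>
    (\<forall>\<omega>\<in>space (M n). 0 \<le> L n \<omega> \<and> L n \<omega> \<le> \<phi> (Y n \<omega>) \<and> \<phi> (Y n \<omega>) \<le> U n \<omega> \<and> U n \<omega> \<le> 1) \<and>
    integral\<^sup>L (M n) (L n) = inner_expectation (M n) (\<lambda>\<omega>. \<phi> (Y n \<omega>)) \<and>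
    integral\<^sup>L (M n) (U n) = outer_expectation (M n) (\<lambda>\<omega>. \<phi> (Y n \<omega>))" if \<phi>: "\<phi> \<in> nonneg_BL1" for \<phi>
  proof -
    have "0 \<le> \<phi> (Y n \<omega>)" "\<phi> (Y n \<omega>) \<le> 1" for n \<omega> using nonneg_BL1D[OF \<phi>] by auto
    from sandwich_sequence[of M 0 "\<lambda>n \<omega>. \<phi> (Y n \<omega>)" 1, OF M this] show ?thesis by metis
  qed
  obtain L0 U0 where 0: "\<And>n. L0 n \<in> borel_measurable (M n) \<and> U0 n \<in> borel_measurable (M n) \<and>
    (\<forall>\<omega>\<in>space (M n). 0 \<le> L0 n \<omega> \<and> L0 n \<omega> \<le> \<phi> (Y n \<omega>) \<and> \<phi> (Y n \<omega>) \<le> U0 n \<omega> \<and> U0 n \<omega> \<le> 1) \<and>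
    integral\<^sup>L (M n) (L0 n) = inner_expectation (M n) (\<lambda>\<omega>. \<phi> (Y n \<omega>)) \<and>
    integral\<^sup>L (M n) (U0 n) = outer_expectation (M n) (\<lambda>\<omega>. \<phi> (Y n \<omega>))" using sw[OF \<phi>(1)] by metis
  obtain L1 U1 where 1: "\<And>n. L1 n \<in> borel_measurable (M n) \<and> U1 n \<in> borel_measurable (M n) \<and>
    (\<forall>\<omega>\<in>space (M n). 0 \<le> L1 n \<omega> \<and> L1 n \<omega> \<le> \<psi> (Y n \<omega>) \<and> \<psi> (Y n \<omega>) \<le> U1 n \<omega> \<and> U1 n \<omega> \<le> 1) \<and>
    integral\<^sup>L (M n) (L1 n) = inner_expectation (M n) (\<lambda>\<omega>. \<psi> (Y n \<omega>)) \<and>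
    integral\<^sup>L (M n) (U1 n) = outer_expectation (M n) (\<lambda>\<omega>. \<psi> (Y n \<omega>))" using sw[OF \<phi>(2)] by metis
  obtain L2 U2 where 2: "\<And>n. L2 n \<in> borel_measurable (M n) \<and> U2 n \<in> borel_measurable (M n) \<and>
    (\<forall>\<omega>\<in>space (M n). 0 \<le> L2 n \<omega> \<and> L2 n \<omega> \<le> \<xi> (Y n \<omega>) \<and> \<xi> (Y n \<omega>) \<le> U2 n \<omega> \<and> U2 n \<omega> \<le> 1) \<and>
    integral\<^sup>L (M n) (L2 n) = inner_expectation (M n) (\<lambda>\<omega>. \<xi> (Y n \<omega>)) \<and>
    integral\<^sup>L (M n) (U2 n) = outer_expectation (M n) (\<lambda>\<omega>. \<xi> (Y n \<omega>))" using sw[OF \<phi>(3)] by metis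
  let ?prod = "\<lambda>(f :: 'a \<Rightarrow> real) (g :: 'a \<Rightarrow> real) (h :: 'a \<Rightarrow> real) (x, y, z). f x * g y * h z"
  have int: "integrable (three_space (M n)) (?prod f g h)"
    "integral\<^sup>L (three_space (M n)) (?prod f g h) = integral\<^sup>L (M n) f * integral\<^sup>L (M n) g * integral\<^sup>L (M n) h"
    if [measurable]: "f \<in> borel_measurable (M n)" "g \<in> borel_measurable (M n)" "h \<in> borel_measurable (M n)"
      and b: "\<And>\<omega>. \<omega> \<in> space (M n) \<Longrightarrow> 0 \<le> f \<omega> \<and> f \<omega> \<le> 1" "\<And>\<omega>. \<omega> \<in> space (M n) \<Longrightarrow> 0 \<le> g \<omega> \<and> g \<omega> \<le> 1"
        "\<And>\<omega>. \<omega> \<in> space (M n) \<Longrightarrow> 0 \<le> h \<omega> \<and> h \<omega> \<le> 1" for f g h n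
  proof -
    show "integral\<^sup>L (three_space (M n)) (?prod f g h) = integral\<^sup>L (M n) f * integral\<^sup>L (M n) g * integral\<^sup>L (M n) h"
      unfolding three_space_def by (intro integral_product3 M that)
    have "?prod f g h \<in> borel_measurable (three_space (M n))"
      unfolding three_space_def by measurable
    then show "integrable (three_space (M n)) (?prod f g h)"
      by (rule prob_space.bounded_integrable[OF prob_space_three[OF M], where lo=0 and hi=1])
         (auto simp: three_space_def space_pair_measure b intro!: mult_le_one)
  qed
  have B: "0 \<le> L0 n \<omega> \<and> L0 n \<omega> \<le> 1" "0 \<le> L1 n \<omega> \<and> L1 n \<omega> \<le> 1" "0 \<le> L2 n \<omega> \<and> L2 n \<omega> \<le> 1"
    "0 \<le> U0 n \<omega> \<and> U0 n \<omega> \<le> 1" "0 \<le> U1 n \<omega> \<and> U1 n \<omega> \<le> 1" "0 \<le> U2 n \<omega> \<and> U2 n \<omega> \<le> 1"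
    if "\<omega> \<in> space (M n)" for n \<omega>
    using 0[of n] 1[of n] 2[of n] that by fastforce+
  have Bm: "L0 n \<in> borel_measurable (M n)" "L1 n \<in> borel_measurable (M n)" "L2 n \<in> borel_measurable (M n)"
    "U0 n \<in> borel_measurable (M n)" "U1 n \<in> borel_measurable (M n)" "U2 n \<in> borel_measurable (M n)" for n
    using 0[of n] 1[of n] 2[of n] by blast+
  note intL = int[OF Bm(1-3) B(1-3)] and intU = int[OF Bm(4-6) B(4-6)]
  show ?thesis
  proof (rule asymp_meanI)
    show "integrable (three_space (M n)) (?prod (L0 n) (L1 n) (L2 n))" for n by (rule intL)
    show "integrable (three_space (M n)) (?prod (U0 n) (U1 n) (U2 n))" for n by (rule intU)
    show "(\<lambda>n. integral\<^sup>L (three_space (M n)) (?prod (L0 n) (L1 n) (L2 n))) \<longlonglongrightarrow> m \<phi> * m \<psi> * m \<xi>"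
    proof -
      have "integral\<^sup>L (three_space (M n)) (?prod (L0 n) (L1 n) (L2 n)) = inner_expectation (M n) (\<lambda>\<omega>. \<phi> (Y n \<omega>)) *
        inner_expectation (M n) (\<lambda>\<omega>. \<psi> (Y n \<omega>)) * inner_expectation (M n) (\<lambda>\<omega>. \<xi> (Y n \<omega>))" for n
        using intL(2)[of n] 0[of n] 1[of n] 2[of n] by (simp only:)
      then show ?thesis
        by (simp only:) (intro tendsto_mult conjunct2[OF lim] \<phi>)
    qed
    show "(\<lambda>n. integral\<^sup>L (three_space (M n)) (?prod (U0 n) (U1 n) (U2 n))) \<longlonglongrightarrow> m \<phi> * m \<psi> * m \<xi>"
    proof -
      have "integral\<^sup>L (three_space (M n)) (?prod (U0 n) (U1 n) (U2 n)) = outer_expectation (M n) (\<lambda>\<omega>. \<phi> (Y n \<omega>)) *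
        outer_expectation (M n) (\<lambda>\<omega>. \<psi> (Y n \<omega>)) * outer_expectation (M n) (\<lambda>\<omega>. \<xi> (Y n \<omega>))" for n
        using intU(2)[of n] 0[of n] 1[of n] 2[of n] by (simp only:)
      then show ?thesis
        by (simp only:) (intro tendsto_mult conjunct1[OF lim] \<phi>)
    qed
    fix n \<omega> assume "\<omega> \<in> space (three_space (M n))"
    then obtain x y z where \<omega>: "\<omega> = (x, y, z)" "x \<in> space (M n)" "y \<in> space (M n)" "z \<in> space (M n)"
      by (auto simp: three_space_def space_pair_measure)
    show "?prod (L0 n) (L1 n) (L2 n) \<omega> \<le> (case three_copies (Y n) \<omega> of (x, y, z) \<Rightarrow> \<phi> x * \<psi> y * \<xi> z)"
      using 0[of n] 1[of n] 2[of n] \<omega> nonneg_BL1D(1)[OF \<phi>(1)] nonneg_BL1D(1)[OF \<phi>(2)]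
      by (simp add: three_copies_def mult_mono)
    show "(case three_copies (Y n) \<omega> of (x, y, z) \<Rightarrow> \<phi> x * \<psi> y * \<xi> z) \<le> ?prod (U0 n) (U1 n) (U2 n) \<omega>"
      using 0[of n] 1[of n] 2[of n] \<omega> B(4-6) nonneg_BL1D(1)[OF \<phi>(1)] nonneg_BL1D(1)[OF \<phi>(2)] nonneg_BL1D(1)[OF \<phi>(3)]
      by (simp add: three_copies_def mult_mono)
  qed
qed

lemma bounded_continuous_minus: "f \<in> bounded_continuous \<Longrightarrow> (\<lambda>x. - f x) \<in> bounded_continuous"
  by (auto simp: bounded_continuous_def bounded_iff intro: continuous_on_minus)

text \<open>Two of the three factors tend to constants in mean, so the product decouples whatever
  their dependence, and for \<open>u\<close> convergence of the integrals suffices. The splitting is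
  \<open>u * v * w - u * (d * e) = u * w * (v - d) + u * d * (w - e)\<close>.\<close>

lemma tendsto_integral_product:
  assumes P: "\<And>n. prob_space (P n)"
    and u: "\<And>n. u n \<in> borel_measurable (P n)" "\<And>n a. a \<in> space (P n) \<Longrightarrow> 0 \<le> u n a \<and> u n a \<le> (1::real)"
    and v: "\<And>n. v n \<in> borel_measurable (P n)" "\<And>n a. a \<in> space (P n) \<Longrightarrow> 0 \<le> v n a \<and> v n a \<le> (1::real)"
    and w: "\<And>n. w n \<in> borel_measurable (P n)" "\<And>n a. a \<in> space (P n) \<Longrightarrow> 0 \<le> w n a \<and> w n a \<le> (1::real)"
    and lim: "(\<lambda>n. integral\<^sup>L (P n) (u n)) \<longlonglongrightarrow> c" "(\<lambda>n. \<integral>a. \<bar>v n a - d\<bar> \<partial>P n) \<longlonglongrightarrow> 0"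
      "(\<lambda>n. \<integral>a. \<bar>w n a - e\<bar> \<partial>P n) \<longlonglongrightarrow> 0"
    and d: "0 \<le> d" "d \<le> 1"
  shows "(\<lambda>n. \<integral>a. u n a * v n a * w n a \<partial>P n) \<longlonglongrightarrow> c * d * e"
proof -
  have le: "\<bar>(\<integral>a. u n a * v n a * w n a \<partial>P n) - integral\<^sup>L (P n) (u n) * (d * e)\<bar> \<le>
      (\<integral>a. \<bar>v n a - d\<bar> \<partial>P n) + (\<integral>a. \<bar>w n a - e\<bar> \<partial>P n)" for n
  proof -
    interpret prob_space "P n" by fact
    note [measurable] = u(1)[of n] v(1)[of n] w(1)[of n]
    have iu: "integrable (P n) (u n)" and iv: "integrable (P n) (v n)" and iw: "integrable (P n) (w n)"
      using u v w by (auto intro!: bounded_integrable[where lo=0 and hi=1])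
    have iprod: "integrable (P n) (\<lambda>a. u n a * v n a * w n a)"
      using u v w by (auto intro!: bounded_integrable[where lo=0 and hi=1] mult_le_one)
    have "(\<integral>a. u n a * v n a * w n a \<partial>P n) - integral\<^sup>L (P n) (u n) * (d * e) =
        (\<integral>a. u n a * v n a * w n a - u n a * (d * e) \<partial>P n)"
      using iu iprod by simp
    also have "\<bar>\<dots>\<bar> \<le> (\<integral>a. \<bar>v n a - d\<bar> + \<bar>w n a - e\<bar> \<partial>P n)"
    proof (rule order_trans[OF integral_abs_bound integral_mono])
      fix a assume a: "a \<in> space (P n)"
      have "u n a * v n a * w n a - u n a * (d * e) = u n a * w n a * (v n a - d) + u n a * d * (w n a - e)"
        by (simp add: algebra_simps)
      also have "\<bar>\<dots>\<bar> \<le> \<bar>u n a * w n a * (v n a - d)\<bar> + \<bar>u n a * d * (w n a - e)\<bar>" by (rule abs_triangle_ineq)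
      also have "\<dots> = u n a * w n a * \<bar>v n a - d\<bar> + u n a * d * \<bar>w n a - e\<bar>"
        using u(2)[OF a] w(2)[OF a] d by (simp add: abs_mult)
      also have "\<dots> \<le> 1 * \<bar>v n a - d\<bar> + 1 * \<bar>w n a - e\<bar>"
        using u(2)[OF a] w(2)[OF a] d by (intro add_mono mult_right_mono) (auto intro!: mult_le_one)
      finally show "\<bar>u n a * v n a * w n a - u n a * (d * e)\<bar> \<le> \<bar>v n a - d\<bar> + \<bar>w n a - e\<bar>" by simp
    qed (use iu iv iw iprod in auto)
    also have "\<dots> = (\<integral>a. \<bar>v n a - d\<bar> \<partial>P n) + (\<integral>a. \<bar>w n a - e\<bar> \<partial>P n)"
      using iv iw by (intro Bochner_Integration.integral_add) auto
    finally show ?thesis .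
  qed
  have "(\<lambda>n. (\<integral>a. u n a * v n a * w n a \<partial>P n) - integral\<^sup>L (P n) (u n) * (d * e)) \<longlonglongrightarrow> 0"
  proof (rule Lim_null_comparison[OF always_eventually])
    show "(\<lambda>n. (\<integral>a. \<bar>v n a - d\<bar> \<partial>P n) + (\<integral>a. \<bar>w n a - e\<bar> \<partial>P n)) \<longlonglongrightarrow> 0"
      using tendsto_add[OF lim(2,3)] by simp
  qed (simp add: le del: integral_diff)
  from tendsto_add[OF this tendsto_mult[OF lim(1) tendsto_const[of "d * e"]]]
  show ?thesis by (simp add: mult.assoc)
qed

section \<open>A sequence with a tight weak limit\<close>

text \<open>A single subsequence and its limit law are isolated here. The values lie in an arbitrary
  metric space; compactness enters through the tightness of \<open>\<mu>\<close>.\<close>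

locale bootstrap_limit =
  fixes P :: "nat \<Rightarrow> 'a measure" and Q :: "nat \<Rightarrow> 'b measure"
    and \<gamma> :: "nat \<Rightarrow> 'a \<Rightarrow> 'd::metric_space" and \<beta> :: "nat \<Rightarrow> 'a \<Rightarrow> 'b \<Rightarrow> 'd" and \<mu> :: "'d measure"
  assumes P: "\<And>n. prob_space (P n)" and Q: "\<And>n. prob_space (Q n)" and tight: "tight_law \<mu>"
    and weak: "converges_weakly (\<lambda>n. bootstrap_space (P n) (Q n)) (\<lambda>n (a, b, c). \<gamma> n a) \<mu>"
begin

abbreviation "\<Omega> n \<equiv> bootstrap_space (P n) (Q n)"
abbreviation "G n \<equiv> \<lambda>(a :: 'a, b :: 'b, c :: 'b). \<gamma> n a"
abbreviation "G1 n \<equiv> \<lambda>(a, b, c :: 'b). \<beta> n a b"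
abbreviation "mean \<phi> \<equiv> integral\<^sup>L \<mu> \<phi>"

lemma law: "borel_law \<mu>" and law_prob: "prob_space \<mu>"
  using weak by (auto simp: converges_weakly_def borel_law_def)

lemma \<Omega>: "prob_space (\<Omega> n)" by (intro prob_space_bootstrap P Q)

lemma mean_unit:
  assumes "\<phi> \<in> nonneg_BL1"
  shows "0 \<le> mean \<phi>" "mean \<phi> \<le> 1"
proof -
  interpret prob_space \<mu> by (rule law_prob)
  have "integrable \<mu> \<phi>" by (rule borel_law_integrable[OF law nonneg_BL1D(4)[OF assms]])
  then show "0 \<le> mean \<phi>" "mean \<phi> \<le> 1"
    using nonneg_BL1D(1,2)[OF assms] by (simp_all add: integral_ge_const integral_le_const)
qed

lemma outer_G: "f \<in> bounded_continuous \<Longrightarrow> (\<lambda>n. outer_expectation (\<Omega> n) (\<lambda>\<omega>. f (G n \<omega>))) \<longlonglongrightarrow> mean f"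
  using weak by (auto simp: converges_weakly_def)

text \<open>The limit is an integral and hence odd in \<open>f\<close>, so weak convergence applied
  to \<open>- f\<close> also determines the inner expectations: a weakly convergent sequence is
  asymptotically measurable.\<close>

lemma inner_G: "f \<in> bounded_continuous \<Longrightarrow> (\<lambda>n. inner_expectation (\<Omega> n) (\<lambda>\<omega>. f (G n \<omega>))) \<longlonglongrightarrow> mean f"
  using tendsto_minus[OF outer_G[OF bounded_continuous_minus]] by (simp add: inner_expectation_eq)

text \<open>Optimal minorants and majorants on the product space may depend on the weights even
  though \<open>\<gamma>\<close> does not. Averaging over both weights preserves inequalities and
  integrals and leaves functions of the data.\<close>

lemma data_sandwich:
  assumes \<phi>: "\<phi> \<in> nonneg_BL1"
  obtains L U where "\<And>n. L n \<in> borel_measurable (P n)" "\<And>n. U n \<in> borel_measurable (P n)"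
    "\<And>n a. a \<in> space (P n) \<Longrightarrow> 0 \<le> L n a \<and> L n a \<le> \<phi> (\<gamma> n a) \<and> \<phi> (\<gamma> n a) \<le> U n a \<and> U n a \<le> 1"
    "(\<lambda>n. integral\<^sup>L (P n) (L n)) \<longlonglongrightarrow> mean \<phi>" "(\<lambda>n. integral\<^sup>L (P n) (U n)) \<longlonglongrightarrow> mean \<phi>"
proof -
  have b: "0 \<le> \<phi> x" "\<phi> x \<le> 1" for x using nonneg_BL1D[OF \<phi>] by auto
  obtain L U where LU: "\<And>n. L n \<in> borel_measurable (\<Omega> n)" "\<And>n. U n \<in> borel_measurable (\<Omega> n)"
    "\<And>n \<omega>. \<omega> \<in> space (\<Omega> n) \<Longrightarrow> 0 \<le> L n \<omega>" "\<And>n \<omega>. \<omega> \<in> space (\<Omega> n) \<Longrightarrow> L n \<omega> \<le> \<phi> (G n \<omega>)"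
    "\<And>n \<omega>. \<omega> \<in> space (\<Omega> n) \<Longrightarrow> \<phi> (G n \<omega>) \<le> U n \<omega>" "\<And>n \<omega>. \<omega> \<in> space (\<Omega> n) \<Longrightarrow> U n \<omega> \<le> 1"
    "\<And>n. integral\<^sup>L (\<Omega> n) (L n) = inner_expectation (\<Omega> n) (\<lambda>\<omega>. \<phi> (G n \<omega>))"
    "\<And>n. integral\<^sup>L (\<Omega> n) (U n) = outer_expectation (\<Omega> n) (\<lambda>\<omega>. \<phi> (G n \<omega>))"
    using sandwich_sequence[of \<Omega> 0 "\<lambda>n \<omega>. \<phi> (G n \<omega>)" 1, OF \<Omega> b] by blast
  have QQ: "prob_space (Q n \<Otimes>\<^sub>M Q n)" for n by (intro prob_space_pair Q)
  have m: "L n \<in> borel_measurable (P n \<Otimes>\<^sub>M Q n \<Otimes>\<^sub>M Q n)" "U n \<in> borel_measurable (P n \<Otimes>\<^sub>M Q n \<Otimes>\<^sub>M Q n)" for n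
    using LU(1,2)[of n] by (simp_all add: bootstrap_space_def)
  have bd: "0 \<le> L n (a, p)" "L n (a, p) \<le> 1" "0 \<le> U n (a, p)" "U n (a, p) \<le> 1"
    "L n (a, p) \<le> \<phi> (\<gamma> n a)" "\<phi> (\<gamma> n a) \<le> U n (a, p)"
    if "a \<in> space (P n)" "p \<in> space (Q n \<Otimes>\<^sub>M Q n)" for n a p
  proof -
    have "(a, p) \<in> space (\<Omega> n)" using that by (auto simp: bootstrap_space_def space_pair_measure)
    from LU(3-6)[OF this] b[of "\<gamma> n a"] show "0 \<le> L n (a, p)" "L n (a, p) \<le> 1" "0 \<le> U n (a, p)" "U n (a, p) \<le> 1"
      "L n (a, p) \<le> \<phi> (\<gamma> n a)" "\<phi> (\<gamma> n a) \<le> U n (a, p)" by (auto split: prod.splits)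
  qed
  note pL = partial_mean[OF P QQ m(1) bd(1,2)] and pU = partial_mean[OF P QQ m(2) bd(3,4)]
  show ?thesis
  proof (rule that)
    show "partial_mean (Q n \<Otimes>\<^sub>M Q n) (L n) \<in> borel_measurable (P n)" for n by (rule pL)
    show "partial_mean (Q n \<Otimes>\<^sub>M Q n) (U n) \<in> borel_measurable (P n)" for n by (rule pU)
    show "(\<lambda>n. integral\<^sup>L (P n) (partial_mean (Q n \<Otimes>\<^sub>M Q n) (L n))) \<longlonglongrightarrow> mean \<phi>"
      using inner_G[OF nonneg_BL1D(4)[OF \<phi>]] LU(7) pL(2) by (simp add: bootstrap_space_def)
    show "(\<lambda>n. integral\<^sup>L (P n) (partial_mean (Q n \<Otimes>\<^sub>M Q n) (U n))) \<longlonglongrightarrow> mean \<phi>"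
      using outer_G[OF nonneg_BL1D(4)[OF \<phi>]] LU(8) pU(2) by (simp add: bootstrap_space_def)
    fix n a assume a: "a \<in> space (P n)"
    have "partial_mean (Q n \<Otimes>\<^sub>M Q n) (L n) a \<le> \<phi> (\<gamma> n a)"
      unfolding partial_mean_def using bd(5)[OF a]
      by (intro prob_space.integral_le_const QQ pL(3) a AE_I2)
    moreover have "\<phi> (\<gamma> n a) \<le> partial_mean (Q n \<Otimes>\<^sub>M Q n) (U n) a"
      unfolding partial_mean_def using bd(6)[OF a]
      by (intro prob_space.integral_ge_const QQ pU(3) a AE_I2)
    moreover have "0 \<le> partial_mean (Q n \<Otimes>\<^sub>M Q n) (L n) a"
      by (rule pL(4)) (simp_all add: a)
    moreover have "partial_mean (Q n \<Otimes>\<^sub>M Q n) (U n) a \<le> 1"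
      by (rule pU(5)) (simp_all add: a)
    ultimately show "0 \<le> partial_mean (Q n \<Otimes>\<^sub>M Q n) (L n) a \<and> partial_mean (Q n \<Otimes>\<^sub>M Q n) (L n) a \<le> \<phi> (\<gamma> n a) \<and>
      \<phi> (\<gamma> n a) \<le> partial_mean (Q n \<Otimes>\<^sub>M Q n) (U n) a \<and> partial_mean (Q n \<Otimes>\<^sub>M Q n) (U n) a \<le> 1"
      by blast
  qed
qed

text \<open>\<open>L\<close> and \<open>U\<close> see the data and one weight only, so the same pair
  bounds \<open>\<phi>\<close> of the first copy at \<open>(a, b)\<close> and of the second copy at
  \<open>(a, c)\<close>.\<close>

definition sandwiched :: "(nat \<Rightarrow> 'a \<times> 'b \<Rightarrow> real) \<Rightarrow> (nat \<Rightarrow> 'a \<times> 'b \<Rightarrow> real) \<Rightarrow> ('d \<Rightarrow> real) \<Rightarrow> bool" where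
  "sandwiched L U \<phi> \<longleftrightarrow>
    (\<forall>n. L n \<in> borel_measurable (P n \<Otimes>\<^sub>M Q n) \<and> U n \<in> borel_measurable (P n \<Otimes>\<^sub>M Q n) \<and>
      (\<forall>a\<in>space (P n). \<forall>b\<in>space (Q n).
        0 \<le> L n (a, b) \<and> L n (a, b) \<le> \<phi> (\<beta> n a b) \<and> \<phi> (\<beta> n a b) \<le> U n (a, b) \<and> U n (a, b) \<le> 1))"

text \<open>Majorants and minorants of \<open>\<phi> (G1 n)\<close> on \<open>\<Omega> n\<close> may depend on the second weight; integrating it out
  gives functions of the data and the first weight only.\<close>
lemma weights_sandwich:
  assumes \<phi>: "\<phi> \<in> nonneg_BL1"
  obtains L U where "sandwiched L U \<phi>"
    "\<And>n. integral\<^sup>L (P n \<Otimes>\<^sub>M Q n) (L n) = inner_expectation (\<Omega> n) (\<lambda>\<omega>. \<phi> (G1 n \<omega>))"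
    "\<And>n. integral\<^sup>L (P n \<Otimes>\<^sub>M Q n) (U n) = outer_expectation (\<Omega> n) (\<lambda>\<omega>. \<phi> (G1 n \<omega>))"
proof -
  have b: "0 \<le> \<phi> x" "\<phi> x \<le> 1" for x using nonneg_BL1D[OF \<phi>] by auto
  obtain L U where LU: "\<And>n. L n \<in> borel_measurable (\<Omega> n)" "\<And>n. U n \<in> borel_measurable (\<Omega> n)"
    "\<And>n \<omega>. \<omega> \<in> space (\<Omega> n) \<Longrightarrow> 0 \<le> L n \<omega>" "\<And>n \<omega>. \<omega> \<in> space (\<Omega> n) \<Longrightarrow> L n \<omega> \<le> \<phi> (G1 n \<omega>)"
    "\<And>n \<omega>. \<omega> \<in> space (\<Omega> n) \<Longrightarrow> \<phi> (G1 n \<omega>) \<le> U n \<omega>" "\<And>n \<omega>. \<omega> \<in> space (\<Omega> n) \<Longrightarrow> U n \<omega> \<le> 1"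
    "\<And>n. integral\<^sup>L (\<Omega> n) (L n) = inner_expectation (\<Omega> n) (\<lambda>\<omega>. \<phi> (G1 n \<omega>))"
    "\<And>n. integral\<^sup>L (\<Omega> n) (U n) = outer_expectation (\<Omega> n) (\<lambda>\<omega>. \<phi> (G1 n \<omega>))"
    using sandwich_sequence[of \<Omega> 0 "\<lambda>n \<omega>. \<phi> (G1 n \<omega>)" 1, OF \<Omega> b] by blast
  have bd: "0 \<le> L n (a, b, c) \<and> L n (a, b, c) \<le> 1" "0 \<le> U n (a, b, c) \<and> U n (a, b, c) \<le> 1"
    "L n (a, b, c) \<le> \<phi> (\<beta> n a b)" "\<phi> (\<beta> n a b) \<le> U n (a, b, c)"
    if "a \<in> space (P n)" "b \<in> space (Q n)" "c \<in> space (Q n)" for n a b c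
  proof -
    have "(a, b, c) \<in> space (\<Omega> n)" using that by (auto simp: bootstrap_space_def space_pair_measure)
    from LU(3-6)[OF this] b[of "\<beta> n a b"]
    show "0 \<le> L n (a, b, c) \<and> L n (a, b, c) \<le> 1" "0 \<le> U n (a, b, c) \<and> U n (a, b, c) \<le> 1"
      "L n (a, b, c) \<le> \<phi> (\<beta> n a b)" "\<phi> (\<beta> n a b) \<le> U n (a, b, c)" by auto
  qed
  note oL = bootstrap_integrate_out[OF P Q LU(1) bd(1)] and oU = bootstrap_integrate_out[OF P Q LU(2) bd(2)]
  show ?thesis
  proof (rule that)
    show "integral\<^sup>L (P n \<Otimes>\<^sub>M Q n) (\<lambda>(a, b). \<integral>c. L n (a, b, c) \<partial>Q n) = inner_expectation (\<Omega> n) (\<lambda>\<omega>. \<phi> (G1 n \<omega>))" for n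
      using oL(2) LU(7) by simp
    show "integral\<^sup>L (P n \<Otimes>\<^sub>M Q n) (\<lambda>(a, b). \<integral>c. U n (a, b, c) \<partial>Q n) = outer_expectation (\<Omega> n) (\<lambda>\<omega>. \<phi> (G1 n \<omega>))" for n
      using oU(2) LU(8) by simp
    have "0 \<le> (\<lambda>(a, b). \<integral>c. L n (a, b, c) \<partial>Q n) (a, b) \<and>
      (\<lambda>(a, b). \<integral>c. L n (a, b, c) \<partial>Q n) (a, b) \<le> \<phi> (\<beta> n a b) \<and>
      \<phi> (\<beta> n a b) \<le> (\<lambda>(a, b). \<integral>c. U n (a, b, c) \<partial>Q n) (a, b) \<and>
      (\<lambda>(a, b). \<integral>c. U n (a, b, c) \<partial>Q n) (a, b) \<le> 1"
      if ab: "a \<in> space (P n)" "b \<in> space (Q n)" for n a b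
    proof -
    have "(\<integral>c. L n (a, b, c) \<partial>Q n) \<le> \<phi> (\<beta> n a b)"
      using bd(3)[OF ab] by (intro prob_space.integral_le_const Q oL(4) ab AE_I2)
    moreover have "\<phi> (\<beta> n a b) \<le> (\<integral>c. U n (a, b, c) \<partial>Q n)"
      using bd(4)[OF ab] by (intro prob_space.integral_ge_const Q oU(4) ab AE_I2)
    moreover have "0 \<le> (\<lambda>(a, b). \<integral>c. L n (a, b, c) \<partial>Q n) (a, b) \<and>
        (\<lambda>(a, b). \<integral>c. L n (a, b, c) \<partial>Q n) (a, b) \<le> 1"
      by (rule oL(3)) (simp_all add: ab)
    moreover have "0 \<le> (\<lambda>(a, b). \<integral>c. U n (a, b, c) \<partial>Q n) (a, b) \<and>
        (\<lambda>(a, b). \<integral>c. U n (a, b, c) \<partial>Q n) (a, b) \<le> 1"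
      by (rule oU(3)) (simp_all add: ab)
    ultimately show ?thesis by auto
    qed
    then show "sandwiched (\<lambda>n (a, b). \<integral>c. L n (a, b, c) \<partial>Q n) (\<lambda>n (a, b). \<integral>c. U n (a, b, c) \<partial>Q n) \<phi>"
      unfolding sandwiched_def using oL(1) oU(1) by blast
  qed
qed

text \<open>Convergence in mean is used instead of convergence in probability. The two agree for
  functions with values in \<open>[0, 1]\<close>, but means fit second moments, products and
  Markov's inequality.\<close>

definition conditionally_convergent :: "('d \<Rightarrow> real) \<Rightarrow> bool" where
  "conditionally_convergent \<phi> \<longleftrightarrow> (\<exists>L U. sandwiched L U \<phi> \<and>
    (\<lambda>n. \<integral>a. \<bar>partial_mean (Q n) (L n) a - mean \<phi>\<bar> \<partial>P n) \<longlonglongrightarrow> 0 \<and>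
    (\<lambda>n. \<integral>a. \<bar>partial_mean (Q n) (U n) a - mean \<phi>\<bar> \<partial>P n) \<longlonglongrightarrow> 0)"

lemma sandwichedD:
  assumes "sandwiched L U \<phi>"
  shows "L n \<in> borel_measurable (P n \<Otimes>\<^sub>M Q n)" "U n \<in> borel_measurable (P n \<Otimes>\<^sub>M Q n)"
    and "a \<in> space (P n) \<Longrightarrow> b \<in> space (Q n) \<Longrightarrow> 0 \<le> L n (a, b) \<and> L n (a, b) \<le> 1"
    and "a \<in> space (P n) \<Longrightarrow> b \<in> space (Q n) \<Longrightarrow> 0 \<le> U n (a, b) \<and> U n (a, b) \<le> 1"
    and "a \<in> space (P n) \<Longrightarrow> b \<in> space (Q n) \<Longrightarrow> L n (a, b) \<le> \<phi> (\<beta> n a b) \<and> \<phi> (\<beta> n a b) \<le> U n (a, b)"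
  using assms unfolding sandwiched_def by (blast intro: order_trans)+

lemma sandwiched_partial_mean:
  assumes "sandwiched L U \<phi>"
  shows "partial_mean (Q n) (L n) \<in> borel_measurable (P n)" "partial_mean (Q n) (U n) \<in> borel_measurable (P n)"
    and "integrable (P n) (partial_mean (Q n) (L n))" "integrable (P n) (partial_mean (Q n) (U n))"
    and "integral\<^sup>L (P n) (partial_mean (Q n) (L n)) = integral\<^sup>L (P n \<Otimes>\<^sub>M Q n) (L n)"
    and "integral\<^sup>L (P n) (partial_mean (Q n) (U n)) = integral\<^sup>L (P n \<Otimes>\<^sub>M Q n) (U n)"
    and "a \<in> space (P n) \<Longrightarrow> 0 \<le> partial_mean (Q n) (L n) a \<and> partial_mean (Q n) (L n) a \<le> 1"
    and "a \<in> space (P n) \<Longrightarrow> 0 \<le> partial_mean (Q n) (U n) a \<and> partial_mean (Q n) (U n) a \<le> 1"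
    and "a \<in> space (P n) \<Longrightarrow> partial_mean (Q n) (L n) a \<le> partial_mean (Q n) (U n) a"
    and "a \<in> space (P n) \<Longrightarrow> integrable (Q n) (\<lambda>b. L n (a, b))"
    and "a \<in> space (P n) \<Longrightarrow> integrable (Q n) (\<lambda>b. U n (a, b))"
proof -
  note D = sandwichedD[OF assms]
  have bd: "0 \<le> L n (a, b)" "L n (a, b) \<le> 1" "0 \<le> U n (a, b)" "U n (a, b) \<le> 1"
    if "a \<in> space (P n)" "b \<in> space (Q n)" for a b
    using D(3,4)[OF that] by auto
  note pL = partial_mean[OF P Q D(1) bd(1,2)] and pU = partial_mean[OF P Q D(2) bd(3,4)]
  show "partial_mean (Q n) (L n) \<in> borel_measurable (P n)" by (rule pL)
  show "partial_mean (Q n) (U n) \<in> borel_measurable (P n)" by (rule pU)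
  show "integrable (P n) (partial_mean (Q n) (L n))" by (rule pL)
  show "integrable (P n) (partial_mean (Q n) (U n))" by (rule pU)
  show "integral\<^sup>L (P n) (partial_mean (Q n) (L n)) = integral\<^sup>L (P n \<Otimes>\<^sub>M Q n) (L n)" by (rule pL)
  show "integral\<^sup>L (P n) (partial_mean (Q n) (U n)) = integral\<^sup>L (P n \<Otimes>\<^sub>M Q n) (U n)" by (rule pU)
  assume a: "a \<in> space (P n)"
  show "0 \<le> partial_mean (Q n) (L n) a \<and> partial_mean (Q n) (L n) a \<le> 1"
    by (intro conjI; (rule pL(4,5)); simp add: a)
  show "0 \<le> partial_mean (Q n) (U n) a \<and> partial_mean (Q n) (U n) a \<le> 1"
    by (intro conjI; (rule pU(4,5)); simp add: a)
  show iL: "integrable (Q n) (\<lambda>b. L n (a, b))" by (rule pL(3)) (simp_all add: a)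
  show iU: "integrable (Q n) (\<lambda>b. U n (a, b))" by (rule pU(3)) (simp_all add: a)
  show "partial_mean (Q n) (L n) a \<le> partial_mean (Q n) (U n) a"
    unfolding partial_mean_def using D(5)[OF a] by (intro integral_mono iL iU) (auto intro: order_trans)
qed

text \<open>The conditional means of \<open>L\<close> and \<open>U\<close> are ordered, so their
  distance in mean is exactly the gap of the two integrals. Convergence thus carries over from the
  minorant to the majorant.\<close>

lemma conditionally_convergentI:
  assumes LU: "sandwiched L U \<phi>"
    and gap: "(\<lambda>n. integral\<^sup>L (P n \<Otimes>\<^sub>M Q n) (U n) - integral\<^sup>L (P n \<Otimes>\<^sub>M Q n) (L n)) \<longlonglongrightarrow> 0"
    and lim: "(\<lambda>n. \<integral>a. \<bar>partial_mean (Q n) (L n) a - mean \<phi>\<bar> \<partial>P n) \<longlonglongrightarrow> 0"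
  shows "conditionally_convergent \<phi>"
proof -
  note pm = sandwiched_partial_mean[OF LU]
  let ?l = "\<lambda>n. partial_mean (Q n) (L n)" and ?u = "\<lambda>n. partial_mean (Q n) (U n)"
  have le: "(\<integral>a. \<bar>?u n a - mean \<phi>\<bar> \<partial>P n) \<le>
      (\<integral>a. \<bar>?l n a - mean \<phi>\<bar> \<partial>P n) + (integral\<^sup>L (P n \<Otimes>\<^sub>M Q n) (U n) - integral\<^sup>L (P n \<Otimes>\<^sub>M Q n) (L n))" for n
  proof -
    interpret prob_space "P n" by (rule P)
    have "(\<integral>a. \<bar>?u n a - mean \<phi>\<bar> \<partial>P n) \<le> (\<integral>a. \<bar>?l n a - mean \<phi>\<bar> + (?u n a - ?l n a) \<partial>P n)"
    proof (rule integral_mono)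
      fix a assume "a \<in> space (P n)"
      from pm(9)[OF this] show "\<bar>?u n a - mean \<phi>\<bar> \<le> \<bar>?l n a - mean \<phi>\<bar> + (?u n a - ?l n a)" by linarith
    qed (use pm(3,4)[of n] in auto)
    also have "\<dots> = (\<integral>a. \<bar>?l n a - mean \<phi>\<bar> \<partial>P n) + (integral\<^sup>L (P n) (?u n) - integral\<^sup>L (P n) (?l n))"
      using pm(3,4)[of n] by simp
    finally show ?thesis by (simp only: pm(5,6))
  qed
  have "(\<lambda>n. \<integral>a. \<bar>?u n a - mean \<phi>\<bar> \<partial>P n) \<longlonglongrightarrow> 0"
  proof (rule Lim_null_comparison[OF always_eventually])
    show "\<forall>n. norm (\<integral>a. \<bar>?u n a - mean \<phi>\<bar> \<partial>P n) \<le> (\<integral>a. \<bar>?l n a - mean \<phi>\<bar> \<partial>P n) +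
        (integral\<^sup>L (P n \<Otimes>\<^sub>M Q n) (U n) - integral\<^sup>L (P n \<Otimes>\<^sub>M Q n) (L n))"
      using le by simp
    show "(\<lambda>n. (\<integral>a. \<bar>?l n a - mean \<phi>\<bar> \<partial>P n) +
        (integral\<^sup>L (P n \<Otimes>\<^sub>M Q n) (U n) - integral\<^sup>L (P n \<Otimes>\<^sub>M Q n) (L n))) \<longlonglongrightarrow> 0"
      using tendsto_add[OF lim gap] by simp
  qed
  with LU lim show ?thesis unfolding conditionally_convergent_def by blast
qed

section \<open>From the conditional statement to conditional means\<close>

abbreviation "BL_distance n a \<equiv>
  SUP h\<in>BL1. \<bar>outer_expectation (Q n) (\<lambda>b. h (\<beta> n a b)) - outer_expectation (\<Omega> n) (\<lambda>\<omega>. h (G n \<omega>))\<bar>"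

lemma le_BL_distance:
  assumes "h \<in> BL1"
  shows "\<bar>outer_expectation (Q n) (\<lambda>b. h (\<beta> n a b)) - outer_expectation (\<Omega> n) (\<lambda>\<omega>. h (G n \<omega>))\<bar> \<le> BL_distance n a"
\<comment> \<open>A real supremum is controlled only for bounded families: two expectations of
  absolute value at most \<open>1\<close> differ by at most \<open>2\<close>.\<close>
proof (rule cSUP_upper[OF assms bdd_aboveI2])
  fix h :: "'d \<Rightarrow> real" assume "h \<in> BL1"
  then have "\<bar>outer_expectation (Q n) (\<lambda>b. h (\<beta> n a b))\<bar> \<le> 1"
    "\<bar>outer_expectation (\<Omega> n) (\<lambda>\<omega>. h (G n \<omega>))\<bar> \<le> 1"
    by (auto intro!: outer_expectation_bound Q \<Omega> simp: BL1_def)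
  then show "\<bar>outer_expectation (Q n) (\<lambda>b. h (\<beta> n a b)) - outer_expectation (\<Omega> n) (\<lambda>\<omega>. h (G n \<omega>))\<bar> \<le> 2"
    by linarith
qed

lemma BL_distance_nonneg: "0 \<le> BL_distance n a"
proof -
  have "(\<lambda>_. 0) \<in> BL1" using nonneg_BL1_const[of 0] by simp
  from le_BL_distance[OF this, of n a] show ?thesis by (rule order_trans[OF abs_ge_zero])
qed

lemma integral_data:
  fixes f :: "'a \<Rightarrow> real"
  assumes "f \<in> borel_measurable (P n)" "\<And>a. a \<in> space (P n) \<Longrightarrow> lo \<le> f a" "\<And>a. a \<in> space (P n) \<Longrightarrow> f a \<le> hi"
  shows "integrable (\<Omega> n) (\<lambda>\<omega>. f (fst \<omega>))" "(\<integral>\<omega>. f (fst \<omega>) \<partial>\<Omega> n) = integral\<^sup>L (P n) f"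
proof -
  have [measurable]: "f \<in> borel_measurable (P n)" by fact
  have QQ: "prob_space (Q n \<Otimes>\<^sub>M Q n)" by (intro prob_space_pair Q)
  interpret QQ: prob_space "Q n \<Otimes>\<^sub>M Q n" by fact
  have m: "(\<lambda>\<omega>. f (fst \<omega>)) \<in> borel_measurable (P n \<Otimes>\<^sub>M Q n \<Otimes>\<^sub>M Q n)" by measurable
  show "integrable (\<Omega> n) (\<lambda>\<omega>. f (fst \<omega>))"
    unfolding bootstrap_space_def using assms(2,3) by (intro integrable_pair[OF P QQ m, of lo hi]) auto
  have "(\<integral>\<omega>. f (fst \<omega>) \<partial>\<Omega> n) = (\<integral>a. partial_mean (Q n \<Otimes>\<^sub>M Q n) (\<lambda>\<omega>. f (fst \<omega>)) a \<partial>P n)"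
    unfolding bootstrap_space_def
    using assms(2,3) by (intro integral_partial_mean[symmetric, OF P QQ m, of lo hi]) auto
  then show "(\<integral>\<omega>. f (fst \<omega>) \<partial>\<Omega> n) = integral\<^sup>L (P n) f"
    by (simp add: partial_mean_def QQ.prob_space)
qed

text \<open>Off an exceptional set the conditional outer expectation of \<open>\<phi>\<close> is
  close to \<open>mean \<phi>\<close>, and it lies between the conditional means of \<open>L\<close>
  and \<open>U\<close>. Asymptotic measurability, applied to \<open>\<phi>\<close>, says that these
  two differ little in mean; on the exceptional set the deviation is at most
  \<open>1\<close>.\<close>

lemma conditional_imp_conditionally_convergent:
  assumes Z: "tendsto_zero_outer_prob \<Omega> (\<lambda>n (a, b, c). BL_distance n a)"
    and am: "asymptotically_measurable \<Omega> G1" and \<phi>: "\<phi> \<in> nonneg_BL1"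
  shows "conditionally_convergent \<phi>"
proof -
  obtain L U where LU: "sandwiched L U \<phi>"
    "\<And>n. integral\<^sup>L (P n \<Otimes>\<^sub>M Q n) (L n) = inner_expectation (\<Omega> n) (\<lambda>\<omega>. \<phi> (G1 n \<omega>))"
    "\<And>n. integral\<^sup>L (P n \<Otimes>\<^sub>M Q n) (U n) = outer_expectation (\<Omega> n) (\<lambda>\<omega>. \<phi> (G1 n \<omega>))"
    by (rule weights_sandwich[OF \<phi>]) (rule that)
  note D = sandwichedD[OF LU(1)] and pm = sandwiched_partial_mean[OF LU(1)]
  let ?gap = "\<lambda>n. integral\<^sup>L (P n \<Otimes>\<^sub>M Q n) (U n) - integral\<^sup>L (P n \<Otimes>\<^sub>M Q n) (L n)"
  have gap: "?gap \<longlonglongrightarrow> 0"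
    using am nonneg_BL1D(4)[OF \<phi>] unfolding LU(2,3) asymptotically_measurable_def by blast
  let ?l = "\<lambda>n. partial_mean (Q n) (L n)" and ?u = "\<lambda>n. partial_mean (Q n) (U n)"
  let ?c = "mean \<phi>" and ?cn = "\<lambda>n. outer_expectation (\<Omega> n) (\<lambda>\<omega>. \<phi> (G n \<omega>))"
  \<comment> \<open>\<open>B\<close> is a measurable set covering the event that the distance
    exceeds \<open>e\<close>. It may depend on the weights, which is why functions of the data are
    integrated over the whole product space here.\<close>
  have bound: "(\<integral>a. \<bar>?l n a - ?c\<bar> \<partial>P n) \<le> ?gap n + e + \<bar>?cn n - ?c\<bar> + measure (\<Omega> n) B"
    if B: "B \<in> sets (\<Omega> n)" "{\<omega> \<in> space (\<Omega> n). \<bar>case \<omega> of (a, b, c) \<Rightarrow> BL_distance n a\<bar> > e} \<subseteq> B" and e: "0 < e" for n e B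
  proof -
    interpret \<Omega>: prob_space "\<Omega> n" by (rule \<Omega>)
    note [measurable] = pm(1,2)[of n]
    let ?f = "\<lambda>a. \<bar>?l n a - ?c\<bar>" and ?g = "\<lambda>a. ?u n a - ?l n a"
    have f: "integrable (\<Omega> n) (\<lambda>\<omega>. ?f (fst \<omega>))" "(\<integral>\<omega>. ?f (fst \<omega>) \<partial>\<Omega> n) = integral\<^sup>L (P n) ?f"
      by (rule integral_data[of ?f n 0 1]; use pm(7) mean_unit[OF \<phi>] in force)+
    have g: "integrable (\<Omega> n) (\<lambda>\<omega>. ?g (fst \<omega>))" "(\<integral>\<omega>. ?g (fst \<omega>) \<partial>\<Omega> n) = integral\<^sup>L (P n) ?g"
      by (rule integral_data[of ?g n "-1" 1]; use pm(7,8) in force)+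
    have "(\<integral>\<omega>. ?f (fst \<omega>) \<partial>\<Omega> n) \<le> (\<integral>\<omega>. ?g (fst \<omega>) + (e + \<bar>?cn n - ?c\<bar>) + indicator B \<omega> \<partial>\<Omega> n)"
    proof (rule integral_mono)
      show "integrable (\<Omega> n) (\<lambda>\<omega>. ?g (fst \<omega>) + (e + \<bar>?cn n - ?c\<bar>) + indicator B \<omega>)"
        using g(1) B(1) by (intro Bochner_Integration.integrable_add integrable_real_indicator) (auto simp: \<Omega>.emeasure_finite less_top[symmetric])
      fix \<omega> assume \<omega>: "\<omega> \<in> space (\<Omega> n)"
      then obtain a b c where abc: "\<omega> = (a, b, c)" "a \<in> space (P n)"
        by (auto simp: bootstrap_space_def space_pair_measure)
      show "?f (fst \<omega>) \<le> ?g (fst \<omega>) + (e + \<bar>?cn n - ?c\<bar>) + indicator B \<omega>"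
      proof (cases "\<omega> \<in> B")
        case True
        then show ?thesis
          using pm(7,8,9)[OF abc(2)] mean_unit[OF \<phi>] e abc(1) by (auto simp: abs_if)
      next
        case False
        then have "BL_distance n a \<le> e" using B(2) \<omega> abc(1) by force
        with le_BL_distance[OF nonneg_BL1D(3)[OF \<phi>], of n a]
        have "\<bar>outer_expectation (Q n) (\<lambda>b. \<phi> (\<beta> n a b)) - ?cn n\<bar> \<le> e" by linarith
        moreover have "?l n a \<le> outer_expectation (Q n) (\<lambda>b. \<phi> (\<beta> n a b))"
          unfolding partial_mean_def using D(5)[OF abc(2)] pm(10,11)[OF abc(2)]
          by (intro le_outer_expectation[where U="\<lambda>b. U n (a, b)"]) auto
        moreover have "outer_expectation (Q n) (\<lambda>b. \<phi> (\<beta> n a b)) \<le> ?u n a"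
          unfolding partial_mean_def using D(5)[OF abc(2)] pm(10,11)[OF abc(2)]
          by (intro outer_expectation_le[where L="\<lambda>b. L n (a, b)"]) auto
        ultimately show ?thesis using False abc(1) by simp
      qed
    qed (rule f)
    also have "\<dots> = (\<integral>\<omega>. ?g (fst \<omega>) \<partial>\<Omega> n) + (e + \<bar>?cn n - ?c\<bar>) + measure (\<Omega> n) B"
    proof -
      have "integrable (\<Omega> n) (indicator B :: _ \<Rightarrow> real)"
        using B(1) by (intro integrable_real_indicator) (auto simp: \<Omega>.emeasure_finite less_top[symmetric])
      with g(1) B(1) show ?thesis
        by (subst Bochner_Integration.integral_add; simp add: \<Omega>.prob_space)
    qed
    also have "(\<integral>\<omega>. ?g (fst \<omega>) \<partial>\<Omega> n) = ?gap n"
      unfolding g(2) using pm(3,4,5,6)[of n] by simp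
    finally show ?thesis unfolding f(2) by linarith
  qed
  have "(\<lambda>n. \<integral>a. \<bar>?l n a - ?c\<bar> \<partial>P n) \<longlonglongrightarrow> 0"
  proof (rule tendstoI)
    fix e :: real assume e: "0 < e"
    \<comment> \<open>A quarter for each term of \<open>bound\<close>: the gap, the threshold, the
      error of the unconditional mean and the measure of \<open>B\<close>.\<close>
    then have e4: "0 < e/4" by simp
    let ?A = "\<lambda>n. {\<omega> \<in> space (\<Omega> n). \<bar>case \<omega> of (a, b, c) \<Rightarrow> BL_distance n a\<bar> > e/4}"
    have "(\<lambda>n. outer_measure_of (\<Omega> n) (?A n)) \<longlonglongrightarrow> 0"
      using Z e4 unfolding tendsto_zero_outer_prob_def by blast
    then have "\<forall>\<^sub>F n in sequentially. outer_measure_of (\<Omega> n) (?A n) < ennreal (e/4)"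
      by (rule order_tendstoD) (use e4 in simp)
    moreover have "\<forall>\<^sub>F n in sequentially. ?gap n < e/4" using gap e4 by (rule order_tendstoD)
    moreover have "\<forall>\<^sub>F n in sequentially. dist (?cn n) ?c < e/4"
      using tendstoD[OF outer_G[OF nonneg_BL1D(4)[OF \<phi>]] e4] .
    ultimately show "\<forall>\<^sub>F n in sequentially. dist (\<integral>a. \<bar>?l n a - ?c\<bar> \<partial>P n) 0 < e"
    proof eventually_elim
      case (elim n)
      interpret \<Omega>: prob_space "\<Omega> n" by (rule \<Omega>)
      obtain B where B: "B \<in> sets (\<Omega> n)" "?A n \<subseteq> B" "outer_measure_of (\<Omega> n) (?A n) = emeasure (\<Omega> n) B"
        using outer_measure_of_attain[of "?A n" "\<Omega> n"] by auto
      then have "measure (\<Omega> n) B < e/4"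
        using elim(1) e4 by (simp add: \<Omega>.emeasure_eq_measure ennreal_less_iff)
      then show ?case using bound[OF B(1,2) e4] elim(2,3) by (simp add: dist_real_def)
    qed
  qed
  with LU(1) gap show ?thesis by (rule conditionally_convergentI)
qed

section \<open>The joint statement\<close>

lemma products_G: "\<phi> \<in> nonneg_BL1 \<Longrightarrow> \<psi> \<in> nonneg_BL1 \<Longrightarrow> \<xi> \<in> nonneg_BL1 \<Longrightarrow>
    asymp_mean (\<lambda>n. three_space (\<Omega> n))
      (\<lambda>n \<omega>. case three_copies (G n) \<omega> of (x, y, z) \<Rightarrow> \<phi> x * \<psi> y * \<xi> z) (mean \<phi> * mean \<psi> * mean \<xi>)"
  by (intro three_copies_products \<Omega> conjI outer_G inner_G nonneg_BL1D(4))

abbreviation "triple n \<equiv> \<lambda>(a, b, c). (\<gamma> n a, \<beta> n a b, \<beta> n a c)"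

text \<open>Given the data, the two copies are independent; as their conditional means tend to
  constants, they also decouple from the data. Products over the triple therefore have the same
  limits as products over three independent copies.\<close>

lemma conditionally_convergent_imp_joint:
  assumes cc: "\<And>\<phi>. \<phi> \<in> nonneg_BL1 \<Longrightarrow> conditionally_convergent \<phi>"
  shows "weakly_equivalent \<Omega> triple (\<lambda>n. three_space (\<Omega> n)) (\<lambda>n. three_copies (G n))"
proof (rule weak_equivalence_by_products[OF law tight _ products_G])
  fix \<phi> \<psi> \<xi> :: "'d \<Rightarrow> real" assume F: "\<phi> \<in> nonneg_BL1" "\<psi> \<in> nonneg_BL1" "\<xi> \<in> nonneg_BL1"
  obtain L0 U0 where 0: "\<And>n. L0 n \<in> borel_measurable (P n)" "\<And>n. U0 n \<in> borel_measurable (P n)"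
    "\<And>n a. a \<in> space (P n) \<Longrightarrow> 0 \<le> L0 n a \<and> L0 n a \<le> \<phi> (\<gamma> n a) \<and> \<phi> (\<gamma> n a) \<le> U0 n a \<and> U0 n a \<le> 1"
    "(\<lambda>n. integral\<^sup>L (P n) (L0 n)) \<longlonglongrightarrow> mean \<phi>" "(\<lambda>n. integral\<^sup>L (P n) (U0 n)) \<longlonglongrightarrow> mean \<phi>"
    using data_sandwich[OF F(1)] by blast
  obtain L1 U1 where 1: "sandwiched L1 U1 \<psi>"
    "(\<lambda>n. \<integral>a. \<bar>partial_mean (Q n) (L1 n) a - mean \<psi>\<bar> \<partial>P n) \<longlonglongrightarrow> 0"
    "(\<lambda>n. \<integral>a. \<bar>partial_mean (Q n) (U1 n) a - mean \<psi>\<bar> \<partial>P n) \<longlonglongrightarrow> 0"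
    using cc[OF F(2)] unfolding conditionally_convergent_def by blast
  obtain L2 U2 where 2: "sandwiched L2 U2 \<xi>"
    "(\<lambda>n. \<integral>a. \<bar>partial_mean (Q n) (L2 n) a - mean \<xi>\<bar> \<partial>P n) \<longlonglongrightarrow> 0"
    "(\<lambda>n. \<integral>a. \<bar>partial_mean (Q n) (U2 n) a - mean \<xi>\<bar> \<partial>P n) \<longlonglongrightarrow> 0"
    using cc[OF F(3)] unfolding conditionally_convergent_def by blast
  note D1 = sandwichedD[OF 1(1)] and D2 = sandwichedD[OF 2(1)]
  note pm1 = sandwiched_partial_mean[OF 1(1)] and pm2 = sandwiched_partial_mean[OF 2(1)]
  have L0: "0 \<le> L0 n a \<and> L0 n a \<le> 1" and U0: "0 \<le> U0 n a \<and> U0 n a \<le> 1" if "a \<in> space (P n)" for n a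
    using 0(3)[OF that] by linarith+
  let ?p = "\<lambda>(u :: 'a \<Rightarrow> real) (v :: 'a \<times> 'b \<Rightarrow> real) (w :: 'a \<times> 'b \<Rightarrow> real) (a, b, c). u a * v (a, b) * w (a, c)"
  note iL = bootstrap_integral_product[OF P Q 0(1) L0 D1(1) D1(3) D2(1) D2(3)]
  note iU = bootstrap_integral_product[OF P Q 0(2) U0 D1(2) D1(4) D2(2) D2(4)]
  show "asymp_mean \<Omega> (\<lambda>n \<omega>. case triple n \<omega> of (x, y, z) \<Rightarrow> \<phi> x * \<psi> y * \<xi> z) (mean \<phi> * mean \<psi> * mean \<xi>)"
  proof (rule asymp_meanI)
    show "integrable (\<Omega> n) (?p (L0 n) (L1 n) (L2 n))" for n by (rule iL(1))
    show "integrable (\<Omega> n) (?p (U0 n) (U1 n) (U2 n))" for n by (rule iU(1))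
    have "integral\<^sup>L (\<Omega> n) (?p (L0 n) (L1 n) (L2 n)) =
        (\<integral>a. L0 n a * partial_mean (Q n) (L1 n) a * partial_mean (Q n) (L2 n) a \<partial>P n)" for n by (rule iL(2))
    moreover have "(\<lambda>n. \<integral>a. L0 n a * partial_mean (Q n) (L1 n) a * partial_mean (Q n) (L2 n) a \<partial>P n)
        \<longlonglongrightarrow> mean \<phi> * mean \<psi> * mean \<xi>"
      by (rule tendsto_integral_product[OF P 0(1) L0 pm1(1,7) pm2(1,7) 0(4) 1(2) 2(2) mean_unit[OF F(2)]])
    ultimately show "(\<lambda>n. integral\<^sup>L (\<Omega> n) (?p (L0 n) (L1 n) (L2 n))) \<longlonglongrightarrow> mean \<phi> * mean \<psi> * mean \<xi>"
      by (simp only:)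
    have "integral\<^sup>L (\<Omega> n) (?p (U0 n) (U1 n) (U2 n)) =
        (\<integral>a. U0 n a * partial_mean (Q n) (U1 n) a * partial_mean (Q n) (U2 n) a \<partial>P n)" for n by (rule iU(2))
    moreover have "(\<lambda>n. \<integral>a. U0 n a * partial_mean (Q n) (U1 n) a * partial_mean (Q n) (U2 n) a \<partial>P n)
        \<longlonglongrightarrow> mean \<phi> * mean \<psi> * mean \<xi>"
      by (rule tendsto_integral_product[OF P 0(2) U0 pm1(2,8) pm2(2,8) 0(5) 1(3) 2(3) mean_unit[OF F(2)]])
    ultimately show "(\<lambda>n. integral\<^sup>L (\<Omega> n) (?p (U0 n) (U1 n) (U2 n))) \<longlonglongrightarrow> mean \<phi> * mean \<psi> * mean \<xi>"
      by (simp only:)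
    fix n \<omega> assume "\<omega> \<in> space (\<Omega> n)"
    then obtain a b c where \<omega>: "\<omega> = (a, b, c)" and a: "a \<in> space (P n)" and b: "b \<in> space (Q n)" and c: "c \<in> space (Q n)"
      by (auto simp: bootstrap_space_def space_pair_measure)
    note f = nonneg_BL1D(1)[OF F(1), of "\<gamma> n a"] nonneg_BL1D(1)[OF F(2), of "\<beta> n a b"] nonneg_BL1D(1)[OF F(3), of "\<beta> n a c"]
    have "L0 n a * L1 n (a, b) * L2 n (a, c) \<le> \<phi> (\<gamma> n a) * \<psi> (\<beta> n a b) * \<xi> (\<beta> n a c)"
      using 0(3)[OF a] D1(3,5)[OF a b] D2(3,5)[OF a c] f by (intro mult_mono mult_nonneg_nonneg) auto
    then show "?p (L0 n) (L1 n) (L2 n) \<omega> \<le> (case triple n \<omega> of (x, y, z) \<Rightarrow> \<phi> x * \<psi> y * \<xi> z)"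
      by (simp add: \<omega>)
    have "\<phi> (\<gamma> n a) * \<psi> (\<beta> n a b) * \<xi> (\<beta> n a c) \<le> U0 n a * U1 n (a, b) * U2 n (a, c)"
      using 0(3)[OF a] U0[OF a] D1(4,5)[OF a b] D2(4,5)[OF a c] f by (intro mult_mono mult_nonneg_nonneg) auto
    then show "(case triple n \<omega> of (x, y, z) \<Rightarrow> \<phi> x * \<psi> y * \<xi> z) \<le> ?p (U0 n) (U1 n) (U2 n) \<omega>"
      by (simp add: \<omega>)
  qed
qed

text \<open>Test functions of the middle coordinate extract the marginal statement. All bounded
  continuous \<open>f\<close> are treated, as asymptotic measurability asks for them.\<close>

lemma joint_imp_outer_G1:
  assumes j: "weakly_equivalent \<Omega> triple (\<lambda>n. three_space (\<Omega> n)) (\<lambda>n. three_copies (G n))"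
    and f: "f \<in> bounded_continuous"
  shows "(\<lambda>n. outer_expectation (\<Omega> n) (\<lambda>\<omega>. f (G1 n \<omega>))) \<longlonglongrightarrow> mean f"
proof -
  have "(\<lambda>p. f (fst (snd p))) \<in> (bounded_continuous :: ('d \<times> 'd \<times> 'd \<Rightarrow> real) set)"
  proof -
    have "continuous_on UNIV (\<lambda>p :: 'd \<times> 'd \<times> 'd. f (fst (snd p)))"
      by (rule continuous_on_compose2[of UNIV f])
        (use f in \<open>auto simp: bounded_continuous_def intro!: continuous_on_fst continuous_on_snd continuous_on_id\<close>)
    moreover have "bounded (range (\<lambda>p :: 'd \<times> 'd \<times> 'd. f (fst (snd p))))"
      by (rule bounded_subset[of "range f"]) (use f in \<open>auto simp: bounded_continuous_def\<close>)
    ultimately show ?thesis by (simp add: bounded_continuous_def)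
  qed
  from bspec[OF j[unfolded weakly_equivalent_def] this] have "(\<lambda>n. \<bar>outer_expectation (\<Omega> n) (\<lambda>\<omega>. f (fst (snd (triple n \<omega>)))) -
      outer_expectation (three_space (\<Omega> n)) (\<lambda>\<omega>. f (fst (snd (three_copies (G n) \<omega>))))\<bar>) \<longlonglongrightarrow> 0" .
  then have "(\<lambda>n. outer_expectation (\<Omega> n) (\<lambda>\<omega>. f (fst (snd (triple n \<omega>)))) -
      outer_expectation (three_space (\<Omega> n)) (\<lambda>\<omega>. f (fst (snd (three_copies (G n) \<omega>))))) \<longlonglongrightarrow> 0"
    by (simp only: tendsto_rabs_zero_iff)
  from tendsto_add[OF this asymp_mean_outer[OF three_copies_asymp_mean[OF \<Omega> f outer_G[OF f] inner_G[OF f]]]]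
  show ?thesis by (simp add: case_prod_unfold)
qed

lemma joint_imp_inner_G1:
  assumes "weakly_equivalent \<Omega> triple (\<lambda>n. three_space (\<Omega> n)) (\<lambda>n. three_copies (G n))"
    and "f \<in> bounded_continuous"
  shows "(\<lambda>n. inner_expectation (\<Omega> n) (\<lambda>\<omega>. f (G1 n \<omega>))) \<longlonglongrightarrow> mean f"
  using tendsto_minus[OF joint_imp_outer_G1[OF assms(1) bounded_continuous_minus[OF assms(2)]]]
  by (simp add: inner_expectation_eq)

text \<open>The linear term of the expanded square involves the mean of the conditional mean, which
  is the inner expectation of \<open>\<phi> (G1 n \<omega>)\<close>; its limit comes from the
  marginal of the joint statement. With \<open>c = mean \<phi>\<close>, the bound on the mean square
  deviation tends to \<open>c^2 - 2 * c * c + c^2 = 0\<close>.\<close>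

lemma joint_imp_conditionally_convergent:
  assumes j: "weakly_equivalent \<Omega> triple (\<lambda>n. three_space (\<Omega> n)) (\<lambda>n. three_copies (G n))"
    and \<phi>: "\<phi> \<in> nonneg_BL1"
  shows "conditionally_convergent \<phi>"
proof -
  obtain L U where LU: "sandwiched L U \<phi>"
    "\<And>n. integral\<^sup>L (P n \<Otimes>\<^sub>M Q n) (L n) = inner_expectation (\<Omega> n) (\<lambda>\<omega>. \<phi> (G1 n \<omega>))"
    "\<And>n. integral\<^sup>L (P n \<Otimes>\<^sub>M Q n) (U n) = outer_expectation (\<Omega> n) (\<lambda>\<omega>. \<phi> (G1 n \<omega>))"
    by (rule weights_sandwich[OF \<phi>]) (rule that)
  note D = sandwichedD[OF LU(1)] and pm = sandwiched_partial_mean[OF LU(1)]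
  let ?c = "mean \<phi>" and ?l = "\<lambda>n. partial_mean (Q n) (L n)"
  have bc: "\<phi> \<in> bounded_continuous" by (rule nonneg_BL1D(4)[OF \<phi>])
  have limL: "(\<lambda>n. integral\<^sup>L (P n \<Otimes>\<^sub>M Q n) (L n)) \<longlonglongrightarrow> ?c"
    unfolding LU(2) by (rule joint_imp_inner_G1[OF j bc])
  have limU: "(\<lambda>n. integral\<^sup>L (P n \<Otimes>\<^sub>M Q n) (U n)) \<longlonglongrightarrow> ?c"
    unfolding LU(3) by (rule joint_imp_outer_G1[OF j bc])
  \<comment> \<open>The factor \<open>1\<close> ignores the data and gives the test function the
    three-factor shape of \<open>products_G\<close>.\<close>
  let ?F = "\<lambda>p :: 'd \<times> 'd \<times> 'd. case p of (x, y, z) \<Rightarrow> 1 * \<phi> y * \<phi> z"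
  have one: "(\<lambda>_. 1) \<in> nonneg_BL1" by (rule nonneg_BL1_const) auto
  let ?e = "\<lambda>n. outer_expectation (\<Omega> n) (\<lambda>\<omega>. ?F (triple n \<omega>))"
  have lim2: "?e \<longlonglongrightarrow> ?c\<^sup>2"
  proof -
    have "?F \<in> bounded_continuous"
    proof -
      have "continuous_on UNIV \<phi>" using bc by (simp add: bounded_continuous_def)
      then have "continuous_on UNIV (\<lambda>p :: 'd \<times> 'd \<times> 'd. \<phi> (fst (snd p)))"
        "continuous_on UNIV (\<lambda>p :: 'd \<times> 'd \<times> 'd. \<phi> (snd (snd p)))"
        by (auto intro!: continuous_on_compose2[of UNIV \<phi>] continuous_on_fst continuous_on_snd continuous_on_id)
      from continuous_on_mult[OF this] have "continuous_on UNIV ?F" by (simp add: case_prod_unfold)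
      moreover have "\<bar>?F p\<bar> \<le> 1" for p
        using nonneg_BL1D(1,2)[OF \<phi>] by (auto split: prod.splits simp: abs_mult intro!: mult_le_one)
      then have "bounded (range ?F)" by (auto simp: bounded_iff)
      ultimately show ?thesis by (simp add: bounded_continuous_def)
    qed
    from bspec[OF j[unfolded weakly_equivalent_def] this]
    have "(\<lambda>n. ?e n - outer_expectation (three_space (\<Omega> n)) (\<lambda>\<omega>. ?F (three_copies (G n) \<omega>))) \<longlonglongrightarrow> 0"
      by (simp only: tendsto_rabs_zero_iff)
    from tendsto_add[OF this asymp_mean_outer[OF products_G[OF one \<phi> \<phi>]]]
    show ?thesis using prob_space.prob_space[OF law_prob] by (simp add: power2_eq_square)
  qed
  have sq_le: "(\<integral>a. \<bar>?l n a - ?c\<bar> \<partial>P n)\<^sup>2 \<le> ?e n - 2 * ?c * integral\<^sup>L (P n \<Otimes>\<^sub>M Q n) (L n) + ?c\<^sup>2" for n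
  proof -
    interpret prob_space "P n" by (rule P)
    have u: "(\<lambda>_. 1) \<in> borel_measurable (P n)" "\<And>a. a \<in> space (P n) \<Longrightarrow> 0 \<le> (1 :: real) \<and> (1 :: real) \<le> 1" by auto
    note [measurable] = pm(1)[of n]
    have i2: "integrable (P n) (\<lambda>a. (?l n a)\<^sup>2)"
      using pm(7) by (intro bounded_integrable[where lo=0 and hi=1]) (auto simp: power_le_one)
    have eq: "(?l n a - ?c)\<^sup>2 = (?l n a)\<^sup>2 - 2 * ?c * ?l n a + ?c\<^sup>2" for a
      by (simp add: power2_diff)
    \<comment> \<open>Nonnegativity of the variance lets the second moment control the mean
      deviation.\<close>
    have "(\<integral>a. \<bar>?l n a - ?c\<bar> \<partial>P n)\<^sup>2 \<le> (\<integral>a. \<bar>?l n a - ?c\<bar>\<^sup>2 \<partial>P n)"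
    proof -
      have "integrable (P n) (\<lambda>a. \<bar>?l n a - ?c\<bar>\<^sup>2)"
        unfolding power2_abs eq using i2 pm(3)[of n] by simp
      then have "variance (\<lambda>a. \<bar>?l n a - ?c\<bar>) = (\<integral>a. \<bar>?l n a - ?c\<bar>\<^sup>2 \<partial>P n) - (\<integral>a. \<bar>?l n a - ?c\<bar> \<partial>P n)\<^sup>2"
        using pm(3)[of n] by (intro variance_eq) auto
      then show ?thesis using variance_positive[of "\<lambda>a. \<bar>?l n a - ?c\<bar>"] by linarith
    qed
    also have "\<dots> = (\<integral>a. (?l n a)\<^sup>2 \<partial>P n) - 2 * ?c * integral\<^sup>L (P n) (?l n) + ?c\<^sup>2"
      unfolding power2_abs eq using i2 pm(3)[of n] by (simp add: prob_space)
    also have "(\<integral>a. (?l n a)\<^sup>2 \<partial>P n) = integral\<^sup>L (\<Omega> n) (\<lambda>(a, b, c). 1 * L n (a, b) * L n (a, c))"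
      using bootstrap_integral_product(2)[OF P Q u D(1) D(3) D(1) D(3)] by (simp add: power2_eq_square)
    also have "integral\<^sup>L (\<Omega> n) (\<lambda>(a, b, c). 1 * L n (a, b) * L n (a, c)) \<le> ?e n"
    proof (rule le_outer_expectation[where U="\<lambda>_. 1"])
      show "integrable (\<Omega> n) (\<lambda>(a, b, c). 1 * L n (a, b) * L n (a, c))"
        by (rule bootstrap_integral_product(1)[OF P Q u D(1) D(3) D(1) D(3)])
      show "integrable (\<Omega> n) (\<lambda>_. 1 :: real)" using \<Omega>[of n] by (simp add: prob_space.finite_measure finite_measure.integrable_const)
      fix \<omega> assume "\<omega> \<in> space (\<Omega> n)"
      then obtain a b c where \<omega>: "\<omega> = (a, b, c)" and a: "a \<in> space (P n)" and b: "b \<in> space (Q n)" and c: "c \<in> space (Q n)"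
        by (auto simp: bootstrap_space_def space_pair_measure)
      show "?F (triple n \<omega>) \<le> 1"
        using nonneg_BL1D(1,2)[OF \<phi>] by (simp add: \<omega> mult_le_one)
      show "(case \<omega> of (a, b, c) \<Rightarrow> 1 * L n (a, b) * L n (a, c)) \<le> ?F (triple n \<omega>)"
        using D(3,5)[OF a b] D(3,5)[OF a c] nonneg_BL1D(1)[OF \<phi>] by (simp add: \<omega> mult_mono)
    qed
    finally show ?thesis by (simp only: pm(5))
  qed
  have "(\<lambda>n. (\<integral>a. \<bar>?l n a - ?c\<bar> \<partial>P n)\<^sup>2) \<longlonglongrightarrow> 0"
  proof (rule Lim_null_comparison[OF always_eventually])
    show "\<forall>n. norm ((\<integral>a. \<bar>?l n a - ?c\<bar> \<partial>P n)\<^sup>2) \<le> ?e n - 2 * ?c * integral\<^sup>L (P n \<Otimes>\<^sub>M Q n) (L n) + ?c\<^sup>2"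
      using sq_le by simp
    have "(\<lambda>n. ?e n - 2 * ?c * integral\<^sup>L (P n \<Otimes>\<^sub>M Q n) (L n) + ?c\<^sup>2) \<longlonglongrightarrow> ?c\<^sup>2 - 2 * ?c * ?c + ?c\<^sup>2"
      by (intro tendsto_intros lim2 limL)
    then show "(\<lambda>n. ?e n - 2 * ?c * integral\<^sup>L (P n \<Otimes>\<^sub>M Q n) (L n) + ?c\<^sup>2) \<longlonglongrightarrow> 0"
      by (simp add: power2_eq_square)
  qed
  then have "(\<lambda>n. \<integral>a. \<bar>?l n a - ?c\<bar> \<partial>P n) \<longlonglongrightarrow> 0" by simp
  moreover have "(\<lambda>n. integral\<^sup>L (P n \<Otimes>\<^sub>M Q n) (U n) - integral\<^sup>L (P n \<Otimes>\<^sub>M Q n) (L n)) \<longlonglongrightarrow> 0"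
    using tendsto_diff[OF limU limL] by simp
  ultimately show ?thesis using conditionally_convergentI[OF LU(1)] by blast
qed

section \<open>Back to the conditional statement\<close>

text \<open>Turns the bound of \<open>BL1_outer_expectation_error\<close> into deviations from the
  limits \<open>c i\<close>. The second \<open>\<delta>\<close> bounds the missing mass of the means
  \<open>c i\<close>; the remaining terms are \<open>(u i - c i) + 2 * (c i - l i)\<close>.\<close>

lemma sum_le_of_pointwise_close:
  fixes c l u :: "'i \<Rightarrow> real"
  assumes I: "finite I" and \<kappa>: "0 < \<kappa>" and c: "1 - \<delta> \<le> (\<Sum>i\<in>I. \<kappa> * c i)"
  shows "\<delta> + (1 - (\<Sum>i\<in>I. \<kappa> * l i)) + (\<Sum>i\<in>I. \<kappa> * (u i - l i)) \<le>
    2 * \<delta> + (\<Sum>i\<in>I. \<kappa> * (2 * \<bar>l i - c i\<bar> + \<bar>u i - c i\<bar>))"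
proof -
  have "(\<Sum>i\<in>I. \<kappa> * (u i - l i)) + (\<Sum>i\<in>I. \<kappa> * c i) - (\<Sum>i\<in>I. \<kappa> * l i) = (\<Sum>i\<in>I. \<kappa> * (u i - l i + c i - l i))"
    unfolding sum.distrib[symmetric] sum_subtractf[symmetric]
    by (intro sum.cong refl) (simp add: algebra_simps)
  also have "\<dots> \<le> (\<Sum>i\<in>I. \<kappa> * (2 * \<bar>l i - c i\<bar> + \<bar>u i - c i\<bar>))"
  proof (intro sum_mono mult_left_mono)
    fix i show "u i - l i + c i - l i \<le> 2 * \<bar>l i - c i\<bar> + \<bar>u i - c i\<bar>"
      using abs_ge_self[of "u i - c i"] abs_ge_minus_self[of "l i - c i"] by simp
  qed (use \<kappa> in simp)
  finally show ?thesis using c by linarith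
qed

text \<open>The distance is bounded by a constant, a null sequence \<open>w\<close> and a measurable
  function \<open>W\<close> of the data whose mean vanishes in the limit. Markov's inequality for
  \<open>W\<close> then gives convergence in outer probability.\<close>

lemma conditionally_convergent_imp_conditional:
  assumes cc: "\<And>\<phi>. \<phi> \<in> nonneg_BL1 \<Longrightarrow> conditionally_convergent \<phi>"
  shows "tendsto_zero_outer_prob \<Omega> (\<lambda>n (a, b, c). BL_distance n a)"
  unfolding tendsto_zero_outer_prob_def
proof (intro allI impI)
  fix \<epsilon> :: real assume \<epsilon>: "0 < \<epsilon>"
  \<comment> \<open>\<open>4 * \<delta>\<close> is half of \<open>\<epsilon>\<close>. Once
    \<open>w n < \<epsilon> / 4\<close>, a distance above \<open>\<epsilon>\<close> forces
    \<open>W n\<close> to be at least \<open>\<epsilon> / 4\<close>.\<close>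
  define \<delta> where "\<delta> = \<epsilon> / 8"
  have \<delta>: "0 < \<delta>" using \<epsilon> by (simp add: \<delta>_def)
  obtain K where K: "compact K" "1 - \<delta> \<le> measure \<mu> K" using tight \<delta> by (auto simp: tight_law_def)
  obtain I \<psi> \<kappa> where I: "finite I" "I \<subseteq> K" "0 < \<kappa>" "\<And>i. i \<in> I \<Longrightarrow> \<psi> i \<in> nonneg_BL1"
    "\<And>i y. \<psi> i y \<noteq> 0 \<Longrightarrow> dist i y < \<delta>"
    "\<And>y. (\<Sum>i\<in>I. \<kappa> * \<psi> i y) \<le> 1" "1 - \<delta> \<le> (\<Sum>i\<in>I. \<kappa> * mean (\<psi> i))"
    by (rule tight_partition_of_unity[OF law K \<delta>]) (rule that)
  \<comment> \<open>\<open>S\<close>, like \<open>R\<close> below, bundles the requirements at one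
    index, so that a single choice over \<open>I\<close> produces the families of bounds.\<close>
  define S where "S i L U \<longleftrightarrow> sandwiched L U (\<psi> i) \<and>
    (\<lambda>n. \<integral>a. \<bar>partial_mean (Q n) (L n) a - mean (\<psi> i)\<bar> \<partial>P n) \<longlonglongrightarrow> 0 \<and>
    (\<lambda>n. \<integral>a. \<bar>partial_mean (Q n) (U n) a - mean (\<psi> i)\<bar> \<partial>P n) \<longlonglongrightarrow> 0" for i L U
  have "\<exists>L U. S i L U" if "i \<in> I" for i
    using cc[OF I(4)[OF that]] unfolding conditionally_convergent_def S_def .
  then obtain L U where S: "\<And>i. i \<in> I \<Longrightarrow> S i (L i) (U i)" by metis
  have LU: "sandwiched (L i) (U i) (\<psi> i)"
    "(\<lambda>n. \<integral>a. \<bar>partial_mean (Q n) (L i n) a - mean (\<psi> i)\<bar> \<partial>P n) \<longlonglongrightarrow> 0"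
    "(\<lambda>n. \<integral>a. \<bar>partial_mean (Q n) (U i n) a - mean (\<psi> i)\<bar> \<partial>P n) \<longlonglongrightarrow> 0" if "i \<in> I" for i
    using S[OF that] by (simp_all add: S_def)
  define R where "R i A B \<longleftrightarrow> (\<forall>n. A n \<in> borel_measurable (P n) \<and> B n \<in> borel_measurable (P n) \<and>
    (\<forall>a\<in>space (P n). 0 \<le> A n a \<and> A n a \<le> \<psi> i (\<gamma> n a) \<and> \<psi> i (\<gamma> n a) \<le> B n a \<and> B n a \<le> (1 :: real))) \<and>
    (\<lambda>n. integral\<^sup>L (P n) (A n)) \<longlonglongrightarrow> mean (\<psi> i) \<and> (\<lambda>n. integral\<^sup>L (P n) (B n)) \<longlonglongrightarrow> mean (\<psi> i)"
    for i A B
  have "\<exists>A B. R i A B" if "i \<in> I" for i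
  proof (rule data_sandwich[OF I(4)[OF that]])
    fix A B :: "nat \<Rightarrow> 'a \<Rightarrow> real"
    assume "\<And>n. A n \<in> borel_measurable (P n)" "\<And>n. B n \<in> borel_measurable (P n)"
      "\<And>n a. a \<in> space (P n) \<Longrightarrow> 0 \<le> A n a \<and> A n a \<le> \<psi> i (\<gamma> n a) \<and> \<psi> i (\<gamma> n a) \<le> B n a \<and> B n a \<le> 1"
      "(\<lambda>n. integral\<^sup>L (P n) (A n)) \<longlonglongrightarrow> mean (\<psi> i)" "(\<lambda>n. integral\<^sup>L (P n) (B n)) \<longlonglongrightarrow> mean (\<psi> i)"
    then have "R i A B" by (simp add: R_def)
    then show ?thesis by blast
  qed
  then obtain A B where R: "\<And>i. i \<in> I \<Longrightarrow> R i (A i) (B i)" by metis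
  have AB: "A i n \<in> borel_measurable (P n) \<and> B i n \<in> borel_measurable (P n) \<and>
    (\<forall>a\<in>space (P n). 0 \<le> A i n a \<and> A i n a \<le> \<psi> i (\<gamma> n a) \<and> \<psi> i (\<gamma> n a) \<le> B i n a \<and> B i n a \<le> 1)"
    "(\<lambda>n. integral\<^sup>L (P n) (A i n)) \<longlonglongrightarrow> mean (\<psi> i)"
    "(\<lambda>n. integral\<^sup>L (P n) (B i n)) \<longlonglongrightarrow> mean (\<psi> i)" if "i \<in> I" for i n
    using R[OF that] by (simp_all add: R_def)
  let ?l = "\<lambda>i n. partial_mean (Q n) (L i n)" and ?u = "\<lambda>i n. partial_mean (Q n) (U i n)"
  let ?a = "\<lambda>i n. integral\<^sup>L (P n) (A i n)" and ?b = "\<lambda>i n. integral\<^sup>L (P n) (B i n)"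
  let ?c = "\<lambda>i. mean (\<psi> i)"
  \<comment> \<open>In the coefficient \<open>3\<close>, two parts come from
    \<open>sum_le_of_pointwise_close\<close> and one from comparing the interpolation sums of the
    two expectations.\<close>
  define W where "W n a = (\<Sum>i\<in>I. \<kappa> * (3 * \<bar>?l i n a - ?c i\<bar> + \<bar>?u i n a - ?c i\<bar>))" for n a
  define w where "w n = (\<Sum>i\<in>I. \<kappa> * (3 * \<bar>?a i n - ?c i\<bar> + \<bar>?b i n - ?c i\<bar>))" for n
  \<comment> \<open>The conditional and the unconditional expectation are each replaced by an
    interpolation sum with coefficients \<open>h i\<close>; each replacement costs
    \<open>2 * \<delta>\<close>.\<close>
  have BL: "BL_distance n a \<le> 4 * \<delta> + W n a + w n" if a: "a \<in> space (P n)" for n a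
  proof (rule cSUP_least)
    show "(BL1 :: ('d \<Rightarrow> real) set) \<noteq> {}" using nonneg_BL1_const[of 0] by auto
    fix h :: "'d \<Rightarrow> real" assume h: "h \<in> BL1"
    let ?H = "outer_expectation (Q n) (\<lambda>b. h (\<beta> n a b))" and ?E = "outer_expectation (\<Omega> n) (\<lambda>\<omega>. h (G n \<omega>))"
    have 1: "\<bar>?H - (\<Sum>i\<in>I. h i * (\<kappa> * ?l i n a))\<bar> \<le>
        \<delta> + (1 - (\<Sum>i\<in>I. \<kappa> * ?l i n a)) + (\<Sum>i\<in>I. \<kappa> * (?u i n a - ?l i n a))"
      unfolding partial_mean_def
      by (rule BL1_outer_expectation_error[OF Q h I(1,4,5,6,3)])
         (use \<delta> a sandwiched_partial_mean(10,11)[OF LU(1)] sandwichedD(5)[OF LU(1)] in auto)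
    have AB': "integrable (\<Omega> n) (\<lambda>\<omega>. A i n (fst \<omega>))" "(\<integral>\<omega>. A i n (fst \<omega>) \<partial>\<Omega> n) = ?a i n"
      "integrable (\<Omega> n) (\<lambda>\<omega>. B i n (fst \<omega>))" "(\<integral>\<omega>. B i n (fst \<omega>) \<partial>\<Omega> n) = ?b i n" if "i \<in> I" for i
      using AB(1)[OF that, of n]
      by (intro integral_data[of _ n 0 1]; force)+
    have "\<bar>?E - (\<Sum>i\<in>I. h i * (\<kappa> * (\<integral>\<omega>. A i n (fst \<omega>) \<partial>\<Omega> n)))\<bar> \<le> \<delta> + (1 - (\<Sum>i\<in>I. \<kappa> * (\<integral>\<omega>. A i n (fst \<omega>) \<partial>\<Omega> n))) +
        (\<Sum>i\<in>I. \<kappa> * ((\<integral>\<omega>. B i n (fst \<omega>) \<partial>\<Omega> n) - (\<integral>\<omega>. A i n (fst \<omega>) \<partial>\<Omega> n)))"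
      by (rule BL1_outer_expectation_error[OF \<Omega> h I(1,4,5,6,3)])
         (use \<delta> AB(1) AB' in \<open>auto simp: bootstrap_space_def space_pair_measure\<close>)
    then have 2: "\<bar>?E - (\<Sum>i\<in>I. h i * (\<kappa> * ?a i n))\<bar> \<le>
        \<delta> + (1 - (\<Sum>i\<in>I. \<kappa> * ?a i n)) + (\<Sum>i\<in>I. \<kappa> * (?b i n - ?a i n))"
      by (simp add: AB'(2,4) cong: sum.cong)
    have 3: "\<bar>(\<Sum>i\<in>I. h i * (\<kappa> * ?l i n a)) - (\<Sum>i\<in>I. h i * (\<kappa> * ?a i n))\<bar> \<le>
        (\<Sum>i\<in>I. \<kappa> * (\<bar>?l i n a - ?c i\<bar> + \<bar>?a i n - ?c i\<bar>))"
      unfolding sum_subtractf[symmetric]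
    proof (rule order_trans[OF sum_abs sum_mono])
      fix i
      have "\<bar>h i * (\<kappa> * ?l i n a) - h i * (\<kappa> * ?a i n)\<bar> = \<bar>h i\<bar> * (\<kappa> * \<bar>?l i n a - ?a i n\<bar>)"
        using I(3) by (simp add: right_diff_distrib[symmetric] abs_mult)
      also have "\<dots> \<le> 1 * (\<kappa> * (\<bar>?l i n a - ?c i\<bar> + \<bar>?a i n - ?c i\<bar>))"
        using h I(3) by (intro mult_mono mult_left_mono) (auto simp: BL1_def)
      finally show "\<bar>h i * (\<kappa> * ?l i n a) - h i * (\<kappa> * ?a i n)\<bar> \<le> \<kappa> * (\<bar>?l i n a - ?c i\<bar> + \<bar>?a i n - ?c i\<bar>)" by simp
    qed
    have "W n a + w n = (\<Sum>i\<in>I. \<kappa> * (2 * \<bar>?l i n a - ?c i\<bar> + \<bar>?u i n a - ?c i\<bar>)) +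
        (\<Sum>i\<in>I. \<kappa> * (2 * \<bar>?a i n - ?c i\<bar> + \<bar>?b i n - ?c i\<bar>)) + (\<Sum>i\<in>I. \<kappa> * (\<bar>?l i n a - ?c i\<bar> + \<bar>?a i n - ?c i\<bar>))"
      by (simp add: W_def w_def sum.distrib[symmetric] algebra_simps)
    then show "\<bar>?H - ?E\<bar> \<le> 4 * \<delta> + W n a + w n"
      using 1 2 3 sum_le_of_pointwise_close[OF I(1,3,7), of "\<lambda>i. ?l i n a" "\<lambda>i. ?u i n a"]
        sum_le_of_pointwise_close[OF I(1,3,7), of "\<lambda>i. ?a i n" "\<lambda>i. ?b i n"] by linarith
  qed
  have intW: "integrable (P n) (W n)" for n
  proof -
    interpret prob_space "P n" by (rule P)
    show ?thesis unfolding W_def using sandwiched_partial_mean(3,4)[OF LU(1)] by auto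
  qed
  have limW: "(\<lambda>n. integral\<^sup>L (P n) (W n)) \<longlonglongrightarrow> 0"
  proof -
    have "integral\<^sup>L (P n) (W n) =
      (\<Sum>i\<in>I. \<kappa> * (3 * (\<integral>a. \<bar>?l i n a - ?c i\<bar> \<partial>P n) + (\<integral>a. \<bar>?u i n a - ?c i\<bar> \<partial>P n)))" for n
    proof -
      interpret prob_space "P n" by (rule P)
      show ?thesis unfolding W_def using sandwiched_partial_mean(3,4)[OF LU(1)] by simp
    qed
    moreover have "(\<lambda>n. \<Sum>i\<in>I. \<kappa> * (3 * (\<integral>a. \<bar>?l i n a - ?c i\<bar> \<partial>P n) + (\<integral>a. \<bar>?u i n a - ?c i\<bar> \<partial>P n)))
        \<longlonglongrightarrow> (\<Sum>i\<in>I. \<kappa> * (3 * 0 + 0))"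
      by (intro tendsto_intros LU(2,3))
    ultimately show ?thesis by simp
  qed
  have limw: "w \<longlonglongrightarrow> 0"
  proof -
    have "w \<longlonglongrightarrow> (\<Sum>i\<in>I. \<kappa> * (3 * \<bar>?c i - ?c i\<bar> + \<bar>?c i - ?c i\<bar>))"
      unfolding w_def by (intro tendsto_intros AB(2,3))
    then show ?thesis by simp
  qed
  show "(\<lambda>n. outer_measure_of (\<Omega> n) {\<omega> \<in> space (\<Omega> n). \<bar>case \<omega> of (a, b, c) \<Rightarrow> BL_distance n a\<bar> > \<epsilon>}) \<longlonglongrightarrow> 0"
  proof (rule tendsto_ennreal_zeroI)
    show "(\<lambda>n. 4 / \<epsilon> * integral\<^sup>L (P n) (W n)) \<longlonglongrightarrow> 0"
      using tendsto_mult[OF tendsto_const limW, of "4 / \<epsilon>"] by simp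
    have "\<forall>\<^sub>F n in sequentially. w n < \<epsilon> / 4" using limw \<epsilon> by (intro order_tendstoD) auto
    then show "\<forall>\<^sub>F n in sequentially.
        outer_measure_of (\<Omega> n) {\<omega> \<in> space (\<Omega> n). \<bar>case \<omega> of (a, b, c) \<Rightarrow> BL_distance n a\<bar> > \<epsilon>}
        \<le> ennreal (4 / \<epsilon> * integral\<^sup>L (P n) (W n))"
    proof eventually_elim
      case (elim n)
      have QQ: "prob_space (Q n \<Otimes>\<^sub>M Q n)" by (intro prob_space_pair Q)
      interpret QQ: prob_space "Q n \<Otimes>\<^sub>M Q n" by (rule QQ)
      let ?S = "{a \<in> space (P n). \<epsilon> / 4 \<le> W n a}"
      have [measurable]: "W n \<in> borel_measurable (P n)" using intW by (rule borel_measurable_integrable)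
      have S: "?S \<in> sets (P n)" by measurable
      \<comment> \<open>The exceptional set, possibly nonmeasurable, is covered by a measurable
        cylinder over the data.\<close>
      have "{\<omega> \<in> space (\<Omega> n). \<bar>case \<omega> of (a, b, c) \<Rightarrow> BL_distance n a\<bar> > \<epsilon>} \<subseteq> ?S \<times> space (Q n \<Otimes>\<^sub>M Q n)"
      proof
        fix \<omega> assume "\<omega> \<in> {\<omega> \<in> space (\<Omega> n). \<bar>case \<omega> of (a, b, c) \<Rightarrow> BL_distance n a\<bar> > \<epsilon>}"
        then have \<omega>': "\<omega> \<in> space (\<Omega> n)" "\<epsilon> < \<bar>BL_distance n (fst \<omega>)\<bar>"
          by (auto simp: case_prod_unfold)
        moreover obtain a p where "\<omega> = (a, p)" by (cases \<omega>)
        ultimately have \<omega>: "\<omega> = (a, p)" "a \<in> space (P n)" "p \<in> space (Q n \<Otimes>\<^sub>M Q n)"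
          by (auto simp: bootstrap_space_def space_pair_measure)
        have "\<epsilon> < BL_distance n a"
          using \<omega>'(2) unfolding \<omega>(1) fst_conv abs_of_nonneg[OF BL_distance_nonneg] .
        then have "\<epsilon> / 4 \<le> W n a" using BL[OF \<omega>(2)] elim unfolding \<delta>_def by linarith
        then show "\<omega> \<in> ?S \<times> space (Q n \<Otimes>\<^sub>M Q n)" using \<omega> by simp
      qed
      then have "outer_measure_of (\<Omega> n) {\<omega> \<in> space (\<Omega> n). \<bar>case \<omega> of (a, b, c) \<Rightarrow> BL_distance n a\<bar> > \<epsilon>} \<le>
          outer_measure_of (\<Omega> n) (?S \<times> space (Q n \<Otimes>\<^sub>M Q n))" by (rule outer_measure_of_mono)
      also have "\<dots> = emeasure (P n \<Otimes>\<^sub>M Q n \<Otimes>\<^sub>M Q n) (?S \<times> space (Q n \<Otimes>\<^sub>M Q n))"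
        unfolding bootstrap_space_def using S by (intro outer_measure_of_eq) auto
      also have "\<dots> = emeasure (P n) ?S"
        using S by (subst QQ.emeasure_pair_measure_Times) (auto simp: QQ.emeasure_space_1)
      also have "\<dots> \<le> ennreal (1 / (\<epsilon>/4) * integral\<^sup>L (P n) (W n))"
        using \<epsilon> I(3) by (intro integral_Markov_inequality intW AE_I2) (auto simp: W_def intro!: sum_nonneg)
      finally show ?case by simp
    qed
  qed
qed

theorem conditional_iff_joint:
  "tendsto_zero_outer_prob \<Omega> (\<lambda>n (a, b, c). BL_distance n a) \<and> asymptotically_measurable \<Omega> G1 \<longleftrightarrow>
    weakly_equivalent \<Omega> triple (\<lambda>n. three_space (\<Omega> n)) (\<lambda>n. three_copies (G n))"
proof
  assume "tendsto_zero_outer_prob \<Omega> (\<lambda>n (a, b, c). BL_distance n a) \<and> asymptotically_measurable \<Omega> G1"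
  then show "weakly_equivalent \<Omega> triple (\<lambda>n. three_space (\<Omega> n)) (\<lambda>n. three_copies (G n))"
    by (intro conditionally_convergent_imp_joint conditional_imp_conditionally_convergent) auto
next
  assume j: "weakly_equivalent \<Omega> triple (\<lambda>n. three_space (\<Omega> n)) (\<lambda>n. three_copies (G n))"
  have "asymptotically_measurable \<Omega> G1"
    unfolding asymptotically_measurable_def
  proof
    fix f :: "'d \<Rightarrow> real" assume f: "f \<in> bounded_continuous"
    show "(\<lambda>n. outer_expectation (\<Omega> n) (\<lambda>\<omega>. f (G1 n \<omega>)) -
        inner_expectation (\<Omega> n) (\<lambda>\<omega>. f (G1 n \<omega>))) \<longlonglongrightarrow> 0"
      using tendsto_diff[OF joint_imp_outer_G1[OF j f] joint_imp_inner_G1[OF j f]] by simp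
  qed
  then show "tendsto_zero_outer_prob \<Omega> (\<lambda>n (a, b, c). BL_distance n a) \<and> asymptotically_measurable \<Omega> G1"
    using conditionally_convergent_imp_conditional joint_imp_conditionally_convergent[OF j] by blast
qed

end

section \<open>Passage to subsequences\<close>

lemma tendsto_zero_outer_prob_subsequence:
  assumes "tendsto_zero_outer_prob M Z" "strict_mono (q :: nat \<Rightarrow> nat)"
  shows "tendsto_zero_outer_prob (\<lambda>n. M (q n)) (\<lambda>n. Z (q n))"
  unfolding tendsto_zero_outer_prob_def
proof (intro allI impI)
  fix \<epsilon> :: real assume *: "0 < \<epsilon>"
  from assms(1) * have "(\<lambda>n. outer_measure_of (M n) {\<omega> \<in> space (M n). \<epsilon> < \<bar>Z n \<omega>\<bar>}) \<longlonglongrightarrow> 0"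
    unfolding tendsto_zero_outer_prob_def by blast
  from LIMSEQ_subseq_LIMSEQ[OF this assms(2)]
  show "(\<lambda>n. outer_measure_of (M (q n)) {\<omega> \<in> space (M (q n)). \<epsilon> < \<bar>Z (q n) \<omega>\<bar>}) \<longlonglongrightarrow> 0"
    by (simp add: o_def)
qed

lemma asymptotically_measurable_subsequence:
  assumes "asymptotically_measurable M Y" "strict_mono (q :: nat \<Rightarrow> nat)"
  shows "asymptotically_measurable (\<lambda>n. M (q n)) (\<lambda>n. Y (q n))"
  unfolding asymptotically_measurable_def
proof (intro ballI)
  fix f :: "'b \<Rightarrow> real" assume *: "f \<in> bounded_continuous"
  from assms(1) * have "(\<lambda>n. outer_expectation (M n) (\<lambda>\<omega>. f (Y n \<omega>)) - inner_expectation (M n) (\<lambda>\<omega>. f (Y n \<omega>))) \<longlonglongrightarrow> 0"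
    unfolding asymptotically_measurable_def by blast
  from LIMSEQ_subseq_LIMSEQ[OF this assms(2)]
  show "(\<lambda>n. outer_expectation (M (q n)) (\<lambda>\<omega>. f (Y (q n) \<omega>)) - inner_expectation (M (q n)) (\<lambda>\<omega>. f (Y (q n) \<omega>))) \<longlonglongrightarrow> 0"
    by (simp add: o_def)
qed

lemma weakly_equivalent_subsequence:
  assumes "weakly_equivalent M Y N Z" "strict_mono (q :: nat \<Rightarrow> nat)"
  shows "weakly_equivalent (\<lambda>n. M (q n)) (\<lambda>n. Y (q n)) (\<lambda>n. N (q n)) (\<lambda>n. Z (q n))"
  unfolding weakly_equivalent_def
proof (intro ballI)
  fix f :: "'b \<Rightarrow> real" assume *: "f \<in> bounded_continuous"
  from assms(1) * have "(\<lambda>n. \<bar>outer_expectation (M n) (\<lambda>\<omega>. f (Y n \<omega>)) - outer_expectation (N n) (\<lambda>\<omega>. f (Z n \<omega>))\<bar>) \<longlonglongrightarrow> 0"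
    unfolding weakly_equivalent_def by blast
  from LIMSEQ_subseq_LIMSEQ[OF this assms(2)]
  show "(\<lambda>n. \<bar>outer_expectation (M (q n)) (\<lambda>\<omega>. f (Y (q n) \<omega>)) - outer_expectation (N (q n)) (\<lambda>\<omega>. f (Z (q n) \<omega>))\<bar>) \<longlonglongrightarrow> 0"
    by (simp add: o_def)
qed

lemma tendsto_zero_outer_prob_by_subsequences:
  assumes "\<And>r :: nat \<Rightarrow> nat. strict_mono r \<Longrightarrow>
    \<exists>s :: nat \<Rightarrow> nat. strict_mono s \<and> tendsto_zero_outer_prob (\<lambda>n. M (r (s n))) (\<lambda>n. Z (r (s n)))"
  shows "tendsto_zero_outer_prob M Z"
  unfolding tendsto_zero_outer_prob_def
proof (intro allI impI tendsto_by_subsequences)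
  fix \<epsilon> :: real and r :: "nat \<Rightarrow> nat" assume "0 < \<epsilon>" "strict_mono r"
  then show "\<exists>s :: nat \<Rightarrow> nat. strict_mono s \<and>
      (\<lambda>n. outer_measure_of (M (r (s n))) {\<omega> \<in> space (M (r (s n))). \<epsilon> < \<bar>Z (r (s n)) \<omega>\<bar>}) \<longlonglongrightarrow> 0"
    using assms[of r] unfolding tendsto_zero_outer_prob_def by blast
qed

lemma asymptotically_measurable_by_subsequences:
  assumes "\<And>r :: nat \<Rightarrow> nat. strict_mono r \<Longrightarrow>
    \<exists>s :: nat \<Rightarrow> nat. strict_mono s \<and> asymptotically_measurable (\<lambda>n. M (r (s n))) (\<lambda>n. Y (r (s n)))"
  shows "asymptotically_measurable M Y"
  unfolding asymptotically_measurable_def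
proof (intro ballI tendsto_by_subsequences)
  fix f :: "'b \<Rightarrow> real" and r :: "nat \<Rightarrow> nat" assume "f \<in> bounded_continuous" "strict_mono r"
  then show "\<exists>s :: nat \<Rightarrow> nat. strict_mono s \<and> (\<lambda>n. outer_expectation (M (r (s n))) (\<lambda>\<omega>. f (Y (r (s n)) \<omega>)) -
      inner_expectation (M (r (s n))) (\<lambda>\<omega>. f (Y (r (s n)) \<omega>))) \<longlonglongrightarrow> 0"
    using assms[of r] unfolding asymptotically_measurable_def by blast
qed

lemma weakly_equivalent_by_subsequences:
  assumes "\<And>r :: nat \<Rightarrow> nat. strict_mono r \<Longrightarrow> \<exists>s :: nat \<Rightarrow> nat. strict_mono s \<and>
    weakly_equivalent (\<lambda>n. M (r (s n))) (\<lambda>n. Y (r (s n))) (\<lambda>n. N (r (s n))) (\<lambda>n. Z (r (s n)))"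
  shows "weakly_equivalent M Y N Z"
  unfolding weakly_equivalent_def
proof (intro ballI tendsto_by_subsequences)
  fix f :: "'b \<Rightarrow> real" and r :: "nat \<Rightarrow> nat" assume "f \<in> bounded_continuous" "strict_mono r"
  then show "\<exists>s :: nat \<Rightarrow> nat. strict_mono s \<and> (\<lambda>n. \<bar>outer_expectation (M (r (s n))) (\<lambda>\<omega>. f (Y (r (s n)) \<omega>)) -
      outer_expectation (N (r (s n))) (\<lambda>\<omega>. f (Z (r (s n)) \<omega>))\<bar>) \<longlonglongrightarrow> 0"
    using assms[of r] unfolding weakly_equivalent_def by blast
qed

theorem proposition4p1:
  fixes P :: "nat \<Rightarrow> 'a measure" and Q :: "nat \<Rightarrow> 'b measure"
    and \<X> :: "nat \<Rightarrow> 'x measure" and \<V> :: "nat \<Rightarrow> 'v measure"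
    and X :: "nat \<Rightarrow> 'a \<Rightarrow> 'x" and V :: "nat \<Rightarrow> 'b \<Rightarrow> 'v"
    and g :: "nat \<Rightarrow> 'x \<Rightarrow> 't linf" and gb :: "nat \<Rightarrow> 'x \<Rightarrow> 'v \<Rightarrow> 't linf"
    and \<Omega> :: "nat \<Rightarrow> ('a \<times> 'b \<times> 'b) measure"
    and G G1 G2 :: "nat \<Rightarrow> 'a \<times> 'b \<times> 'b \<Rightarrow> 't linf"
  assumes "\<And>n. prob_space (P n)" and "\<And>n. prob_space (Q n)"
    and "\<And>n. X n \<in> P n \<rightarrow>\<^sub>M \<X> n" and "\<And>n. V n \<in> Q n \<rightarrow>\<^sub>M \<V> n"
    and "\<And>n. \<Omega> n = bootstrap_space (P n) (Q n)"
    and "\<And>n a b1 b2. G n (a, b1, b2) = g n (X n a)"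
    and "\<And>n a b1 b2. G1 n (a, b1, b2) = gb n (X n a) (V n b1)"
    and "\<And>n a b1 b2. G2 n (a, b1, b2) = gb n (X n a) (V n b2)"
    and "\<And>n t. (\<lambda>\<omega>. coord (G n \<omega>) t) \<in> borel_measurable (\<Omega> n)"
    and "\<And>n t. (\<lambda>\<omega>. coord (G1 n \<omega>) t) \<in> borel_measurable (\<Omega> n)"
    and "\<And>n t. (\<lambda>\<omega>. coord (G2 n \<omega>) t) \<in> borel_measurable (\<Omega> n)"
    and "relatively_compact \<Omega> G"
  shows
    "(tendsto_zero_outer_prob \<Omega>
        (\<lambda>n (a, _, _). SUP h\<in>BL1.
           \<bar>outer_expectation (Q n) (\<lambda>b. h (gb n (X n a) (V n b)))
            - outer_expectation (\<Omega> n) (\<lambda>\<omega>. h (G n \<omega>))\<bar>)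
      \<and> asymptotically_measurable \<Omega> G1)
     \<longleftrightarrow>
     weakly_equivalent
       \<Omega> (\<lambda>n \<omega>. (G n \<omega>, G1 n \<omega>, G2 n \<omega>))
       (\<lambda>n. three_space (\<Omega> n)) (\<lambda>n. three_copies (G n))"
proof -
  \<comment> \<open>The maps see the data only through \<open>X n a\<close> and the weights only
    through \<open>V n b\<close>, so both random variables can be absorbed into maps on the
    underlying spaces. Conditioning on the data then means holding \<open>a\<close> fixed.\<close>
  define \<gamma> where "\<gamma> n a = g n (X n a)" for n a
  define \<beta> where "\<beta> n a b = gb n (X n a) (V n b)" for n a b
  have \<Omega>: "\<Omega> = (\<lambda>n. bootstrap_space (P n) (Q n))" using assms(5) by blast
  have G: "G = (\<lambda>n (a, b, c). \<gamma> n a)" using assms(6) by (auto simp: fun_eq_iff \<gamma>_def)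
  have G1: "G1 = (\<lambda>n (a, b, c). \<beta> n a b)" using assms(7) by (auto simp: fun_eq_iff \<beta>_def)
  have triple: "(\<lambda>n \<omega>. (G n \<omega>, G1 n \<omega>, G2 n \<omega>)) = (\<lambda>n (a, b, c). (\<gamma> n a, \<beta> n a b, \<beta> n a c))"
    using assms(8) by (auto simp: fun_eq_iff \<beta>_def G G1)
  let ?Z = "\<lambda>n (a, b :: 'b, c :: 'b). SUP h\<in>BL1. \<bar>outer_expectation (Q n) (\<lambda>b. h (\<beta> n a b)) -
      outer_expectation (\<Omega> n) (\<lambda>\<omega>. h (G n \<omega>))\<bar>"
  let ?W = "\<lambda>n (a, b, c). (\<gamma> n a, \<beta> n a b, \<beta> n a c)"
  \<comment> \<open>What is obtained along the further subsequence is the whole equivalence, so this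
    one fact serves both directions of the final argument.\<close>
  have sub: "\<exists>s :: nat \<Rightarrow> nat. strict_mono s \<and>
      (tendsto_zero_outer_prob (\<lambda>n. \<Omega> (r (s n))) (\<lambda>n. ?Z (r (s n))) \<and>
        asymptotically_measurable (\<lambda>n. \<Omega> (r (s n))) (\<lambda>n. G1 (r (s n))) \<longleftrightarrow>
       weakly_equivalent (\<lambda>n. \<Omega> (r (s n))) (\<lambda>n. ?W (r (s n)))
         (\<lambda>n. three_space (\<Omega> (r (s n)))) (\<lambda>n. three_copies (G (r (s n)))))"
    if r: "strict_mono r" for r :: "nat \<Rightarrow> nat"
  proof -
    obtain s \<mu> where s: "strict_mono (s :: nat \<Rightarrow> nat)" "tight_law \<mu>"
      "converges_weakly (\<lambda>n. \<Omega> (r (s n))) (\<lambda>n. G (r (s n))) \<mu>"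
      using assms(12) r unfolding relatively_compact_def by blast
    have "bootstrap_limit (\<lambda>n. P (r (s n))) (\<lambda>n. Q (r (s n))) (\<lambda>n. \<gamma> (r (s n))) \<mu>"
      by (rule bootstrap_limit.intro[OF assms(1,2) s(2) s(3)[unfolded \<Omega> G]])
    from bootstrap_limit.conditional_iff_joint[OF this, of "\<lambda>n. \<beta> (r (s n))"] s(1) show ?thesis
      unfolding \<Omega> G G1 by (intro exI[of _ s] conjI)
  qed
  have "(tendsto_zero_outer_prob \<Omega> ?Z \<and> asymptotically_measurable \<Omega> G1) \<longleftrightarrow>
    weakly_equivalent \<Omega> ?W (\<lambda>n. three_space (\<Omega> n)) (\<lambda>n. three_copies (G n))" (is "?A \<and> ?B \<longleftrightarrow> ?C")
  proof
    assume i: "?A \<and> ?B"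
    show ?C
    proof (rule weakly_equivalent_by_subsequences)
      fix r :: "nat \<Rightarrow> nat" assume r: "strict_mono r"
      obtain s :: "nat \<Rightarrow> nat" where s: "strict_mono s"
        "tendsto_zero_outer_prob (\<lambda>n. \<Omega> (r (s n))) (\<lambda>n. ?Z (r (s n))) \<and>
          asymptotically_measurable (\<lambda>n. \<Omega> (r (s n))) (\<lambda>n. G1 (r (s n))) \<longleftrightarrow>
         weakly_equivalent (\<lambda>n. \<Omega> (r (s n))) (\<lambda>n. ?W (r (s n)))
           (\<lambda>n. three_space (\<Omega> (r (s n)))) (\<lambda>n. three_copies (G (r (s n))))"
        using sub[OF r] by blast
      have q: "strict_mono (\<lambda>n. r (s n))" using strict_mono_o[OF r s(1)] by (simp add: o_def)
      show "\<exists>s :: nat \<Rightarrow> nat. strict_mono s \<and> weakly_equivalent (\<lambda>n. \<Omega> (r (s n))) (\<lambda>n. ?W (r (s n)))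
           (\<lambda>n. three_space (\<Omega> (r (s n)))) (\<lambda>n. three_copies (G (r (s n))))"
        using s tendsto_zero_outer_prob_subsequence[OF conjunct1[OF i] q]
          asymptotically_measurable_subsequence[OF conjunct2[OF i] q] by blast
    qed
  next
    assume ii: ?C
    have sub': "\<exists>s :: nat \<Rightarrow> nat. strict_mono s \<and> tendsto_zero_outer_prob (\<lambda>n. \<Omega> (r (s n))) (\<lambda>n. ?Z (r (s n))) \<and>
        asymptotically_measurable (\<lambda>n. \<Omega> (r (s n))) (\<lambda>n. G1 (r (s n)))"
      if r: "strict_mono r" for r :: "nat \<Rightarrow> nat"
    proof -
      obtain s :: "nat \<Rightarrow> nat" where s: "strict_mono s"
        "tendsto_zero_outer_prob (\<lambda>n. \<Omega> (r (s n))) (\<lambda>n. ?Z (r (s n))) \<and>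
          asymptotically_measurable (\<lambda>n. \<Omega> (r (s n))) (\<lambda>n. G1 (r (s n))) \<longleftrightarrow>
         weakly_equivalent (\<lambda>n. \<Omega> (r (s n))) (\<lambda>n. ?W (r (s n)))
           (\<lambda>n. three_space (\<Omega> (r (s n)))) (\<lambda>n. three_copies (G (r (s n))))"
        using sub[OF r] by blast
      have q: "strict_mono (\<lambda>n. r (s n))" using strict_mono_o[OF r s(1)] by (simp add: o_def)
      show ?thesis using s weakly_equivalent_subsequence[OF ii q] by blast
    qed
    show "?A \<and> ?B"
      using tendsto_zero_outer_prob_by_subsequences[of \<Omega> ?Z]
        asymptotically_measurable_by_subsequences[of \<Omega> G1] sub' by blast
  qed
  then show ?thesis unfolding triple by (simp only: \<beta>_def)
qed

end
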